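(* There exist $\mu>0$ (sufficiently large), $\delta_0>0$ and $C>0$, independent of $k$, such that for every time mesh with $k-k_{\min}\le\delta_0$ the following holds. Let $f\in L^\infty(I;L^2(\Omega))$, let $u_0\in H^1_0(\Omega)$ with $A_{k,m}u_0\in L^2(\Omega)$ for all $m=1,\dots,M$, and let $u_k\in X_k^0$ be the dG(0) semidiscrete solution with data $f,u_0$. Then $$\max_{1\le m\le M}\left(\|A_{k,m}u_{k,m}\|_{L^2(\Omega)}+\left\|\frac{[u_k]_{m-1}}{k_m}\right\|_{L^2(\Omega)}\right)\le Ce^{\mu T}\left(\ln\frac{T}{k}\,\|f\|_{L^\infty(I;L^2(\Omega))}+\mu T\max_{1\le m\le M}\|A_{k,m}u_0\|_{L^2(\Omega)}\right).$$
   Context: Problem data. $\Omega\subset\mathbb R^d$, $d\ge1$, is a bounded Lipschitz domain, $T>0$, $I=(0,T)$. The coefficients $a_{ij}\in L^\infty(I\times\Omega)$ ($1\le i,j\le d$) satisfy $a_{ij}=a_{ji}$ and $\sum_{i,j}a_{ij}(t,x)\xi_i\xi_j\ge\alpha|\xi|^2$ for all $\xi\in\mathbb R^d$ and a.e. $(t,x)$, with a constant $\alpha>0$; they are continuous in $t$ on $\bar I$ for almost all $x$, and $|a_{ij}(t_1,x)-a_{ij}(t_2,x)|\le\omega(|t_1-t_2|)$ for all $t_1,t_2\in\bar I$ and almost all $x\in\Omega$, where $\omega:[0,T]\to[0,\infty)$ is nondecreasing, $\omega(t)/t^{3/2}$ is non-increasing on $(0,T]$, and $\int_0^T\omega(t)t^{-3/2}\,dt<\infty$.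 For $u,v\in H^1_0(\Omega)$ set $a(t;u,v)=\int_\Omega\sum_{i,j}a_{ij}(t,x)\partial_iu\,\partial_jv\,dx$, and let $A(t):H^1_0(\Omega)\to H^{-1}(\Omega)$ be given by $\langle A(t)u,v\rangle=a(t;u,v)$. Time meshes. $0=t_0<t_1<\dots<t_M=T$, $I_m=(t_{m-1},t_m]$, $k_m=t_m-t_{m-1}$, $k=\max_mk_m$, $k_{\min}=\min_mk_m$. All meshes satisfy, with fixed constants $c,\beta,\kappa>0$: (i) $k_{\min}\ge ck^\beta$; (ii) $\kappa^{-1}\le k_m/k_{m+1}\le\kappa$ for $1\le m\le M-1$; (iii) $k\le T/4$. Discretization. $X_k^0$ is the space of functions $v_k\in L^2(I;H^1_0(\Omega))$ that are constant in time on each $I_m$; $v_{k,m}:=v_k|_{I_m}$. $A_{k,m}=\frac1{k_m}\int_{I_m}A(t)\,dt:H^1_0(\Omega)\to H^{-1}(\Omega)$. The dG(0) semidiscrete solution $u_k\in X_k^0$ with data $f,u_0$ is defined by $$\int_Ia(t;u_k,\varphi_k)\,dt+\sum_{m=2}^M(u_{k,m}-u_{k,m-1},\varphi_{k,m})_\Omega+(u_{k,1},\varphi_{k,1})_\Omega=\int_I(f,\varphi_k)_\Omega\,dt+(u_0,\varphi_{k,1})_\Omega\quad\forall\varphi_k\in X_k^0 .$$ Jumps: $[u_k]_m=u_{k,m+1}-u_{k,m}$ for $1\le m\le M-1$, and $[u_k]_0=u_{k,1}-u_0$. "Independent of $k$" means: depending only on $\Omega,d,T$, the coefficients $a_{ij}$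 (including $\alpha,\omega$) and $c,\beta,\kappa$, and not otherwise on the time mesh, nor on $f,u_0$. *)

theory Defs
  imports "HOL-Probability.Essential_Supremum"
begin

section \<open>Lipschitz domains\<close>

text \<open>
  Near each boundary point the set is, after a rigid motion, the region strictly above the graph
  of a Lipschitz function.  The unit vector \<open>e\<close> is the vertical direction, \<open>\<gamma>\<close> is defined on the
  hyperplane orthogonal to \<open>e\<close>, and \<open>x - (x \<bullet> e) e\<close> is the horizontal part of \<open>x\<close>.
\<close>
definition bounded_lipschitz_domain :: "(real ^ 'n::finite) set \<Rightarrow> bool" where
  "bounded_lipschitz_domain \<Omega> \<longleftrightarrow>
     open \<Omega> \<and> connected \<Omega> \<and> \<Omega> \<noteq> {} \<and> bounded \<Omega> \<and>
     (\<forall>p\<in>frontier \<Omega>. \<exists>e \<gamma> L r. norm e = 1 \<and> r > 0 \<and> L-lipschitz_on {y. y \<bullet> e = 0} \<gamma> \<and>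
        \<Omega> \<inter> ball p r = {x \<in> ball p r. x \<bullet> e > \<gamma> (x - (x \<bullet> e) *\<^sub>R e)})"

section \<open>Function spaces on a domain\<close>

text \<open>
  Elements of \<open>L\<^sup>2(\<Omega>)\<close> and of the Sobolev spaces are represented by functions on the whole space, of
  which only the restriction to \<open>\<Omega>\<close>, up to null sets, matters.
\<close>

definition L2_space :: "(real ^ 'n::finite) set \<Rightarrow> (real ^ 'n \<Rightarrow> real) set" where
  "L2_space \<Omega> = {u \<in> borel_measurable (lebesgue_on \<Omega>). integrable (lebesgue_on \<Omega>) (\<lambda>x. (u x)\<^sup>2)}"

definition L2_inner :: "(real ^ 'n::finite) set \<Rightarrow> (real ^ 'n \<Rightarrow> real) \<Rightarrow> (real ^ 'n \<Rightarrow> real) \<Rightarrow> real" where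
  "L2_inner \<Omega> u v = (LINT x|lebesgue_on \<Omega>. u x * v x)"

definition L2_norm :: "(real ^ 'n::finite) set \<Rightarrow> (real ^ 'n \<Rightarrow> real) \<Rightarrow> real" where
  "L2_norm \<Omega> u = sqrt (L2_inner \<Omega> u u)"

definition partial :: "'n \<Rightarrow> (real ^ 'n::finite \<Rightarrow> real) \<Rightarrow> real ^ 'n \<Rightarrow> real" where
  "partial i \<phi> x = frechet_derivative \<phi> (at x) (axis i 1)"

primrec C_k :: "nat \<Rightarrow> (real ^ 'n::finite \<Rightarrow> real) \<Rightarrow> bool" where
  "C_k 0 \<phi> \<longleftrightarrow> continuous_on UNIV \<phi>"
| "C_k (Suc k) \<phi> \<longleftrightarrow> (\<forall>x. \<phi> differentiable (at x)) \<and> (\<forall>i. C_k k (partial i \<phi>))"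

definition test_functions :: "(real ^ 'n::finite) set \<Rightarrow> (real ^ 'n \<Rightarrow> real) set" where
  "test_functions \<Omega> =
     {\<phi>. (\<forall>k. C_k k \<phi>) \<and> compact (closure {x. \<phi> x \<noteq> 0}) \<and> closure {x. \<phi> x \<noteq> 0} \<subseteq> \<Omega>}"

definition is_weak_partial ::
  "(real ^ 'n::finite) set \<Rightarrow> 'n \<Rightarrow> (real ^ 'n \<Rightarrow> real) \<Rightarrow> (real ^ 'n \<Rightarrow> real) \<Rightarrow> bool" where
  "is_weak_partial \<Omega> i u g \<longleftrightarrow>
     (\<forall>\<phi>\<in>test_functions \<Omega>. L2_inner \<Omega> u (partial i \<phi>) = - L2_inner \<Omega> g \<phi>)"

definition weak_partial ::
  "(real ^ 'n::finite) set \<Rightarrow> 'n \<Rightarrow> (real ^ 'n \<Rightarrow> real) \<Rightarrow> real ^ 'n \<Rightarrow> real" where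
  "weak_partial \<Omega> i u = (SOME g. g \<in> L2_space \<Omega> \<and> is_weak_partial \<Omega> i u g)"

definition H1_space :: "(real ^ 'n::finite) set \<Rightarrow> (real ^ 'n \<Rightarrow> real) set" where
  "H1_space \<Omega> = {u \<in> L2_space \<Omega>. \<forall>i. \<exists>g\<in>L2_space \<Omega>. is_weak_partial \<Omega> i u g}"

definition H1_norm :: "(real ^ 'n::finite) set \<Rightarrow> (real ^ 'n \<Rightarrow> real) \<Rightarrow> real" where
  "H1_norm \<Omega> u = sqrt ((L2_norm \<Omega> u)\<^sup>2 + (\<Sum>i\<in>UNIV. (L2_norm \<Omega> (weak_partial \<Omega> i u))\<^sup>2))"

definition H10_space :: "(real ^ 'n::finite) set \<Rightarrow> (real ^ 'n \<Rightarrow> real) set" where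
  "H10_space \<Omega> = {u \<in> H1_space \<Omega>. \<exists>\<phi>. (\<forall>n. \<phi> n \<in> test_functions \<Omega>) \<and>
     (\<lambda>n. H1_norm \<Omega> (\<lambda>x. \<phi> n x - u x)) \<longlonglongrightarrow> 0}"

definition essentially_bounded :: "'a measure \<Rightarrow> ('a \<Rightarrow> real) \<Rightarrow> bool" where
  "essentially_bounded M g \<longleftrightarrow>
     g \<in> borel_measurable M \<and> esssup M (\<lambda>x. ereal \<bar>g x\<bar>) < \<infinity>"

text \<open>Bochner (strong) measurability: a.e. limit of simple functions with values in \<open>L\<^sup>2(\<Omega>)\<close>.\<close>
definition strongly_measurable_L2 ::
  "real set \<Rightarrow> (real ^ 'n::finite) set \<Rightarrow> (real \<Rightarrow> real ^ 'n \<Rightarrow> real) \<Rightarrow> bool" where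
  "strongly_measurable_L2 J \<Omega> f \<longleftrightarrow>
     (\<exists>s. (\<forall>n. simple_function (lebesgue_on J) (s n)) \<and> (\<forall>n. \<forall>t\<in>J. s n t \<in> L2_space \<Omega>) \<and>
        (AE t in lebesgue_on J. (\<lambda>n. L2_norm \<Omega> (\<lambda>x. s n t x - f t x)) \<longlonglongrightarrow> 0))"

definition Linfty_L2_norm ::
  "real set \<Rightarrow> (real ^ 'n::finite) set \<Rightarrow> (real \<Rightarrow> real ^ 'n \<Rightarrow> real) \<Rightarrow> real" where
  "Linfty_L2_norm J \<Omega> f = real_of_ereal (esssup (lebesgue_on J) (\<lambda>t. ereal (L2_norm \<Omega> (f t))))"

definition Linfty_L2_space ::
  "real set \<Rightarrow> (real ^ 'n::finite) set \<Rightarrow> (real \<Rightarrow> real ^ 'n \<Rightarrow> real) set" where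
  "Linfty_L2_space J \<Omega> =
     {f. (\<forall>t\<in>J. f t \<in> L2_space \<Omega>) \<and> strongly_measurable_L2 J \<Omega> f \<and>
         esssup (lebesgue_on J) (\<lambda>t. ereal (L2_norm \<Omega> (f t))) < \<infinity>}"

section \<open>The elliptic operator\<close>

definition admissible_modulus :: "real \<Rightarrow> (real \<Rightarrow> real) \<Rightarrow> bool" where
  "admissible_modulus T \<omega> \<longleftrightarrow>
     (\<forall>t\<in>{0..T}. 0 \<le> \<omega> t) \<and> mono_on {0..T} \<omega> \<and>
     antimono_on {0<..T} (\<lambda>t. \<omega> t / t powr (3/2)) \<and>
     set_integrable lborel {0<..T} (\<lambda>t. \<omega> t * t powr (-3/2))"

definition admissible_coefficients ::
  "(real ^ 'n::finite) set \<Rightarrow> real \<Rightarrow> real \<Rightarrow> (real \<Rightarrow> real) \<Rightarrow>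
   ('n \<Rightarrow> 'n \<Rightarrow> real \<Rightarrow> real ^ 'n \<Rightarrow> real) \<Rightarrow> bool" where
  "admissible_coefficients \<Omega> T \<alpha> \<omega> a \<longleftrightarrow>
     (\<forall>i j. essentially_bounded (lebesgue_on ({0<..<T} \<times> \<Omega>)) (\<lambda>(t, x). a i j t x)) \<and>
     (AE (t, x) in lebesgue_on ({0<..<T} \<times> \<Omega>). \<forall>i j. a i j t x = a j i t x) \<and>
     (AE (t, x) in lebesgue_on ({0<..<T} \<times> \<Omega>).
        \<forall>\<xi>. (\<Sum>i\<in>UNIV. \<Sum>j\<in>UNIV. a i j t x * \<xi> $ i * \<xi> $ j) \<ge> \<alpha> * (norm \<xi>)\<^sup>2) \<and>
     (AE x in lebesgue_on \<Omega>. \<forall>i j. continuous_on {0..T} (\<lambda>t. a i j t x)) \<and>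
     (\<forall>i j. \<forall>t\<^sub>1\<in>{0..T}. \<forall>t\<^sub>2\<in>{0..T}.
        AE x in lebesgue_on \<Omega>. \<bar>a i j t\<^sub>1 x - a i j t\<^sub>2 x\<bar> \<le> \<omega> \<bar>t\<^sub>1 - t\<^sub>2\<bar>)"

definition a_form ::
  "(real ^ 'n::finite) set \<Rightarrow> ('n \<Rightarrow> 'n \<Rightarrow> real \<Rightarrow> real ^ 'n \<Rightarrow> real) \<Rightarrow>
   real \<Rightarrow> (real ^ 'n \<Rightarrow> real) \<Rightarrow> (real ^ 'n \<Rightarrow> real) \<Rightarrow> real" where
  "a_form \<Omega> a t u v =
     (LINT x|lebesgue_on \<Omega>. (\<Sum>i\<in>UNIV. \<Sum>j\<in>UNIV.
        a i j t x * weak_partial \<Omega> i u x * weak_partial \<Omega> j v x))"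

text \<open>
  An element of \<open>H\<^sup>-\<^sup>1(\<Omega>)\<close> is given by its values on \<open>H\<^sup>1\<^sub>0(\<Omega>)\<close>; thus \<open>A_op \<Omega> a t u\<close> is the
  functional \<open>A(t)u\<close>, and the mean value \<open>A\<^sub>k\<^sub>,\<^sub>m\<close> of \<open>A\<close> over a time interval \<open>(s, r]\<close> is evaluated
  by pulling the application to \<open>u\<close> and \<open>v\<close> under the operator-valued integral.
\<close>
definition A_op ::
  "(real ^ 'n::finite) set \<Rightarrow> ('n \<Rightarrow> 'n \<Rightarrow> real \<Rightarrow> real ^ 'n \<Rightarrow> real) \<Rightarrow>
   real \<Rightarrow> (real ^ 'n \<Rightarrow> real) \<Rightarrow> (real ^ 'n \<Rightarrow> real) \<Rightarrow> real" where
  "A_op \<Omega> a t u = (\<lambda>v. a_form \<Omega> a t u v)"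

definition A_mean ::
  "(real ^ 'n::finite) set \<Rightarrow> ('n \<Rightarrow> 'n \<Rightarrow> real \<Rightarrow> real ^ 'n \<Rightarrow> real) \<Rightarrow>
   (nat \<Rightarrow> real) \<Rightarrow> nat \<Rightarrow> (real ^ 'n \<Rightarrow> real) \<Rightarrow> (real ^ 'n \<Rightarrow> real) \<Rightarrow> real" where
  "A_mean \<Omega> a \<tau> m u = (\<lambda>v. 1 / (\<tau> m - \<tau> (m - 1)) *
     (LINT t|lebesgue_on {\<tau> (m - 1)<..\<tau> m}. A_op \<Omega> a t u v))"

text \<open>
  \<open>H\<^sup>-\<^sup>1(\<Omega>)\<close> contains \<open>L\<^sup>2(\<Omega>)\<close> through the \<open>L\<^sup>2\<close> inner product; \<open>F \<in> L\<^sup>2(\<Omega>)\<close> for a functional \<open>F\<close>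
  refers to this embedding.
\<close>
definition represented_by ::
  "(real ^ 'n::finite) set \<Rightarrow> ((real ^ 'n \<Rightarrow> real) \<Rightarrow> real) \<Rightarrow> (real ^ 'n \<Rightarrow> real) \<Rightarrow> bool" where
  "represented_by \<Omega> F g \<longleftrightarrow> g \<in> L2_space \<Omega> \<and> (\<forall>v\<in>H10_space \<Omega>. F v = L2_inner \<Omega> g v)"

definition functional_in_L2 :: "(real ^ 'n::finite) set \<Rightarrow> ((real ^ 'n \<Rightarrow> real) \<Rightarrow> real) \<Rightarrow> bool" where
  "functional_in_L2 \<Omega> F \<longleftrightarrow> (\<exists>g. represented_by \<Omega> F g)"

definition functional_L2_norm :: "(real ^ 'n::finite) set \<Rightarrow> ((real ^ 'n \<Rightarrow> real) \<Rightarrow> real) \<Rightarrow> real" where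
  "functional_L2_norm \<Omega> F = L2_norm \<Omega> (SOME g. represented_by \<Omega> F g)"

section \<open>Time meshes and the dG(0) method\<close>

definition step :: "(nat \<Rightarrow> real) \<Rightarrow> nat \<Rightarrow> real" where
  "step \<tau> m = \<tau> m - \<tau> (m - 1)"

definition step_max :: "nat \<Rightarrow> (nat \<Rightarrow> real) \<Rightarrow> real" where
  "step_max M \<tau> = (MAX m\<in>{1..M}. step \<tau> m)"

definition step_min :: "nat \<Rightarrow> (nat \<Rightarrow> real) \<Rightarrow> real" where
  "step_min M \<tau> = (MIN m\<in>{1..M}. step \<tau> m)"

definition admissible_mesh ::
  "real \<Rightarrow> real \<Rightarrow> real \<Rightarrow> real \<Rightarrow> nat \<Rightarrow> (nat \<Rightarrow> real) \<Rightarrow> bool" where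
  "admissible_mesh T c \<beta> \<kappa> M \<tau> \<longleftrightarrow>
     \<tau> 0 = 0 \<and> \<tau> M = T \<and> (\<forall>m<M. \<tau> m < \<tau> (Suc m)) \<and>
     step_min M \<tau> \<ge> c * step_max M \<tau> powr \<beta> \<and>
     (\<forall>m. 1 \<le> m \<and> m + 1 \<le> M \<longrightarrow>
        1 / \<kappa> \<le> step \<tau> m / step \<tau> (m + 1) \<and> step \<tau> m / step \<tau> (m + 1) \<le> \<kappa>) \<and>
     step_max M \<tau> \<le> T / 4"

text \<open>
  A piecewise constant function \<open>v\<close> is a function of time; its value on \<open>I\<^sub>m = (t\<^sub>m\<^sub>-\<^sub>1, t\<^sub>m]\<close> is
  \<open>v (\<tau> m)\<close>.
\<close>
definition X0_space ::
  "(real ^ 'n::finite) set \<Rightarrow> nat \<Rightarrow> (nat \<Rightarrow> real) \<Rightarrow> (real \<Rightarrow> real ^ 'n \<Rightarrow> real) set" where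
  "X0_space \<Omega> M \<tau> = {v. \<forall>m\<in>{1..M}. \<exists>w\<in>H10_space \<Omega>. \<forall>t\<in>{\<tau> (m - 1)<..\<tau> m}. v t = w}"

definition dG0_solution ::
  "(real ^ 'n::finite) set \<Rightarrow> real \<Rightarrow> ('n \<Rightarrow> 'n \<Rightarrow> real \<Rightarrow> real ^ 'n \<Rightarrow> real) \<Rightarrow>
   nat \<Rightarrow> (nat \<Rightarrow> real) \<Rightarrow> (real \<Rightarrow> real ^ 'n \<Rightarrow> real) \<Rightarrow> (real ^ 'n \<Rightarrow> real) \<Rightarrow>
   (real \<Rightarrow> real ^ 'n \<Rightarrow> real) \<Rightarrow> bool" where
  "dG0_solution \<Omega> T a M \<tau> f u\<^sub>0 u \<longleftrightarrow>
     u \<in> X0_space \<Omega> M \<tau> \<and>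
     (\<forall>\<phi>\<in>X0_space \<Omega> M \<tau>.
        (LINT t|lebesgue_on {0<..<T}. a_form \<Omega> a t (u t) (\<phi> t))
        + (\<Sum>m=2..M. L2_inner \<Omega> (\<lambda>x. u (\<tau> m) x - u (\<tau> (m - 1)) x) (\<phi> (\<tau> m)))
        + L2_inner \<Omega> (u (\<tau> 1)) (\<phi> (\<tau> 1))
        = (LINT t|lebesgue_on {0<..<T}. L2_inner \<Omega> (f t) (\<phi> t))
        + L2_inner \<Omega> u\<^sub>0 (\<phi> (\<tau> 1)))"

definition jump ::
  "(nat \<Rightarrow> real) \<Rightarrow> (real ^ 'n::finite \<Rightarrow> real) \<Rightarrow> (real \<Rightarrow> real ^ 'n \<Rightarrow> real) \<Rightarrow>
   nat \<Rightarrow> real ^ 'n \<Rightarrow> real" where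
  "jump \<tau> u\<^sub>0 u m x = (if m = 0 then u (\<tau> 1) x - u\<^sub>0 x else u (\<tau> (m + 1)) x - u (\<tau> m) x)"

end

theory Submission
  imports Defs
begin

text \<open>
  On the \<open>m\<close>-th time interval the method reads \<open>(u\<^sub>m - u\<^sub>m\<^sub>-\<^sub>1) / k\<^sub>m + A\<^sub>m u\<^sub>m = f\<^sub>m\<close>, where \<open>A\<^sub>m\<close> and \<open>f\<^sub>m\<close> are the
  means of the operator and of the source.  So \<open>A\<^sub>m u\<^sub>m\<close> is square integrable, and a bound for its norm
  bounds the jump quotient as well.

  To bound \<open>A\<^sub>m u\<^sub>m\<close> for one \<open>m\<close>, freeze the operator at \<open>B = A\<^sub>m\<close> and compare with the scheme for \<open>B\<close>.  The
  difference of the two schemes is the extra source \<open>(B - A\<^sub>l) u\<^sub>l\<close>, which lies only in \<open>H\<^sup>-\<^sup>1\<close>, since the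
  domains of the operators may change with time.  Let \<open>s\<^sub>l\<close> be the time from the beginning of the
  \<open>l\<close>-th interval to the end of the \<open>m\<close>-th one.  The products of resolvents of \<open>B\<close> over the intervals
  \<open>l, \<dots>, m\<close>, followed by \<open>B\<close>, are bounded by \<open>1 / s\<^sub>l\<close> in \<open>L\<^sup>2\<close> and, for \<open>l < m\<close>, by a multiple of
  \<open>s\<^sub>l\<^sup>-\<^sup>3\<^sup>/\<^sup>2\<close> from \<open>H\<^sup>-\<^sup>1\<close> to \<open>L\<^sup>2\<close>.  Since \<open>B\<close> commutes with its resolvents, which are contractions,
  the initial value contributes at most \<open>\<parallel>A\<^sub>m u\<^sub>0\<parallel>\<close>.  The first bound gives the sum of the \<open>k\<^sub>l / s\<^sub>l\<close> and hence the logarithm.  The second one meets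
  \<open>\<parallel>B - A\<^sub>l\<parallel> \<le> C \<omega>(s\<^sub>l)\<close>, and the sum of the \<open>k\<^sub>l \<omega>(s\<^sub>l) s\<^sub>l\<^sup>-\<^sup>3\<^sup>/\<^sup>2\<close> is bounded by the integral of
  \<open>\<omega>(t) t\<^sup>-\<^sup>3\<^sup>/\<^sup>2\<close>.  The remaining factor, the gradient norm of \<open>u\<^sub>l\<close>, is at most a multiple of
  \<open>(\<parallel>A\<^sub>l u\<^sub>l\<parallel> \<parallel>u\<^sub>l\<parallel>)\<^sup>1\<^sup>/\<^sup>2\<close>, so the error of freezing grows only like the square root of the maximum to
  be estimated and is absorbed (\<open>discrete_estimate\<close>).

  The argument is carried out by duality (\<open>dual_problem\<close>, \<open>duality_identity\<close>): the dual iterates stay in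
  \<open>H\<^sup>1\<^sub>0\<close>, and the bound from \<open>H\<^sup>-\<^sup>1\<close> becomes a gradient bound.  Both smoothing bounds follow without
  spectral theory from expanding the squared norm of the data of a backward Euler recursion into
  nonnegative terms (\<open>backward_Euler_energy_chain\<close>, \<open>backward_Euler_smoothing\<close>).

  The functional analysis rests on three facts: \<open>L\<^sup>2\<close> and \<open>H\<^sup>1\<close> are complete (\<open>L2_complete\<close>,
  \<open>H1_complete\<close>), which with \<open>Riesz_representation\<close> yields the resolvents; test functions separate points of
  \<open>L\<^sup>2\<close> (\<open>fundamental_lemma\<close>), which makes weak derivatives and representers unique; and Poincare's
  inequality holds on \<open>H\<^sup>1\<^sub>0\<close> (\<open>Poincare\<close>).
\<close>

section \<open>Semi-inner products on spaces of functions\<close>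

text \<open>
  Functions that agree almost everywhere are different elements of \<open>L\<^sup>2\<close> and of the Sobolev spaces
  as they are encoded here, so all inner products are only positive semidefinite.  The vector
  operations are the pointwise ones.  The Hilbert space facts that are needed survive unchanged:
  Cauchy--Schwarz, the triangle inequality and the Riesz representation.
\<close>
locale semi_inner_space =
  fixes V :: "('a \<Rightarrow> real) set" and ip :: "('a \<Rightarrow> real) \<Rightarrow> ('a \<Rightarrow> real) \<Rightarrow> real"
  assumes zero_mem: "(\<lambda>x. 0) \<in> V"
    and add_mem: "u \<in> V \<Longrightarrow> v \<in> V \<Longrightarrow> (\<lambda>x. u x + v x) \<in> V"
    and scale_mem: "u \<in> V \<Longrightarrow> (\<lambda>x. r * u x) \<in> V"
    and ip_commute: "u \<in> V \<Longrightarrow> v \<in> V \<Longrightarrow> ip u v = ip v u"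
    and ip_add_left: "u \<in> V \<Longrightarrow> v \<in> V \<Longrightarrow> w \<in> V \<Longrightarrow> ip (\<lambda>x. u x + v x) w = ip u w + ip v w"
    and ip_scale_left: "u \<in> V \<Longrightarrow> w \<in> V \<Longrightarrow> ip (\<lambda>x. r * u x) w = r * ip u w"
    and ip_nonneg: "u \<in> V \<Longrightarrow> 0 \<le> ip u u"
begin

lemma diff_mem: "u \<in> V \<Longrightarrow> v \<in> V \<Longrightarrow> (\<lambda>x. u x - v x) \<in> V"
  using add_mem[OF _ scale_mem[of v "-1"], of u] by simp

lemma divide_mem: "u \<in> V \<Longrightarrow> (\<lambda>x. u x / r) \<in> V"
  using scale_mem[of u "1 / r"] by simp

lemma ip_diff_left:
  "u \<in> V \<Longrightarrow> v \<in> V \<Longrightarrow> w \<in> V \<Longrightarrow> ip (\<lambda>x. u x - v x) w = ip u w - ip v w"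
  using ip_add_left[OF _ scale_mem[of v "-1"], of u w] ip_scale_left[of v w "-1"] by simp

lemma ip_divide_left: "u \<in> V \<Longrightarrow> w \<in> V \<Longrightarrow> ip (\<lambda>x. u x / r) w = ip u w / r"
  using ip_scale_left[of u w "1 / r"] by simp

lemma ip_add_right:
  "u \<in> V \<Longrightarrow> v \<in> V \<Longrightarrow> w \<in> V \<Longrightarrow> ip w (\<lambda>x. u x + v x) = ip w u + ip w v"
  using ip_add_left[of u v w] by (simp add: ip_commute add_mem)

lemma ip_diff_right:
  "u \<in> V \<Longrightarrow> v \<in> V \<Longrightarrow> w \<in> V \<Longrightarrow> ip w (\<lambda>x. u x - v x) = ip w u - ip w v"
  using ip_diff_left[of u v w] by (simp add: ip_commute diff_mem)

lemma ip_scale_right: "u \<in> V \<Longrightarrow> w \<in> V \<Longrightarrow> ip w (\<lambda>x. r * u x) = r * ip w u"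
  using ip_scale_left[of u w r] by (simp add: ip_commute scale_mem)

lemma ip_divide_right: "u \<in> V \<Longrightarrow> w \<in> V \<Longrightarrow> ip w (\<lambda>x. u x / r) = ip w u / r"
  using ip_divide_left[of u w r] by (simp add: ip_commute divide_mem)

lemmas mem_intros = zero_mem add_mem scale_mem diff_mem divide_mem
lemmas ip_simps = ip_add_left ip_add_right ip_diff_left ip_diff_right
  ip_scale_left ip_scale_right ip_divide_left ip_divide_right

definition seminorm :: "('a \<Rightarrow> real) \<Rightarrow> real"
  where "seminorm u = sqrt (ip u u)"

lemma seminorm_nonneg: "u \<in> V \<Longrightarrow> 0 \<le> seminorm u"
  by (simp add: seminorm_def ip_nonneg)

lemma seminorm_power2: "u \<in> V \<Longrightarrow> (seminorm u)\<^sup>2 = ip u u"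
  by (simp add: seminorm_def ip_nonneg)

lemma seminorm_scale: "u \<in> V \<Longrightarrow> seminorm (\<lambda>x. r * u x) = \<bar>r\<bar> * seminorm u"
  by (simp add: seminorm_def ip_simps mem_intros real_sqrt_mult flip: mult.assoc)

lemma Cauchy_Schwarz:
  assumes u: "u \<in> V" and v: "v \<in> V"
  shows "\<bar>ip u v\<bar> \<le> seminorm u * seminorm v"
proof -
  define A B D where "A = ip u u" and "B = ip u v" and "D = ip v v"
  have A0: "0 \<le> A" and D0: "0 \<le> D" using ip_nonneg u v by (auto simp: A_def D_def)
  have quad: "0 \<le> A - 2 * r * B + r\<^sup>2 * D" for r
  proof -
    have "0 \<le> ip (\<lambda>x. u x - r * v x) (\<lambda>x. u x - r * v x)"
      using u v by (intro ip_nonneg mem_intros)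
    also have "\<dots> = A - 2 * r * B + r\<^sup>2 * D"
      using u v by (simp add: ip_simps mem_intros A_def B_def D_def ip_commute[of v u]
          power2_eq_square algebra_simps)
    finally show ?thesis .
  qed
  have "B\<^sup>2 \<le> A * D"
  proof (cases "D = 0")
    case True
    have "B = 0"
    proof (rule ccontr)
      assume "B \<noteq> 0"
      then show False using quad[of "(A + 1) / (2 * B)"] True by simp
    qed
    then show ?thesis using True by simp
  next
    case False
    with D0 have "D > 0" by simp
    then show ?thesis using quad[of "B / D"] by (simp add: field_simps power2_eq_square)
  qed
  then have "sqrt (B\<^sup>2) \<le> sqrt (A * D)" by (rule real_sqrt_le_mono)
  then show ?thesis by (simp add: real_sqrt_mult seminorm_def A_def B_def D_def)
qed

lemma seminorm_triangle:
  assumes u: "u \<in> V" and v: "v \<in> V"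
  shows "seminorm (\<lambda>x. u x + v x) \<le> seminorm u + seminorm v"
proof (rule power2_le_imp_le)
  have "(seminorm (\<lambda>x. u x + v x))\<^sup>2 = ip u u + 2 * ip u v + ip v v"
    using u v by (simp add: seminorm_power2 mem_intros ip_simps ip_commute[of v u])
  also have "\<dots> \<le> (seminorm u + seminorm v)\<^sup>2"
    using Cauchy_Schwarz[OF u v] u v by (simp add: power2_sum seminorm_power2)
  finally show "(seminorm (\<lambda>x. u x + v x))\<^sup>2 \<le> (seminorm u + seminorm v)\<^sup>2" .
  show "0 \<le> seminorm u + seminorm v" using u v by (simp add: seminorm_nonneg)
qed

lemma seminorm_triangle_diff:
  assumes u: "u \<in> V" and v: "v \<in> V"
  shows "seminorm (\<lambda>x. u x - v x) \<le> seminorm u + seminorm v"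
  using seminorm_triangle[OF u scale_mem[OF v, of "-1"]] seminorm_scale[OF v, of "-1"] by simp

lemma ip_tendsto:
  assumes u: "\<And>n. u n \<in> V" and l: "l \<in> V" and v: "v \<in> V"
    and lim: "(\<lambda>n. seminorm (\<lambda>x. u n x - l x)) \<longlonglongrightarrow> 0"
  shows "(\<lambda>n. ip (u n) v) \<longlonglongrightarrow> ip l v"
proof -
  have "(\<lambda>n. ip (u n) v - ip l v) \<longlonglongrightarrow> 0"
  proof (rule Lim_null_comparison)
    show "\<forall>\<^sub>F n in sequentially. norm (ip (u n) v - ip l v)
        \<le> seminorm (\<lambda>x. u n x - l x) * seminorm v"
      using Cauchy_Schwarz[OF diff_mem[OF u l] v] u l v by (simp add: ip_simps)
    show "(\<lambda>n. seminorm (\<lambda>x. u n x - l x) * seminorm v) \<longlonglongrightarrow> 0"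
      using tendsto_mult_right[OF lim, of "seminorm v"] by simp
  qed
  then show ?thesis by (simp add: LIM_zero_iff)
qed

definition Cauchy_in :: "(nat \<Rightarrow> 'a \<Rightarrow> real) \<Rightarrow> bool"
  where "Cauchy_in u \<longleftrightarrow> (\<forall>n. u n \<in> V) \<and>
    (\<forall>e>0. \<exists>N. \<forall>m\<ge>N. \<forall>n\<ge>N. seminorm (\<lambda>x. u m x - u n x) < e)"

definition complete :: bool
  where "complete \<longleftrightarrow>
    (\<forall>u. Cauchy_in u \<longrightarrow> (\<exists>l\<in>V. (\<lambda>n. seminorm (\<lambda>x. u n x - l x)) \<longlonglongrightarrow> 0))"

text \<open>
  The representer minimises \<open>J u = ip u u - 2 F u\<close>.  By the parallelogram identity every minimising
  sequence is Cauchy, its limit is a minimiser by completeness, and the first variation of \<open>J\<close>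
  vanishes there, which is the claim.
\<close>
theorem Riesz_representation:
  assumes complete
    and F_add: "\<And>u v. u \<in> V \<Longrightarrow> v \<in> V \<Longrightarrow> F (\<lambda>x. u x + v x) = F u + F v"
    and F_scale: "\<And>u r. u \<in> V \<Longrightarrow> F (\<lambda>x. r * u x) = r * F u"
    and F_bound: "\<And>u. u \<in> V \<Longrightarrow> \<bar>F u\<bar> \<le> K * seminorm u"
  obtains g where "g \<in> V" "\<And>v. v \<in> V \<Longrightarrow> ip g v = F v"
proof -
  have F_diff: "F (\<lambda>x. u x - v x) = F u - F v" if "u \<in> V" "v \<in> V" for u v
    using F_add[of u "\<lambda>x. -1 * v x"] F_scale[of v "-1"] that by (simp add: scale_mem[of v "-1", simplified])
  define J where "J u = ip u u - 2 * F u" for u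
  have J_lower: "- (K\<^sup>2) \<le> J u" if "u \<in> V" for u
  proof -
    have "0 \<le> (seminorm u - K)\<^sup>2" by simp
    then have "- (K\<^sup>2) \<le> (seminorm u)\<^sup>2 - 2 * (K * seminorm u)"
      by (simp add: power2_diff algebra_simps)
    moreover have "F u \<le> K * seminorm u" using F_bound[OF that] by linarith
    ultimately show ?thesis using that by (simp add: J_def seminorm_power2)
  qed
  define I where "I = (INF u\<in>V. J u)"
  have bdd: "bdd_below (J ` V)" using J_lower by (auto intro!: bdd_belowI)
  have I_le: "I \<le> J u" if "u \<in> V" for u
    unfolding I_def using bdd that by (rule cINF_lower)
  have "\<exists>u\<in>V. J u < I + 1 / Suc n" for n
  proof -
    have "Inf (J ` V) < I + 1 / Suc n" by (simp add: I_def)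
    then show ?thesis using cInf_lessD[of "J ` V"] zero_mem by blast
  qed
  then obtain u where u: "\<And>n. u n \<in> V" and Ju: "\<And>n. J (u n) < I + 1 / Suc n" by metis
  have dist: "(seminorm (\<lambda>x. u m x - u n x))\<^sup>2 \<le> 2 * (1 / Suc m + 1 / Suc n)" for m n
  proof -
    let ?h = "\<lambda>x. (1/2) * (u m x + u n x)"
    have "J (u m) + J (u n) - 2 * J ?h = (seminorm (\<lambda>x. u m x - u n x))\<^sup>2 / 2"
      using u[of m] u[of n]
      by (simp only: J_def seminorm_power2 diff_mem ip_simps mem_intros F_add F_scale)
        (simp add: ip_commute[of "u n" "u m"] field_simps)
    moreover have "I \<le> J ?h" using u by (intro I_le mem_intros)
    moreover have "x \<le> 2 * (p + q)"
      if "a + b - 2 * c = x / 2" "i \<le> c" "a < i + p" "b < i + q" for x p q a b c i :: real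
      using that by argo
    ultimately show ?thesis using Ju[of m] Ju[of n] by blast
  qed
  have "Cauchy_in u"
    unfolding Cauchy_in_def
  proof (intro conjI allI impI u)
    fix e :: real assume e: "e > 0"
    obtain N where N: "1 / Suc N < e\<^sup>2 / 4"
      using nat_approx_posE[of "e\<^sup>2 / 4"] e by (metis zero_less_divide_iff zero_less_numeral zero_less_power)
    show "\<exists>N. \<forall>m\<ge>N. \<forall>n\<ge>N. seminorm (\<lambda>x. u m x - u n x) < e"
    proof (intro exI allI impI)
      fix m n assume mn: "N \<le> m" "N \<le> n"
      have "1 / Suc m \<le> 1 / Suc N" "1 / Suc n \<le> 1 / Suc N" using mn by (auto simp: field_simps)
      then have "(seminorm (\<lambda>x. u m x - u n x))\<^sup>2 < e\<^sup>2" using dist[of m n] N by argo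
      then show "seminorm (\<lambda>x. u m x - u n x) < e" using power_less_imp_less_base e by (metis less_eq_real_def)
    qed
  qed
  then obtain l where l: "l \<in> V" and lim: "(\<lambda>n. seminorm (\<lambda>x. u n x - l x)) \<longlonglongrightarrow> 0"
    using \<open>complete\<close> unfolding complete_def by blast
  have J_l: "J l \<le> I"
  proof (rule LIMSEQ_le)
    show "(\<lambda>n. I + 1 / Suc n + (2 * seminorm l + 2 * K) * seminorm (\<lambda>x. u n x - l x)) \<longlonglongrightarrow> I"
      using tendsto_add[OF tendsto_add[OF tendsto_const LIMSEQ_Suc[OF lim_1_over_n]]
          tendsto_mult_left[OF lim, of "2 * seminorm l + 2 * K"], of I] by simp
    show "(\<lambda>n. J l) \<longlonglongrightarrow> J l" by simp
    show "\<exists>N. \<forall>n\<ge>N. J l \<le> I + 1 / Suc n + (2 * seminorm l + 2 * K) * seminorm (\<lambda>x. u n x - l x)"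
    proof (intro exI allI impI)
      fix n
      let ?d = "\<lambda>x. u n x - l x"
      have d: "?d \<in> V" using u l by (intro mem_intros)
      have "J (u n) - J l = ip ?d ?d + 2 * ip l ?d - 2 * F ?d"
        using u[of n] l by (simp add: J_def ip_simps mem_intros F_diff ip_commute[of "u n" l])
      moreover have "- ip l ?d \<le> seminorm l * seminorm ?d"
        using Cauchy_Schwarz[OF l d] by linarith
      moreover have "F ?d \<le> K * seminorm ?d" using F_bound[OF d] by linarith
      moreover have "0 \<le> ip ?d ?d" by (rule ip_nonneg[OF d])
      ultimately have "J l \<le> J (u n) + (2 * seminorm l + 2 * K) * seminorm ?d"
        by (simp add: algebra_simps)
      with Ju[of n] show "J l \<le> I + 1 / Suc n + (2 * seminorm l + 2 * K) * seminorm ?d" by linarith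
    qed
  qed
  have "ip l v = F v" if v: "v \<in> V" for v
  proof (rule ccontr)
    assume "ip l v \<noteq> F v"
    define b where "b = F v - ip l v"
    have b: "b \<noteq> 0" using \<open>ip l v \<noteq> F v\<close> by (simp add: b_def)
    have pos: "0 \<le> t\<^sup>2 * ip v v - 2 * t * b" for t
    proof -
      have "J (\<lambda>x. l x + t * v x) - J l = t\<^sup>2 * ip v v - 2 * t * b"
        using l v by (simp add: J_def ip_simps mem_intros F_add F_scale ip_commute[of v l] b_def
            power2_eq_square algebra_simps)
      moreover have "I \<le> J (\<lambda>x. l x + t * v x)" using l v by (intro I_le mem_intros)
      ultimately show ?thesis using J_l by linarith
    qed
    define D where "D = ip v v + 1"
    have D: "D > 0" using ip_nonneg[OF v] by (simp add: D_def)
    have "(b / D)\<^sup>2 * ip v v - 2 * (b / D) * b < 0"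
    proof -
      have "(b / D)\<^sup>2 * ip v v \<le> (b / D)\<^sup>2 * D" by (intro mult_left_mono) (auto simp: D_def)
      also have "\<dots> = b\<^sup>2 / D" using D by (simp add: power2_eq_square field_simps)
      also have "b\<^sup>2 / D < 2 * (b / D) * b"
        using b D zero_less_power2[of b] by (simp add: power2_eq_square field_simps)
      finally show ?thesis by simp
    qed
    with pos[of "b / D"] show False by linarith
  qed
  with l show ?thesis by (rule that)
qed

end

section \<open>An energy recursion\<close>

text \<open>
  Let \<open>v\<^sub>0, v\<^sub>1, \<dots>, v\<^sub>n\<close> be backward Euler iterates, \<open>v\<^sub>j\<^sub>-\<^sub>1 = v\<^sub>j + h\<^sub>j B v\<^sub>j\<close>, for a symmetric positive
  \<open>B\<close>, and let \<open>q\<^sub>p j\<close> stand for \<open>(B\<^sup>p v\<^sub>j, v\<^sub>j)\<close>.  Squaring the recursion gives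
  \<open>q\<^sub>p (j - 1) = q\<^sub>p j + 2 h\<^sub>j q\<^sub>p\<^sub>+\<^sub>1 j + h\<^sub>j\<^sup>2 q\<^sub>p\<^sub>+\<^sub>2 j\<close> with nonnegative terms.  Running this backwards
  expands \<open>\<parallel>v\<^sub>0\<parallel>\<^sup>2\<close> into a polynomial in \<open>B\<close> with nonnegative coefficients evaluated at \<open>v\<^sub>n\<close>; keeping
  one term of it at a time bounds \<open>\<parallel>B v\<^sub>n\<parallel>\<close> and the energy of \<open>B v\<^sub>n\<close>.  This replaces the functional
  calculus of \<open>B\<close>.

  With \<open>S = h\<^sub>1 + \<dots> + h\<^sub>n\<close> the coefficient of \<open>q\<^sub>2 n\<close> is at least \<open>S\<^sup>2\<close>.  The coefficient of \<open>q\<^sub>3 n\<close> is of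
  order \<open>S\<^sup>3\<close> only if no single step exhausts \<open>S\<close>: it vanishes for \<open>n = 1\<close>, and for \<open>n \<ge> 2\<close>
  comparable neighbouring steps exclude this.  The recursion for \<open>q\<^sub>3\<close> starts at \<open>j = 3\<close> since \<open>B v\<^sub>1\<close>
  has no energy when \<open>v\<^sub>0\<close> is merely square integrable.
\<close>
lemma backward_Euler_energy_chain:
  fixes h q0 q1 q2 q3 :: "nat \<Rightarrow> real" and n :: nat and \<kappa> :: real
  assumes h: "\<And>j. 1 \<le> j \<Longrightarrow> j \<le> n \<Longrightarrow> 0 < h j"
    and q_nonneg: "\<And>j. 1 \<le> j \<Longrightarrow> j \<le> n \<Longrightarrow> 0 \<le> q1 j" "0 \<le> q0 n" "0 \<le> q2 n"
    and q0: "\<And>j. 1 \<le> j \<Longrightarrow> j \<le> n \<Longrightarrow> q0 (j - 1) \<ge> q0 j + 2 * h j * q1 j + (h j)\<^sup>2 * q2 j"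
    and q1: "\<And>j. 2 \<le> j \<Longrightarrow> j \<le> n \<Longrightarrow> q1 (j - 1) \<ge> q1 j + 2 * h j * q2 j + (h j)\<^sup>2 * q3 j"
    and q2: "\<And>j. 2 \<le> j \<Longrightarrow> j \<le> n \<Longrightarrow> q2 (j - 1) \<ge> q2 j + 2 * h j * q3 j"
    and q3: "\<And>j. 3 \<le> j \<Longrightarrow> j \<le> n \<Longrightarrow> q3 (j - 1) \<ge> q3 j"
    and q3_nonneg: "2 \<le> n \<Longrightarrow> 0 \<le> q3 n"
    and n: "1 \<le> n"
  shows "(\<Sum>j=1..n. h j)\<^sup>2 * q2 n \<le> q0 0"
    and "2 \<le> n \<Longrightarrow> 0 < \<kappa> \<Longrightarrow>
      (\<And>j. 1 \<le> j \<Longrightarrow> j < n \<Longrightarrow> h j \<le> \<kappa> * h (j + 1) \<and> h (j + 1) \<le> \<kappa> * h j) \<Longrightarrow>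
      2 / (3 + \<kappa>)\<^sup>2 * (\<Sum>j=1..n. h j) ^ 3 * q3 n \<le> q0 0"
proof -
  \<comment> \<open>the time that is still to run after the \<open>j\<close>-th step\<close>
  define S where "S j = (\<Sum>i=j+1..n. h i)" for j
  have S_n: "S n = 0" by (simp add: S_def)
  have S_step: "S (j - 1) = S j + h j" if "1 \<le> j" "j \<le> n" for j
    using that sum.atLeast_Suc_atMost[of j n h] by (simp add: S_def)
  have S_nonneg: "0 \<le> S j" for j
    unfolding S_def by (intro sum_nonneg) (use h in \<open>auto intro!: less_imp_le\<close>)
  \<comment> \<open>what the last iterate contributes to the energies of the \<open>j\<close>-th one, by downward induction\<close>
  have Q2: "q2 n + 2 * S j * (if 2 \<le> n then q3 n else 0) \<le> q2 j \<and>
      2 * S j * q2 n + (S j)\<^sup>2 * (if 2 \<le> n then q3 n else 0) \<le> q1 j \<and>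
      (2 \<le> j \<longrightarrow> (if 2 \<le> n then q3 n else 0) \<le> q3 j)" if "1 \<le> j" "j \<le> n" for j
    using that(2,1)
  proof (induction j rule: inc_induct)
    case base
    then show ?case using q_nonneg(1)[of n] n by (auto simp: S_n)
  next
    case (step j)
    then have IH: "q2 n + 2 * S (Suc j) * q3 n \<le> q2 (Suc j)"
      "2 * S (Suc j) * q2 n + (S (Suc j))\<^sup>2 * q3 n \<le> q1 (Suc j)"
      "q3 n \<le> q3 (Suc j)" and j: "1 \<le> j" "j < n" by auto
    have n2: "2 \<le> n" using j by simp
    have hj: "0 < h (Suc j)" using h j by simp
    have Sj: "S j = S (Suc j) + h (Suc j)" using S_step[of "Suc j"] j by simp
    note S0 = S_nonneg[of "Suc j"]
    have p: "h (Suc j) * q3 n \<le> h (Suc j) * q3 (Suc j)"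
      "(h (Suc j))\<^sup>2 * q3 n \<le> (h (Suc j))\<^sup>2 * q3 (Suc j)"
      "h (Suc j) * (q2 n + 2 * S (Suc j) * q3 n) \<le> h (Suc j) * q2 (Suc j)"
      using IH hj by (auto intro!: mult_left_mono)
    have nn: "0 \<le> S (Suc j) * h (Suc j) * q3 n"
      using S0 hj q3_nonneg n2 by simp
    have "q2 (Suc j) + 2 * h (Suc j) * q3 (Suc j) \<le> q2 j" using q2[of "Suc j"] j by simp
    then have 1: "q2 n + 2 * S j * q3 n \<le> q2 j" using IH p by (simp add: Sj algebra_simps)
    have "q1 (Suc j) + 2 * h (Suc j) * q2 (Suc j) + (h (Suc j))\<^sup>2 * q3 (Suc j) \<le> q1 j"
      using q1[of "Suc j"] j by simp
    then have 2: "2 * S j * q2 n + (S j)\<^sup>2 * q3 n \<le> q1 j"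
      using IH p nn by (simp add: Sj algebra_simps power2_eq_square)
    have 3: "2 \<le> j \<longrightarrow> q3 n \<le> q3 j" using q3[of "Suc j"] IH j by auto
    from 1 2 3 n2 show ?case by simp
  qed
  let ?q3 = "if 2 \<le> n then q3 n else 0"
  have q3n: "0 \<le> ?q3" using q3_nonneg by simp
  have q0_step: "q0 j \<ge> q0 (Suc j) + 2 * h (Suc j) * (2 * S (Suc j) * q2 n + (S (Suc j))\<^sup>2 * ?q3)
      + (h (Suc j))\<^sup>2 * (q2 n + 2 * S (Suc j) * ?q3)" if "j < n" for j
  proof -
    have hj: "0 < h (Suc j)" using h that by simp
    have "h (Suc j) * (2 * S (Suc j) * q2 n + (S (Suc j))\<^sup>2 * ?q3) \<le> h (Suc j) * q1 (Suc j)"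
      "(h (Suc j))\<^sup>2 * (q2 n + 2 * S (Suc j) * ?q3) \<le> (h (Suc j))\<^sup>2 * q2 (Suc j)"
      using Q2[of "Suc j"] that hj by (auto intro!: mult_left_mono)
    then show ?thesis using q0[of "Suc j"] that by simp
  qed
  have Q0: "q0 j \<ge> (S j)\<^sup>2 * q2 n" if "j \<le> n" for j
    using that
  proof (induction j rule: inc_induct)
    case base
    then show ?case using q_nonneg by (simp add: S_n)
  next
    case (step j)
    have hj: "0 < h (Suc j)" using h step by simp
    have "0 \<le> h (Suc j) * S (Suc j) * q2 n" "0 \<le> h (Suc j) * ((S (Suc j))\<^sup>2 * ?q3)"
      "0 \<le> (h (Suc j))\<^sup>2 * (S (Suc j) * ?q3)"
      using hj S_nonneg[of "Suc j"] q_nonneg(3) q3n by (auto intro!: mult_nonneg_nonneg)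
    then show ?case using q0_step[OF step.hyps(2)] step.IH S_step[of "Suc j"] step.hyps
      by (simp add: power2_eq_square algebra_simps)
  qed
  have S0: "S 0 = (\<Sum>j=1..n. h j)" by (simp add: S_def)
  show "(\<Sum>j=1..n. h j)\<^sup>2 * q2 n \<le> q0 0" using Q0[of 0] by (simp add: S0)
  assume n2: "2 \<le> n" and \<kappa>: "0 < \<kappa>"
    and ratio: "\<And>j. 1 \<le> j \<Longrightarrow> j < n \<Longrightarrow> h j \<le> \<kappa> * h (j + 1) \<and> h (j + 1) \<le> \<kappa> * h j"
  define \<gamma> where "\<gamma> = 2 / (3 + \<kappa>)\<^sup>2"
  have \<gamma>: "0 < \<gamma>" "\<gamma> * (3 + \<kappa>)\<^sup>2 = 2" using \<kappa> by (auto simp: \<gamma>_def)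
  have \<gamma>1: "\<gamma> * (3 + \<kappa>) \<le> 2"
  proof -
    have "\<gamma> * (3 + \<kappa>) * 1 \<le> \<gamma> * (3 + \<kappa>) * (3 + \<kappa>)" using \<kappa> \<gamma>(1) by (intro mult_left_mono) auto
    with \<gamma>(2) show ?thesis by (simp add: power2_eq_square)
  qed
  \<comment> \<open>the increments \<open>2 h S\<^sub>j\<^sub>+\<^sub>1 S\<^sub>j\<close> are comparable with those of \<open>S\<^sup>3\<close> as soon as \<open>h \<le> \<kappa> S\<^sub>j\<^sub>+\<^sub>1\<close>\<close>
  have step0: "q0 j \<ge> q0 (Suc j) + 2 * h (Suc j) * S (Suc j) * S j * q3 n" if "j < n" for j
  proof -
    have hj: "0 < h (Suc j)" using h that by simp
    have "0 \<le> h (Suc j) * S (Suc j) * q2 n" "0 \<le> (h (Suc j))\<^sup>2 * q2 n"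
      using hj S_nonneg[of "Suc j"] q_nonneg(3) by (auto intro!: mult_nonneg_nonneg)
    then show ?thesis using q0_step[OF that] n2 S_step[of "Suc j"] that
      by (simp add: power2_eq_square algebra_simps)
  qed
  have "q0 j \<ge> \<gamma> * (S j) ^ 3 * q3 n" if "j \<le> n - 2" for j
    using that
  proof (induction j rule: inc_induct)
    case base
    define x y where "x = h (n - 1)" and "y = h n"
    have xy: "0 < x" "0 < y" using h n2 by (auto simp: x_def y_def)
    have r: "x \<le> \<kappa> * y" "y \<le> \<kappa> * x" using ratio[of "n - 1"] n2 by (auto simp: x_def y_def)
    have Sn1: "S (n - 1) = y" using S_step[of n] n2 by (simp add: S_n y_def)
    have Sn2: "S (n - 2) = y + x" using S_step[of "n - 1"] n2 Sn1 by (simp add: x_def numeral_2_eq_2)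
    have "q0 (n - 1) \<ge> 0" using Q0[of "n - 1"] q_nonneg(3) by (smt (verit) diff_le_self mult_nonneg_nonneg zero_le_power2)
    then have "q0 (n - 2) \<ge> 2 * x * y * (y + x) * q3 n"
      using step0[of "n - 2"] n2 Sn1 Sn2 by (simp add: Suc_diff_Suc numeral_2_eq_2 x_def)
    moreover have "\<gamma> * (y + x)\<^sup>2 \<le> 2 * (x * y)"
    proof -
      have "(y + x)\<^sup>2 \<le> ((3 + \<kappa>) * y) * ((3 + \<kappa>) * x)"
        unfolding power2_eq_square using r xy \<kappa> by (intro mult_mono) (auto simp: algebra_simps)
      then have "\<gamma> * (y + x)\<^sup>2 \<le> \<gamma> * ((3 + \<kappa>)\<^sup>2 * (x * y))"
        using \<gamma> by (intro mult_left_mono) (auto simp: power2_eq_square algebra_simps)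
      also have "\<dots> = 2 * (x * y)" using \<gamma>(2) by (simp flip: mult.assoc)
      finally show ?thesis .
    qed
    then have "\<gamma> * (y + x)\<^sup>2 * ((y + x) * q3 n) \<le> 2 * (x * y) * ((y + x) * q3 n)"
      using xy q3_nonneg n2 by (intro mult_right_mono) auto
    ultimately show ?case by (simp add: Sn2 power2_eq_square power3_eq_cube algebra_simps)
  next
    case (step j)
    have jn: "j < n" using step.hyps by simp
    have hj: "0 < h (Suc j)" using h jn by simp
    have Sj: "S j = S (Suc j) + h (Suc j)" using S_step[of "Suc j"] jn by simp
    define s k where "s = S (Suc j)" and "k = h (Suc j)"
    have "h (Suc j) \<le> \<kappa> * h (Suc (Suc j))" using ratio[of "Suc j"] step.hyps by simp
    also have "\<dots> \<le> \<kappa> * s"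
      using S_step[of "Suc (Suc j)"] S_nonneg[of "Suc (Suc j)"] step.hyps \<kappa> by (simp add: s_def)
    finally have k: "0 < k" "k \<le> \<kappa> * s" using hj by (auto simp: k_def)
    have s: "0 < s" using k \<kappa> by (smt (verit) zero_less_mult_pos)
    have "\<gamma> * (s + k) ^ 3 \<le> \<gamma> * s ^ 3 + 2 * k * s * (s + k)"
    proof -
      have "k * k * k \<le> k * k * (\<kappa> * s)" using k by (intro mult_left_mono) auto
      moreover have "0 \<le> \<kappa> * (k * (s * s))" using k s \<kappa> by simp
      moreover have "(s + k) ^ 3 - s ^ 3 = 3 * (k * s * (s + k)) + k * k * k"
        "(3 + \<kappa>) * (k * s * (s + k)) = 3 * (k * s * (s + k)) + k * k * (\<kappa> * s) + \<kappa> * (k * (s * s))"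
        by (simp_all add: power3_eq_cube algebra_simps)
      ultimately have "(s + k) ^ 3 - s ^ 3 \<le> (3 + \<kappa>) * (k * s * (s + k))" by linarith
      then have "\<gamma> * ((s + k) ^ 3 - s ^ 3) \<le> \<gamma> * ((3 + \<kappa>) * (k * s * (s + k)))"
        using \<gamma> by (intro mult_left_mono) auto
      also have "\<dots> = (\<gamma> * (3 + \<kappa>)) * (k * s * (s + k))" by simp
      also have "\<dots> \<le> 2 * (k * s * (s + k))" using \<gamma>1 s k by (intro mult_right_mono) auto
      finally show ?thesis by (simp add: algebra_simps)
    qed
    then have "\<gamma> * (s + k) ^ 3 * q3 n \<le> (\<gamma> * s ^ 3 + 2 * k * s * (s + k)) * q3 n"
      using q3_nonneg n2 by (intro mult_right_mono) auto
    moreover have "q0 j \<ge> q0 (Suc j) + 2 * k * s * (s + k) * q3 n"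
      using step0[OF jn] by (simp add: Sj s_def k_def)
    ultimately show ?case using step.IH by (simp add: Sj s_def k_def algebra_simps)
  qed
  from this[of 0] show "2 / (3 + \<kappa>)\<^sup>2 * (\<Sum>j=1..n. h j) ^ 3 * q3 n \<le> q0 0"
    by (simp add: \<gamma>_def S0)
qed

section \<open>Square integrable functions\<close>

lemma L2_mult_integrable:
  assumes "u \<in> L2_space \<Omega>" "v \<in> L2_space \<Omega>"
  shows "integrable (lebesgue_on \<Omega>) (\<lambda>x. u x * v x)"
proof (rule Bochner_Integration.integrable_bound)
  show "integrable (lebesgue_on \<Omega>) (\<lambda>x. (u x)\<^sup>2 + (v x)\<^sup>2)"
    using assms by (auto simp: L2_space_def)
  show "(\<lambda>x. u x * v x) \<in> borel_measurable (lebesgue_on \<Omega>)"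
    using assms by (auto simp: L2_space_def)
  have "\<bar>a * b\<bar> \<le> a\<^sup>2 + b\<^sup>2" for a b :: real
  proof -
    have "0 \<le> (\<bar>a\<bar> - \<bar>b\<bar>)\<^sup>2" by simp
    then have "2 * (\<bar>a\<bar> * \<bar>b\<bar>) \<le> a\<^sup>2 + b\<^sup>2" by (simp add: power2_diff)
    moreover have "0 \<le> \<bar>a\<bar> * \<bar>b\<bar>" by simp
    ultimately show ?thesis unfolding abs_mult by linarith
  qed
  then show "AE x in lebesgue_on \<Omega>. norm (u x * v x) \<le> norm ((u x)\<^sup>2 + (v x)\<^sup>2)"
    by simp
qed

lemma L2_add_mem:
  assumes "u \<in> L2_space \<Omega>" "v \<in> L2_space \<Omega>"
  shows "(\<lambda>x. u x + v x) \<in> L2_space \<Omega>"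
proof -
  have "integrable (lebesgue_on \<Omega>) (\<lambda>x. (u x)\<^sup>2 + (v x)\<^sup>2 + 2 * (u x * v x))"
    using assms L2_mult_integrable[OF assms] by (auto simp: L2_space_def)
  then show ?thesis using assms by (auto simp: L2_space_def power2_sum algebra_simps)
qed

lemma semi_inner_space_L2: "semi_inner_space (L2_space \<Omega>) (L2_inner \<Omega>)"
proof
  show "(\<lambda>x. 0) \<in> L2_space \<Omega>" by (simp add: L2_space_def)
next
  fix u v assume "u \<in> L2_space \<Omega>" "v \<in> L2_space \<Omega>"
  then show "(\<lambda>x. u x + v x) \<in> L2_space \<Omega>" by (rule L2_add_mem)
next
  fix u :: "real ^ 'a \<Rightarrow> real" and r assume "u \<in> L2_space \<Omega>"
  then show "(\<lambda>x. r * u x) \<in> L2_space \<Omega>" by (auto simp: L2_space_def power_mult_distrib)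
next
  fix u v :: "real ^ 'a \<Rightarrow> real"
  show "L2_inner \<Omega> u v = L2_inner \<Omega> v u" by (simp add: L2_inner_def mult.commute)
next
  fix u v w assume "u \<in> L2_space \<Omega>" "v \<in> L2_space \<Omega>" "w \<in> L2_space \<Omega>"
  then show "L2_inner \<Omega> (\<lambda>x. u x + v x) w = L2_inner \<Omega> u w + L2_inner \<Omega> v w"
    by (simp add: L2_inner_def distrib_right L2_mult_integrable)
next
  fix u w :: "real ^ 'a \<Rightarrow> real" and r
  show "L2_inner \<Omega> (\<lambda>x. r * u x) w = r * L2_inner \<Omega> u w"
    by (simp add: L2_inner_def mult.assoc)
next
  fix u :: "real ^ 'a \<Rightarrow> real"
  show "0 \<le> L2_inner \<Omega> u u" by (simp add: L2_inner_def)
qed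

interpretation L2: semi_inner_space "L2_space \<Omega>" "L2_inner \<Omega>"
  rewrites "semi_inner_space.seminorm (L2_inner \<Omega>) = L2_norm \<Omega>"
  for \<Omega> :: "(real ^ 'n::finite) set"
proof -
  show "semi_inner_space (L2_space \<Omega>) (L2_inner \<Omega>)" by (rule semi_inner_space_L2)
  show "semi_inner_space.seminorm (L2_inner \<Omega>) = L2_norm \<Omega>"
    by (intro ext) (simp add: semi_inner_space.seminorm_def[OF semi_inner_space_L2] L2_norm_def)
qed

lemma L2_inner_cong_AE:
  assumes "AE x in lebesgue_on \<Omega>. u x = u' x" "AE x in lebesgue_on \<Omega>. v x = v' x"
    and "u \<in> L2_space \<Omega>" "u' \<in> L2_space \<Omega>" "v \<in> L2_space \<Omega>" "v' \<in> L2_space \<Omega>"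
  shows "L2_inner \<Omega> u v = L2_inner \<Omega> u' v'"
  unfolding L2_inner_def
  by (rule integral_cong_AE) (use assms in \<open>auto simp: L2_space_def\<close>)

lemma L2_norm_cong_AE:
  assumes "AE x in lebesgue_on \<Omega>. u x = u' x" "u \<in> L2_space \<Omega>" "u' \<in> L2_space \<Omega>"
  shows "L2_norm \<Omega> u = L2_norm \<Omega> u'"
  using L2_inner_cong_AE[OF assms(1) assms(1)] assms by (simp add: L2_norm_def)

lemma L2_from_nn_integral_bound:
  assumes u: "u \<in> borel_measurable (lebesgue_on \<Omega>)"
    and bound: "(\<integral>\<^sup>+x. ennreal ((u x)\<^sup>2) \<partial>lebesgue_on \<Omega>) \<le> ennreal (e\<^sup>2)" and e: "0 \<le> e"
  shows "u \<in> L2_space \<Omega>" "L2_norm \<Omega> u \<le> e"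
proof -
  have int: "integrable (lebesgue_on \<Omega>) (\<lambda>x. (u x)\<^sup>2)"
    using bound u le_less_trans[OF bound ennreal_less_top] by (intro integrableI_bounded) auto
  then show "u \<in> L2_space \<Omega>" using u by (simp add: L2_space_def)
  have "ennreal (LINT x|lebesgue_on \<Omega>. (u x)\<^sup>2) \<le> ennreal (e\<^sup>2)"
    using bound nn_integral_eq_integral[OF int] by simp
  then have "(LINT x|lebesgue_on \<Omega>. (u x)\<^sup>2) \<le> e\<^sup>2" by (simp add: ennreal_le_iff)
  then show "L2_norm \<Omega> u \<le> e"
    using e real_sqrt_le_mono[of "LINT x|lebesgue_on \<Omega>. (u x)\<^sup>2" "e\<^sup>2"]
    by (simp add: L2_norm_def L2_inner_def power2_eq_square)
qed

lemma one_in_L2: "\<Omega> \<in> lmeasurable \<Longrightarrow> (\<lambda>x. 1) \<in> L2_space \<Omega>"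
  using finite_measure.integrable_const[OF finite_measure_lebesgue_on, of \<Omega> "1::real"]
  by (simp add: L2_space_def)

lemma L2_integrable:
  assumes "\<Omega> \<in> lmeasurable" "u \<in> L2_space \<Omega>"
  shows "integrable (lebesgue_on \<Omega>) u"
  using L2_mult_integrable[OF assms(2) one_in_L2[OF assms(1)]] by simp

lemma L2_abs_mem: "u \<in> L2_space \<Omega> \<Longrightarrow> (\<lambda>x. \<bar>u x\<bar>) \<in> L2_space \<Omega>"
  by (auto simp: L2_space_def)

text \<open>
  Riesz--Fischer.  A subsequence \<open>u (r k)\<close> with summable increments converges almost everywhere,
  because on a set of finite measure its increments are also summable in \<open>L\<^sup>1\<close>; Fatou's lemma turns
  the pointwise limit into a limit in \<open>L\<^sup>2\<close> of the whole sequence.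
\<close>
theorem L2_complete:
  assumes \<Omega>: "\<Omega> \<in> lmeasurable"
  shows "semi_inner_space.complete (L2_space \<Omega>) (L2_inner \<Omega>)"
  unfolding L2.complete_def
proof (intro allI impI)
  fix u assume "semi_inner_space.Cauchy_in (L2_space \<Omega>) (L2_inner \<Omega>) u"
  then have u: "\<And>n. u n \<in> L2_space \<Omega>"
    and cauchy: "\<And>e. e > 0 \<Longrightarrow> \<exists>N. \<forall>m\<ge>N. \<forall>n\<ge>N. L2_norm \<Omega> (\<lambda>x. u m x - u n x) < e"
    unfolding L2.Cauchy_in_def by auto
  have u_meas [measurable]: "u n \<in> borel_measurable (lebesgue_on \<Omega>)" for n
    using u[of n] by (simp add: L2_space_def)
  obtain N where N: "\<And>k m n. N k \<le> m \<Longrightarrow> N k \<le> n \<Longrightarrow> L2_norm \<Omega> (\<lambda>x. u m x - u n x) < (1/2) ^ k"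
    using cauchy[of "(1/2) ^ k" for k] by (metis zero_less_divide_1_iff zero_less_numeral zero_less_power)
  define r where "r k = (\<Sum>i\<le>k. N i) + k" for k
  have r_ge: "N k \<le> r k" for k
    unfolding r_def using member_le_sum[of k "{..k}" N] by auto
  have r_mono: "r k \<le> r (Suc k)" and r_ge_id: "k \<le> r k" for k by (auto simp: r_def)
  define d where "d k x = \<bar>u (r (Suc k)) x - u (r k) x\<bar>" for k x
  have d_nonneg: "0 \<le> d k x" for k x by (simp add: d_def)
  have d_mem: "d k \<in> L2_space \<Omega>" for k
    unfolding d_def by (intro L2_abs_mem L2.diff_mem u)
  have d_int: "(\<integral>\<^sup>+x. ennreal (d k x) \<partial>lebesgue_on \<Omega>) \<le> ennreal ((1/2) ^ k * L2_norm \<Omega> (\<lambda>x. 1))" for k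
  proof -
    have "L2_norm \<Omega> (d k) = L2_norm \<Omega> (\<lambda>x. u (r (Suc k)) x - u (r k) x)"
      by (simp add: d_def L2_norm_def L2_inner_def flip: abs_mult)
    also have "\<dots> \<le> (1/2) ^ k"
      using N[of k "r (Suc k)" "r k"] r_ge[of k] r_mono[of k] by simp
    finally have "L2_inner \<Omega> (d k) (\<lambda>x. 1) \<le> (1/2) ^ k * L2_norm \<Omega> (\<lambda>x. 1)"
      using L2.Cauchy_Schwarz[OF d_mem one_in_L2[OF \<Omega>], of k]
        mult_right_mono[OF _ L2.seminorm_nonneg[OF one_in_L2[OF \<Omega>]]] by fastforce
    moreover have "(\<integral>\<^sup>+x. ennreal (d k x) \<partial>lebesgue_on \<Omega>) = ennreal (LINT x|lebesgue_on \<Omega>. d k x)"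
      using L2_integrable[OF \<Omega> d_mem, of k] by (intro nn_integral_eq_integral) (simp_all add: d_nonneg)
    ultimately show ?thesis by (simp add: L2_inner_def ennreal_leI)
  qed
  have "AE x in lebesgue_on \<Omega>. (\<Sum>k. ennreal (d k x)) \<noteq> \<infinity>"
  proof (rule nn_integral_PInf_AE)
    show "(\<lambda>x. \<Sum>k. ennreal (d k x)) \<in> borel_measurable (lebesgue_on \<Omega>)"
      unfolding d_def by measurable
    have "(\<integral>\<^sup>+x. (\<Sum>k. ennreal (d k x)) \<partial>lebesgue_on \<Omega>) = (\<Sum>k. \<integral>\<^sup>+x. ennreal (d k x) \<partial>lebesgue_on \<Omega>)"
      unfolding d_def by (rule nn_integral_suminf) measurable
    also have "\<dots> \<le> (\<Sum>k. ennreal ((1/2) ^ k * L2_norm \<Omega> (\<lambda>x. 1)))"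
      by (intro suminf_le d_int) auto
    also have "\<dots> = ennreal (\<Sum>k. (1/2) ^ k * L2_norm \<Omega> (\<lambda>x. 1))"
      using L2.seminorm_nonneg[OF one_in_L2[OF \<Omega>]]
      by (intro suminf_ennreal2 summable_mult2 summable_geometric) auto
    also have "\<dots> < \<infinity>" by simp
    finally show "(\<integral>\<^sup>+x. (\<Sum>k. ennreal (d k x)) \<partial>lebesgue_on \<Omega>) \<noteq> \<infinity>" by simp
  qed
  then have conv: "AE x in lebesgue_on \<Omega>. convergent (\<lambda>k. u (r k) x)"
  proof (rule AE_mp, intro AE_I2 impI)
    fix x assume "(\<Sum>k. ennreal (d k x)) \<noteq> \<infinity>"
    then have "summable (\<lambda>k. d k x)" by (intro summable_suminf_not_top) (auto simp: d_def)
    then have "summable (\<lambda>k. u (r (Suc k)) x - u (r k) x)"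
      unfolding d_def by (rule summable_rabs_cancel)
    then have "convergent (\<lambda>n. \<Sum>k<n. u (r (Suc k)) x - u (r k) x)"
      by (simp add: summable_iff_convergent)
    then have "convergent (\<lambda>n. u (r n) x - u (r 0) x)"
      by (simp add: sum_lessThan_telescope[of "\<lambda>k. u (r k) x"])
    then show "convergent (\<lambda>k. u (r k) x)"
      by (simp add: convergent_diff_const_right_iff)
  qed
  define l where "l x = lim (\<lambda>k. u (r k) x)" for x
  have l_meas [measurable]: "l \<in> borel_measurable (lebesgue_on \<Omega>)"
    unfolding l_def by (rule borel_measurable_lim_metric) measurable
  have close: "(\<lambda>x. u n x - l x) \<in> L2_space \<Omega> \<and> L2_norm \<Omega> (\<lambda>x. u n x - l x) \<le> e"
    if K: "\<forall>m\<ge>K. \<forall>n\<ge>K. L2_norm \<Omega> (\<lambda>x. u m x - u n x) < e" and n: "K \<le> n" for n K e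
  proof -
    have e: "0 \<le> e"
      using K n L2.seminorm_nonneg[OF L2.diff_mem[OF u u], of n n] by (metis le_less_trans less_imp_le)
    have "(\<integral>\<^sup>+x. ennreal ((u n x - l x)\<^sup>2) \<partial>lebesgue_on \<Omega>)
        = (\<integral>\<^sup>+x. liminf (\<lambda>k. ennreal ((u n x - u (r k) x)\<^sup>2)) \<partial>lebesgue_on \<Omega>)"
    proof (rule nn_integral_cong_AE, rule AE_mp[OF conv], intro AE_I2 impI)
      fix x assume "convergent (\<lambda>k. u (r k) x)"
      then have "(\<lambda>k. u (r k) x) \<longlonglongrightarrow> l x" unfolding l_def by (simp add: convergent_LIMSEQ_iff)
      then have "(\<lambda>k. ennreal ((u n x - u (r k) x)\<^sup>2)) \<longlonglongrightarrow> ennreal ((u n x - l x)\<^sup>2)"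
        by (intro tendsto_intros)
      then show "ennreal ((u n x - l x)\<^sup>2) = liminf (\<lambda>k. ennreal ((u n x - u (r k) x)\<^sup>2))"
        by (rule lim_imp_Liminf[OF trivial_limit_sequentially, symmetric])
    qed
    also have "\<dots> \<le> liminf (\<lambda>k. \<integral>\<^sup>+x. ennreal ((u n x - u (r k) x)\<^sup>2) \<partial>lebesgue_on \<Omega>)"
      by (rule nn_integral_liminf) measurable
    also have "\<dots> \<le> liminf (\<lambda>k. ennreal (e\<^sup>2))"
    proof (rule Liminf_mono, rule eventually_sequentiallyI[of K])
      fix k assume "K \<le> k"
      then have "K \<le> r k" using r_ge_id[of k] by simp
      define v where "v = (\<lambda>x. u n x - u (r k) x)"
      have v: "v \<in> L2_space \<Omega>" unfolding v_def by (intro L2.diff_mem u)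
      have "L2_norm \<Omega> v \<le> e" using K n \<open>K \<le> r k\<close> by (auto simp: v_def intro: less_imp_le)
      then have "L2_inner \<Omega> v v \<le> e\<^sup>2"
        using L2.seminorm_power2[OF v] power_mono[of "L2_norm \<Omega> v" e 2] L2.seminorm_nonneg[OF v] by simp
      moreover have "(\<integral>\<^sup>+x. ennreal ((v x)\<^sup>2) \<partial>lebesgue_on \<Omega>) = ennreal (L2_inner \<Omega> v v)"
        using v nn_integral_eq_integral[of "lebesgue_on \<Omega>" "\<lambda>x. (v x)\<^sup>2"]
        by (simp add: L2_space_def L2_inner_def power2_eq_square)
      ultimately show "(\<integral>\<^sup>+x. ennreal ((u n x - u (r k) x)\<^sup>2) \<partial>lebesgue_on \<Omega>) \<le> ennreal (e\<^sup>2)"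
        by (simp add: v_def ennreal_leI)
    qed
    also have "\<dots> = ennreal (e\<^sup>2)" by (simp add: Liminf_const)
    finally have bound: "(\<integral>\<^sup>+x. ennreal ((u n x - l x)\<^sup>2) \<partial>lebesgue_on \<Omega>) \<le> ennreal (e\<^sup>2)" .
    have meas: "(\<lambda>x. u n x - l x) \<in> borel_measurable (lebesgue_on \<Omega>)" by measurable
    show ?thesis using L2_from_nn_integral_bound[OF meas bound e] by blast
  qed
  obtain K0 where K0: "\<forall>m\<ge>K0. \<forall>n\<ge>K0. L2_norm \<Omega> (\<lambda>x. u m x - u n x) < 1"
    using cauchy[of 1] by auto
  have l: "l \<in> L2_space \<Omega>"
    using L2.diff_mem[OF u[of K0] conjunct1[OF close[OF K0 order_refl]]] by simp
  have "(\<lambda>n. L2_norm \<Omega> (\<lambda>x. u n x - l x)) \<longlonglongrightarrow> 0"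
  proof (rule LIMSEQ_I)
    fix e :: real assume "e > 0"
    then obtain K where K: "\<forall>m\<ge>K. \<forall>n\<ge>K. L2_norm \<Omega> (\<lambda>x. u m x - u n x) < e / 2"
      using cauchy[of "e / 2"] by auto
    show "\<exists>no. \<forall>n\<ge>no. norm (L2_norm \<Omega> (\<lambda>x. u n x - l x) - 0) < e"
    proof (intro exI allI impI)
      fix n assume "K \<le> n"
      then show "norm (L2_norm \<Omega> (\<lambda>x. u n x - l x) - 0) < e"
        using close[OF K] \<open>e > 0\<close> L2.seminorm_nonneg[OF L2.diff_mem[OF u[of n] l]] by fastforce
    qed
  qed
  with l show "\<exists>l\<in>L2_space \<Omega>. (\<lambda>n. L2_norm \<Omega> (\<lambda>x. u n x - l x)) \<longlonglongrightarrow> 0" by blast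
qed

section \<open>Test functions\<close>

lemma partial_eqI: "(\<phi> has_derivative D) (at x) \<Longrightarrow> partial i \<phi> x = D (axis i 1)"
  unfolding partial_def by (metis frechet_derivative_at)

lemma partial_const: "partial i (\<lambda>x. r) = (\<lambda>x. 0)"
  by (intro ext partial_eqI[where D = "\<lambda>x. 0"]) simp

lemma partial_add:
  assumes "\<And>x. \<phi> differentiable (at x)" "\<And>x. \<psi> differentiable (at x)"
  shows "partial i (\<lambda>x. \<phi> x + \<psi> x) = (\<lambda>x. partial i \<phi> x + partial i \<psi> x)"
  unfolding partial_def[of i \<phi>] partial_def[of i \<psi>] using assms
  by (intro ext partial_eqI[of _ "\<lambda>h. _ h + _ h"] has_derivative_add)
    (auto simp: frechet_derivative_works)

lemma partial_mult:
  assumes "\<And>x. \<phi> differentiable (at x)" "\<And>x. \<psi> differentiable (at x)"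
  shows "partial i (\<lambda>x. \<phi> x * \<psi> x) = (\<lambda>x. \<phi> x * partial i \<psi> x + partial i \<phi> x * \<psi> x)"
proof
  fix x
  show "partial i (\<lambda>x. \<phi> x * \<psi> x) x = \<phi> x * partial i \<psi> x + partial i \<phi> x * \<psi> x"
    unfolding partial_def[of i \<phi>] partial_def[of i \<psi>] using assms
    by (intro partial_eqI[of _ "\<lambda>h. \<phi> x * _ h + _ h * \<psi> x"] has_derivative_mult)
      (auto simp: frechet_derivative_works)
qed

lemma C_k_Suc_imp: "C_k (Suc k) \<phi> \<Longrightarrow> C_k k \<phi>"
proof (induction k arbitrary: \<phi>)
  case 0
  then show ?case
    by (auto intro!: continuous_at_imp_continuous_on differentiable_imp_continuous_within)
next
  case (Suc k)
  then show ?case by (metis C_k.simps(2))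
qed

lemma C_k_const: "C_k k (\<lambda>x. r)"
  by (induction k arbitrary: r) (auto simp: partial_const)

lemma C_k_add: "C_k k \<phi> \<Longrightarrow> C_k k \<psi> \<Longrightarrow> C_k k (\<lambda>x. \<phi> x + \<psi> x)"
  by (induction k arbitrary: \<phi> \<psi>) (auto simp: partial_add intro!: continuous_intros)

lemma C_k_mult: "C_k k \<phi> \<Longrightarrow> C_k k \<psi> \<Longrightarrow> C_k k (\<lambda>x. \<phi> x * \<psi> x)"
proof (induction k arbitrary: \<phi> \<psi>)
  case 0
  then show ?case by (auto intro!: continuous_intros)
next
  case (Suc k)
  have "C_k k (\<lambda>x. \<phi> x * partial i \<psi> x + partial i \<phi> x * \<psi> x)" for i
    using Suc.prems by (intro C_k_add Suc.IH) (auto intro: C_k_Suc_imp)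
  then show ?case using Suc.prems by (auto simp: partial_mult)
qed

lemma C_k_scale: "C_k k \<phi> \<Longrightarrow> C_k k (\<lambda>x. r * \<phi> x)"
  by (intro C_k_mult C_k_const)

lemma C_k_prod: "finite I \<Longrightarrow> (\<And>i. i \<in> I \<Longrightarrow> C_k k (\<phi> i)) \<Longrightarrow> C_k k (\<lambda>x. \<Prod>i\<in>I. \<phi> i x)"
  by (induction I rule: finite_induct) (auto intro!: C_k_mult C_k_const)

lemma coordinate_has_derivative: "((\<lambda>x :: real ^ 'n::finite. x $ i) has_derivative (\<lambda>h. h $ i)) (at x)"
  by (rule bounded_linear_imp_has_derivative[OF bounded_linear_vec_nth])

lemma C_k_coordinate: "C_k k (\<lambda>x :: real ^ 'n::finite. x $ i)"
proof (cases k)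
  case (Suc l)
  have "partial j (\<lambda>x :: real ^ 'n. x $ i) = (\<lambda>x. axis j 1 $ i)" for j
    by (intro ext partial_eqI[OF coordinate_has_derivative])
  then show ?thesis
    using coordinate_has_derivative by (auto simp: Suc C_k_const differentiable_def)
qed (auto intro!: continuous_intros)

text \<open>
  The functions \<open>p(1/t) exp(-1/t)\<close> on the positive half line, extended by zero.  Allowing a polynomial
  \<open>p\<close> makes the family closed under differentiation, so that all its members are smooth.
\<close>
definition cutoff :: "real poly \<Rightarrow> real \<Rightarrow> real"
  where "cutoff p t = (if 0 < t then poly p (1 / t) * exp (- (1 / t)) else 0)"

lemma poly_mult_exp_tendsto_0: "((\<lambda>y. y ^ k * poly p y * exp (- y)) \<longlongrightarrow> (0 :: real)) at_top"
proof (induction p arbitrary: k)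
  case (pCons r p)
  have "((\<lambda>y. r * (y ^ k / exp y) + y ^ Suc k * poly p y * exp (- y)) \<longlongrightarrow> r * 0 + 0) at_top"
    by (intro tendsto_add tendsto_mult_left tendsto_power_div_exp_0 pCons.IH)
  then show ?case by (simp add: exp_minus field_simps)
qed simp

lemma cutoff_has_derivative:
  "(cutoff p has_real_derivative cutoff ([:0, 0, 1:] * (p - pderiv p)) t) (at t)"
proof -
  consider "t < 0" | "t = 0" | "0 < t" by linarith
  then show ?thesis
  proof cases
    case 1
    have "((\<lambda>t. 0) has_real_derivative 0) (at t)" by simp
    then have "(cutoff p has_real_derivative 0) (at t)"
      by (rule has_field_derivative_transform_within_open[of _ _ _ "{..<0}"])
        (use 1 in \<open>auto simp: cutoff_def\<close>)
    then show ?thesis using 1 by (simp add: cutoff_def)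
  next
    case 2
    have "((\<lambda>h. (cutoff p (0 + h) - cutoff p 0) / h) \<longlongrightarrow> 0) (at 0)"
    proof (rule filterlim_split_at)
      have "\<forall>\<^sub>F h in at_left 0. 0 = (cutoff p (0 + h) - cutoff p 0) / (h :: real)"
        unfolding eventually_at_filter by (rule always_eventually) (auto simp: cutoff_def)
      then show "((\<lambda>h. (cutoff p (0 + h) - cutoff p 0) / h) \<longlongrightarrow> 0) (at_left 0)"
        by (rule Lim_transform_eventually[OF tendsto_const])
    next
      have "((\<lambda>h. (1 / h) ^ 1 * poly p (1 / h) * exp (- (1 / h))) \<longlongrightarrow> 0) (at_right 0)"
        using filterlim_compose[OF poly_mult_exp_tendsto_0[of 1 p] filterlim_inverse_at_top_right]
        by (simp add: inverse_eq_divide)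
      moreover have "\<forall>\<^sub>F h in at_right 0. (1 / h) ^ 1 * poly p (1 / h) * exp (- (1 / h))
          = (cutoff p (0 + h) - cutoff p 0) / (h :: real)"
        unfolding eventually_at_filter by (rule always_eventually) (auto simp: cutoff_def)
      ultimately show "((\<lambda>h. (cutoff p (0 + h) - cutoff p 0) / h) \<longlongrightarrow> 0) (at_right 0)"
        by (rule Lim_transform_eventually)
    qed
    then show ?thesis using 2 by (simp add: DERIV_def cutoff_def)
  next
    case 3
    have "((\<lambda>t. poly p (1 / t) * exp (- (1 / t))) has_real_derivative
        poly ([:0, 0, 1:] * (p - pderiv p)) (1 / t) * exp (- (1 / t))) (at t)"
      using 3 by (auto intro!: derivative_eq_intros DERIV_chain2[OF poly_DERIV]
          simp: field_simps power2_eq_square)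
    then have "(cutoff p has_real_derivative
        poly ([:0, 0, 1:] * (p - pderiv p)) (1 / t) * exp (- (1 / t))) (at t)"
      by (rule has_field_derivative_transform_within_open[of _ _ _ "{0<..}"])
        (use 3 in \<open>auto simp: cutoff_def\<close>)
    then show ?thesis using 3 by (simp add: cutoff_def)
  qed
qed

lemma cutoff_affine_has_derivative:
  "((\<lambda>x :: real ^ 'n::finite. cutoff p (r * x $ i + s)) has_derivative
    (\<lambda>h. r * h $ i * cutoff ([:0, 0, 1:] * (p - pderiv p)) (r * x $ i + s))) (at x)"
proof -
  have "((\<lambda>x :: real ^ 'n. r * x $ i + s) has_derivative (\<lambda>h. r * h $ i)) (at x)"
    by (auto intro!: derivative_eq_intros coordinate_has_derivative)
  from has_derivative_compose[OF this, of "cutoff p" "\<lambda>h. h * _"]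
    cutoff_has_derivative[of p "r * x $ i + s"]
  show ?thesis by (simp add: has_field_derivative_def mult_commute_abs)
qed

lemma C_k_cutoff_affine: "C_k k (\<lambda>x :: real ^ 'n::finite. cutoff p (r * x $ i + s))"
proof (induction k arbitrary: p)
  case 0
  have "isCont (\<lambda>x :: real ^ 'n. cutoff p (r * x $ i + s)) x" for x
    by (rule has_derivative_continuous[OF cutoff_affine_has_derivative])
  then show ?case by (simp add: continuous_at_imp_continuous_on)
next
  case (Suc k)
  have "partial j (\<lambda>x :: real ^ 'n. cutoff p (r * x $ i + s))
      = (\<lambda>x. (r * axis j 1 $ i) * cutoff ([:0, 0, 1:] * (p - pderiv p)) (r * x $ i + s))" for j
    by (intro ext partial_eqI[OF cutoff_affine_has_derivative])
  moreover have "(\<lambda>x :: real ^ 'n. cutoff p (r * x $ i + s)) differentiable (at x)" for x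
    unfolding differentiable_def using cutoff_affine_has_derivative by blast
  ultimately show ?case by (auto simp only: C_k.simps intro!: C_k_scale Suc.IH)
qed

text \<open>
  A product of smooth cutoffs in the coordinate directions.  It is positive exactly on \<open>box a b\<close>, and
  since \<open>exp (-1 / (n t))\<close> tends to 1 for every \<open>t > 0\<close>, it increases to the indicator function of the
  box as the dilation factor \<open>n\<close> grows.  The factor is written as \<open>Suc n\<close> to keep it positive.
\<close>
definition bump :: "nat \<Rightarrow> real ^ 'n::finite \<Rightarrow> real ^ 'n \<Rightarrow> real ^ 'n \<Rightarrow> real"
  where "bump n a b x = (\<Prod>i\<in>UNIV. cutoff 1 (real (Suc n) * x $ i + - real (Suc n) * a $ i) *
    cutoff 1 (- real (Suc n) * x $ i + real (Suc n) * b $ i))"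

lemma bump_eq:
  "bump n a b x = (if x \<in> box a b then \<Prod>i\<in>UNIV.
     exp (- (1 / (real (Suc n) * (x $ i - a $ i)))) * exp (- (1 / (real (Suc n) * (b $ i - x $ i)))) else 0)"
proof -
  define N where "N = real (Suc n)"
  have N: "0 < N" by (simp add: N_def)
  have bump: "bump n a b x = (\<Prod>i\<in>UNIV. cutoff 1 (N * (x $ i - a $ i)) * cutoff 1 (N * (b $ i - x $ i)))"
    unfolding bump_def N_def[symmetric] by (simp add: algebra_simps)
  show ?thesis
  proof (cases "x \<in> box a b")
    case True
    then have "a $ i < x $ i" "x $ i < b $ i" for i by (auto simp: mem_box_cart)
    then show ?thesis using True N unfolding N_def[symmetric]
      by (simp add: bump cutoff_def)
  next
    case False
    then obtain i where i: "\<not> (a $ i < x $ i \<and> x $ i < b $ i)" by (auto simp: mem_box_cart)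
    then have "cutoff 1 (N * (x $ i - a $ i)) * cutoff 1 (N * (b $ i - x $ i)) = 0"
      using N by (auto simp: cutoff_def zero_less_mult_iff)
    then show ?thesis using False by (auto simp: bump)
  qed
qed

lemma bump_bounds: "0 \<le> bump n a b x" "bump n a b x \<le> 1"
proof -
  show "0 \<le> bump n a b x" by (auto simp: bump_eq intro!: prod_nonneg)
  have *: "exp (- (1 / (real (Suc n) * r))) * exp (- (1 / (real (Suc n) * s))) \<le> 1"
    if "0 < r" "0 < s" for r s
    using that by (intro mult_le_one) simp_all
  show "bump n a b x \<le> 1"
  proof (cases "x \<in> box a b")
    case True
    then have "0 < x $ i - a $ i" "0 < b $ i - x $ i" for i by (auto simp: mem_box_cart)
    then show ?thesis using True *
      by (simp only: bump_eq if_True) (intro prod_le_1, simp)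
  qed (simp add: bump_eq)
qed

lemma bump_tendsto:
  fixes a b :: "real ^ 'n::finite"
  shows "(\<lambda>n. bump n a b x) \<longlonglongrightarrow> indicator (box a b) x"
proof (cases "x \<in> box a b")
  case True
  have *: "(\<lambda>n. exp (- (1 / (real (Suc n) * r)))) \<longlonglongrightarrow> 1" for r
  proof -
    have "(\<lambda>n. exp (- (1 / real (Suc n) * (1 / r)))) \<longlonglongrightarrow> exp (- (0 * (1 / r)))"
      by (intro tendsto_intros LIMSEQ_Suc[OF lim_1_over_n])
    then show ?thesis by simp
  qed
  have "(\<lambda>n. \<Prod>i\<in>UNIV. exp (- (1 / (real (Suc n) * (x $ i - a $ i)))) *
      exp (- (1 / (real (Suc n) * (b $ i - x $ i))))) \<longlonglongrightarrow> (\<Prod>i\<in>(UNIV :: 'n set). 1 * 1)"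
    by (intro tendsto_prod tendsto_mult *)
  then show ?thesis using True by (simp add: bump_eq)
qed (simp add: bump_eq)

lemma test_functionsI:
  assumes "\<And>k. C_k k \<phi>" "compact K" "K \<subseteq> \<Omega>" "\<And>x. x \<notin> K \<Longrightarrow> \<phi> x = 0"
  shows "\<phi> \<in> test_functions \<Omega>"
proof -
  have "closure {x. \<phi> x \<noteq> 0} \<subseteq> K"
    using assms by (intro closure_minimal compact_imp_closed) auto
  then show ?thesis
    using assms by (auto simp: test_functions_def compact_eq_bounded_closed intro: bounded_subset)
qed

lemma test_functionsE:
  assumes "\<phi> \<in> test_functions \<Omega>"
  obtains K where "\<And>k. C_k k \<phi>" "compact K" "K \<subseteq> \<Omega>" "\<And>x. x \<notin> K \<Longrightarrow> \<phi> x = 0"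
proof
  show "x \<notin> closure {x. \<phi> x \<noteq> 0} \<Longrightarrow> \<phi> x = 0" for x
    using closure_subset[of "{x. \<phi> x \<noteq> 0}"] by blast
qed (use assms in \<open>auto simp: test_functions_def\<close>)

lemma bump_in_test_functions:
  assumes "cbox a b \<subseteq> \<Omega>"
  shows "bump n a b \<in> test_functions \<Omega>"
proof (rule test_functionsI)
  show "C_k k (bump n a b)" for k
    unfolding bump_def[abs_def] by (intro C_k_prod C_k_mult C_k_cutoff_affine) auto
  show "x \<notin> cbox a b \<Longrightarrow> bump n a b x = 0" for x
    using box_subset_cbox[of a b] by (auto simp: bump_eq)
qed (use assms in auto)

lemma test_functions_zero: "(\<lambda>x. 0) \<in> test_functions \<Omega>"
  by (rule test_functionsI[of _ "{}"]) (auto simp: C_k_const)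

lemma test_functions_add:
  assumes "\<phi> \<in> test_functions \<Omega>" "\<psi> \<in> test_functions \<Omega>"
  shows "(\<lambda>x. \<phi> x + \<psi> x) \<in> test_functions \<Omega>"
proof -
  obtain K where K: "\<And>k. C_k k \<phi>" "compact K" "K \<subseteq> \<Omega>" "\<And>x. x \<notin> K \<Longrightarrow> \<phi> x = 0"
    by (rule test_functionsE[OF assms(1)]) blast
  obtain L where L: "\<And>k. C_k k \<psi>" "compact L" "L \<subseteq> \<Omega>" "\<And>x. x \<notin> L \<Longrightarrow> \<psi> x = 0"
    by (rule test_functionsE[OF assms(2)]) blast
  show ?thesis
    by (rule test_functionsI[of _ "K \<union> L"]) (use K L in \<open>auto intro: C_k_add\<close>)
qed

lemma test_functions_mult:
  assumes "\<And>k. C_k k \<psi>" "\<phi> \<in> test_functions \<Omega>"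
  shows "(\<lambda>x. \<psi> x * \<phi> x) \<in> test_functions \<Omega>"
  by (rule test_functionsE[OF assms(2)], rule test_functionsI) (auto intro: C_k_mult assms(1))

lemma test_functions_scale: "\<phi> \<in> test_functions \<Omega> \<Longrightarrow> (\<lambda>x. r * \<phi> x) \<in> test_functions \<Omega>"
  by (intro test_functions_mult C_k_const)

lemma test_functions_partial:
  assumes "\<phi> \<in> test_functions \<Omega>"
  shows "partial i \<phi> \<in> test_functions \<Omega>"
proof -
  obtain K where K: "\<And>k. C_k k \<phi>" "compact K" "K \<subseteq> \<Omega>" "\<And>x. x \<notin> K \<Longrightarrow> \<phi> x = 0"
    by (rule test_functionsE[OF assms]) blast
  have "partial i \<phi> x = 0" if "x \<notin> K" for x
  proof -
    have "((\<lambda>x. 0) has_derivative (\<lambda>h. 0)) (at x)" by simp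
    then have "(\<phi> has_derivative (\<lambda>h. 0)) (at x)"
      by (rule has_derivative_transform_within_open[of _ _ _ _ "- K"])
        (use K that in \<open>auto intro: open_Compl compact_imp_closed\<close>)
    then show ?thesis by (rule partial_eqI)
  qed
  moreover have "C_k k (partial i \<phi>)" for k using K(1)[of "Suc k"] by simp
  ultimately show ?thesis using K by (intro test_functionsI[of _ K]) auto
qed

lemma test_functions_differentiable: "\<phi> \<in> test_functions \<Omega> \<Longrightarrow> \<phi> differentiable (at x)"
  by (erule test_functionsE) (metis C_k.simps(2))

lemma test_functions_continuous: "\<phi> \<in> test_functions \<Omega> \<Longrightarrow> continuous_on S \<phi>"
  by (erule test_functionsE) (metis C_k.simps(1) continuous_on_subset subset_UNIV)

lemma test_functions_integrable_lborel:
  assumes "\<phi> \<in> test_functions \<Omega>"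
  shows "integrable lborel \<phi>"
proof -
  obtain K where K: "compact K" "\<And>x. x \<notin> K \<Longrightarrow> \<phi> x = 0"
    by (rule test_functionsE[OF assms]) blast
  have "integrable lborel (\<lambda>x. indicator K x *\<^sub>R \<phi> x)"
    using K(1) test_functions_continuous[OF assms] by (rule borel_integrable_compact)
  also have "(\<lambda>x. indicator K x *\<^sub>R \<phi> x) = \<phi>" using K(2) by (auto simp: fun_eq_iff indicator_def)
  finally show ?thesis .
qed

lemma test_functions_bounded:
  assumes "\<phi> \<in> test_functions \<Omega>"
  obtains B where "0 \<le> B" "\<And>x. \<bar>\<phi> x\<bar> \<le> B"
proof -
  obtain K where K: "compact K" "\<And>x. x \<notin> K \<Longrightarrow> \<phi> x = 0"
    by (rule test_functionsE[OF assms]) blast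
  have "bounded (\<phi> ` K)"
    using K(1) test_functions_continuous[OF assms] by (intro compact_imp_bounded compact_continuous_image)
  then obtain B where "\<And>x. x \<in> K \<Longrightarrow> \<bar>\<phi> x\<bar> \<le> B" by (auto simp: bounded_iff)
  then have "\<bar>\<phi> x\<bar> \<le> max B 0" for x using K(2)[of x] by (cases "x \<in> K") (auto simp: le_max_iff_disj)
  then show ?thesis using that[of "max B 0"] by auto
qed

section \<open>Integration by parts and the fundamental lemma\<close>

lemma integral_translation:
  fixes f :: "real ^ 'n::finite \<Rightarrow> real"
  assumes "f \<in> borel_measurable borel"
  shows "(LINT x|lborel. f (x + y)) = (LINT x|lborel. f x)"
proof -
  have "(LINT x|lborel. f x) = (LINT x|distr lborel borel ((+) y). f x)"
    by (simp add: lborel_distr_plus)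
  also have "\<dots> = (LINT x|lborel. f (y + x))"
    using assms by (intro integral_distr) auto
  finally show ?thesis by (simp add: add.commute)
qed

text \<open>
  Difference quotients of \<open>\<psi>\<close> integrate to zero by translation invariance, and they converge boundedly
  to the derivative on a fixed ball.
\<close>
lemma integral_partial_eq_0:
  fixes \<psi> :: "real ^ 'n::finite \<Rightarrow> real"
  assumes \<psi>: "\<psi> \<in> test_functions \<Omega>"
  shows "(LINT x|lborel. partial i \<psi> x) = 0"
proof -
  define h where "h n = 1 / real (Suc n)" for n
  have h: "0 < h n" "h n \<le> 1" for n by (auto simp: h_def)
  have h_lim: "h \<longlonglongrightarrow> 0" unfolding h_def by (rule LIMSEQ_Suc[OF lim_1_over_n])
  define q where "q n x = (\<psi> (x + h n *\<^sub>R axis i 1) - \<psi> x) / h n" for n x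
  obtain K where K: "compact K" "\<And>x. x \<notin> K \<Longrightarrow> \<psi> x = 0"
    by (rule test_functionsE[OF \<psi>]) blast
  obtain R where R: "\<And>x. x \<in> K \<Longrightarrow> norm x \<le> R"
    using compact_imp_bounded[OF K(1)] by (auto simp: bounded_iff)
  obtain B where B: "0 \<le> B" "\<And>x. \<bar>partial i \<psi> x\<bar> \<le> B"
    using test_functions_bounded[OF test_functions_partial[OF \<psi>]] by blast
  have \<psi>_meas [measurable]: "\<psi> \<in> borel_measurable borel"
    using test_functions_continuous[OF \<psi>] by (rule borel_measurable_continuous_onI)
  \<comment> \<open>the derivative along the \<open>i\<close>-th coordinate line through \<open>x\<close>\<close>
  have line: "((\<lambda>t. \<psi> (x + t *\<^sub>R axis i 1)) has_real_derivative partial i \<psi> (x + t *\<^sub>R axis i 1)) (at t)" for x t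
  proof -
    have "((\<lambda>t. x + t *\<^sub>R axis i 1) has_derivative (\<lambda>s. s *\<^sub>R axis i 1)) (at t)"
      by (auto intro!: derivative_eq_intros)
    moreover have D: "(\<psi> has_derivative frechet_derivative \<psi> (at (x + t *\<^sub>R axis i 1))) (at (x + t *\<^sub>R axis i 1))"
      using test_functions_differentiable[OF \<psi>] by (simp add: frechet_derivative_works)
    ultimately have "((\<lambda>t. \<psi> (x + t *\<^sub>R axis i 1)) has_derivative
        (\<lambda>s. frechet_derivative \<psi> (at (x + t *\<^sub>R axis i 1)) (s *\<^sub>R axis i 1))) (at t)"
      by (rule has_derivative_compose)
    moreover have "frechet_derivative \<psi> (at (x + t *\<^sub>R axis i 1)) (s *\<^sub>R axis i 1)
        = partial i \<psi> (x + t *\<^sub>R axis i 1) * s" for s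
      using linear_scale[OF has_derivative_linear[OF D]] by (simp add: partial_def)
    ultimately show ?thesis by (simp add: has_field_derivative_def)
  qed
  have "(\<lambda>n. LINT x|lborel. q n x) \<longlonglongrightarrow> (LINT x|lborel. partial i \<psi> x)"
  proof (rule integral_dominated_convergence[where w = "\<lambda>x. B * indicator (cball 0 (R + 1)) x"])
    show "partial i \<psi> \<in> borel_measurable lborel"
      using test_functions_continuous[OF test_functions_partial[OF \<psi>]]
      by (simp add: borel_measurable_continuous_onI)
    show "q n \<in> borel_measurable lborel" for n
      unfolding q_def by measurable
    show "integrable lborel (\<lambda>x. B * indicator (cball 0 (R + 1)) x)"
      by (intro integrable_mult_right integrable_real_indicator) (use emeasure_bounded_finite[OF bounded_cball] in \<open>auto simp: less_top\<close>)
    show "AE x in lborel. (\<lambda>n. q n x) \<longlonglongrightarrow> partial i \<psi> x"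
    proof (rule AE_I2)
      fix x
      have "((\<lambda>t. (\<psi> (x + t *\<^sub>R axis i 1) - \<psi> x) / t) \<longlongrightarrow> partial i \<psi> x) (at 0)"
        using line[of x 0] by (simp add: has_field_derivative_iff)
      moreover have "filterlim h (at 0) sequentially"
        using h_lim h by (auto simp: filterlim_at intro!: always_eventually less_imp_neq[symmetric])
      ultimately show "(\<lambda>n. q n x) \<longlonglongrightarrow> partial i \<psi> x"
        unfolding q_def by (rule filterlim_compose)
    qed
    show "AE x in lborel. norm (q n x) \<le> B * indicator (cball 0 (R + 1)) x" for n
    proof (rule AE_I2)
      fix x
      show "norm (q n x) \<le> B * indicator (cball 0 (R + 1)) x"
      proof (cases "norm x \<le> R + 1")
        case True
        obtain z where "\<psi> (x + h n *\<^sub>R axis i 1) - \<psi> (x + 0 *\<^sub>R axis i 1)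
            = (h n - 0) * partial i \<psi> (x + z *\<^sub>R axis i 1)"
          using MVT2[OF h(1)[of n], of "\<lambda>t. \<psi> (x + t *\<^sub>R axis i 1)"
              "\<lambda>t. partial i \<psi> (x + t *\<^sub>R axis i 1)"] line by blast
        then have "q n x = partial i \<psi> (x + z *\<^sub>R axis i 1)"
          using h(1)[of n] by (simp add: q_def)
        then show ?thesis using B(2) True by simp
      next
        case False
        then have "x \<notin> K" using R[of x] by auto
        moreover have "x + h n *\<^sub>R axis i 1 \<notin> K"
        proof
          assume "x + h n *\<^sub>R axis i 1 \<in> K"
          then have "norm (x + h n *\<^sub>R axis i 1) \<le> R" by (rule R)
          moreover have "norm x \<le> norm (x + h n *\<^sub>R axis i 1) + norm (h n *\<^sub>R (axis i 1 :: real ^ 'n))"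
            using norm_triangle_ineq4[of "x + h n *\<^sub>R axis i 1" "h n *\<^sub>R axis i 1"] by simp
          moreover have "norm (h n *\<^sub>R (axis i 1 :: real ^ 'n)) \<le> 1" using h[of n] by (simp add: norm_axis_1)
          ultimately show False using False by simp
        qed
        ultimately show ?thesis using False K(2) by (simp add: q_def)
      qed
    qed
  qed
  moreover have "(LINT x|lborel. q n x) = 0" for n
  proof -
    have int: "integrable lborel \<psi>" by (rule test_functions_integrable_lborel[OF \<psi>])
    have shift: "integrable lborel (\<lambda>x. \<psi> (x + h n *\<^sub>R axis i 1))"
      using int lborel_distr_plus[of "h n *\<^sub>R axis i 1 :: real ^ 'n"]
        integrable_distr_eq[of "(+) (h n *\<^sub>R axis i 1)" lborel borel \<psi>]
      by (simp add: add.commute)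
    show ?thesis
      unfolding q_def using int shift integral_translation[OF \<psi>_meas] by simp
  qed
  ultimately show ?thesis using LIMSEQ_unique[OF _ tendsto_const[of 0]] by simp
qed

lemma integral_lebesgue_on_support:
  fixes f :: "real ^ 'n::finite \<Rightarrow> real"
  assumes "open \<Omega>" "f \<in> borel_measurable borel" "\<And>x. x \<notin> \<Omega> \<Longrightarrow> f x = 0"
  shows "(LINT x|lebesgue_on \<Omega>. f x) = (LINT x|lborel. f x)"
proof -
  have "\<Omega> \<in> sets lebesgue" using assms(1) by (simp add: lmeasurable_open borel_open)
  then have "(LINT x|lebesgue_on \<Omega>. f x) = (LINT x|lebesgue. indicator \<Omega> x *\<^sub>R f x)"
    by (simp add: integral_restrict_space)
  also have "(\<lambda>x. indicator \<Omega> x *\<^sub>R f x) = f" using assms(3) by (auto simp: indicator_def fun_eq_iff)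
  also have "(LINT x|lebesgue. f x) = (LINT x|lborel. f x)"
    using assms(2) by (simp add: integral_completion)
  finally show ?thesis .
qed

lemma test_functions_C_k: "\<phi> \<in> test_functions \<Omega> \<Longrightarrow> C_k k \<phi>"
  by (erule test_functionsE) blast

lemma test_functions_measurable: "\<phi> \<in> test_functions \<Omega> \<Longrightarrow> \<phi> \<in> borel_measurable borel"
  using test_functions_continuous by (metis borel_measurable_continuous_onI)

lemma test_functions_outside: "\<phi> \<in> test_functions \<Omega> \<Longrightarrow> x \<notin> \<Omega> \<Longrightarrow> \<phi> x = 0"
  by (erule test_functionsE) blast

lemma test_functions_L2:
  fixes \<phi> :: "real ^ 'n::finite \<Rightarrow> real"
  assumes "open \<Omega>" and \<phi>: "\<phi> \<in> test_functions \<Omega>"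
  shows "\<phi> \<in> L2_space \<Omega>"
proof -
  have [measurable]: "\<phi> \<in> borel_measurable borel" by (rule test_functions_measurable[OF \<phi>])
  have "(\<lambda>x. \<phi> x * \<phi> x) \<in> test_functions \<Omega>"
    by (intro test_functions_mult test_functions_C_k[OF \<phi>] \<phi>)
  then have "integrable lborel (\<lambda>x. (\<phi> x)\<^sup>2)"
    unfolding power2_eq_square by (rule test_functions_integrable_lborel)
  then have "integrable lebesgue (\<lambda>x. (\<phi> x)\<^sup>2)" by (simp add: integrable_completion)
  moreover have "\<Omega> \<in> sets lebesgue" using assms(1) by (simp add: borel_open)
  ultimately have "integrable (lebesgue_on \<Omega>) (\<lambda>x. (\<phi> x)\<^sup>2)"
    using integrable_mult_indicator[of \<Omega> lebesgue "\<lambda>x. (\<phi> x)\<^sup>2"]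
    by (simp add: integrable_restrict_space)
  moreover have "\<phi> \<in> borel_measurable lebesgue" by (rule measurable_completion) simp
  then have "\<phi> \<in> borel_measurable (lebesgue_on \<Omega>)" by (rule measurable_restrict_space1)
  ultimately show ?thesis by (simp add: L2_space_def)
qed

lemma integration_by_parts:
  assumes "open \<Omega>" and \<phi>: "\<phi> \<in> test_functions \<Omega>" and \<psi>: "\<And>k. C_k k \<psi>"
  shows "(LINT x|lebesgue_on \<Omega>. \<psi> x * partial i \<phi> x) = - (LINT x|lebesgue_on \<Omega>. partial i \<psi> x * \<phi> x)"
proof -
  have 1: "(\<lambda>x. \<psi> x * \<phi> x) \<in> test_functions \<Omega>" "(\<lambda>x. \<psi> x * partial i \<phi> x) \<in> test_functions \<Omega>"
    "(\<lambda>x. partial i \<psi> x * \<phi> x) \<in> test_functions \<Omega>"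
    using \<psi> C_k.simps(2)[THEN iffD1, OF \<psi>] by (auto intro!: test_functions_mult test_functions_partial \<phi>)
  have "\<psi> differentiable (at x)" for x using \<psi>[of 1] by simp
  then have "partial i (\<lambda>x. \<psi> x * \<phi> x) = (\<lambda>x. \<psi> x * partial i \<phi> x + partial i \<psi> x * \<phi> x)"
    by (intro partial_mult test_functions_differentiable[OF \<phi>])
  then have "(LINT x|lborel. \<psi> x * partial i \<phi> x + partial i \<psi> x * \<phi> x) = 0"
    using integral_partial_eq_0[OF 1(1), of i] by simp
  then have "(LINT x|lborel. \<psi> x * partial i \<phi> x) + (LINT x|lborel. partial i \<psi> x * \<phi> x) = 0"
    using 1(2,3)[THEN test_functions_integrable_lborel] by simp
  moreover have "(LINT x|lebesgue_on \<Omega>. f x) = (LINT x|lborel. f x)" if "f \<in> test_functions \<Omega>" for f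
    using that \<open>open \<Omega>\<close> by (intro integral_lebesgue_on_support test_functions_measurable test_functions_outside)
  ultimately show ?thesis using 1 by simp
qed

text \<open>
  Testing with bump functions and passing to the limit shows that \<open>g\<close> has integral zero over every box
  whose closure lies in \<open>\<Omega>\<close>.  Boxes generate the Borel sets and are stable under intersection, so \<open>g\<close>
  has integral zero over all Borel subsets of such a box and vanishes there almost everywhere;
  countably many boxes exhaust \<open>\<Omega>\<close>.
\<close>
theorem fundamental_lemma:
  fixes \<Omega> :: "(real ^ 'n::finite) set"
  assumes \<Omega>: "open \<Omega>" "bounded \<Omega>" and g: "g \<in> L2_space \<Omega>"
    and orth: "\<And>\<phi>. \<phi> \<in> test_functions \<Omega> \<Longrightarrow> L2_inner \<Omega> g \<phi> = 0"
  shows "AE x in lebesgue_on \<Omega>. g x = 0"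
proof -
  have lm: "\<Omega> \<in> lmeasurable" using \<Omega> by (simp add: lmeasurable_open)
  then have sl: "\<Omega> \<in> sets lebesgue" by auto
  have int: "integrable lebesgue (\<lambda>x. indicator \<Omega> x *\<^sub>R g x)"
    using L2_integrable[OF lm g] sl by (simp add: integrable_restrict_space)
  \<comment> \<open>\<open>g\<close> is only Lebesgue measurable; generators of the Borel sets apply to a Borel version of it\<close>
  then obtain G where G_meas [measurable]: "G \<in> borel_measurable lborel"
    and G_eq: "AE x in lborel. indicator \<Omega> x *\<^sub>R g x = G x"
    using completion_ex_borel_measurable_real[OF borel_measurable_integrable] by blast
  have G_eq': "AE x in lebesgue. indicator \<Omega> x *\<^sub>R g x = G x" by (rule AE_completion[OF G_eq])
  have "integrable lebesgue G"
    by (rule integrable_cong_AE_imp[OF int _ G_eq']) (simp add: measurable_completion)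
  then have G_int: "integrable lborel G" by (simp add: integrable_completion)
  have G_orth: "(LINT x|lborel. G x * \<phi> x) = 0" if \<phi>: "\<phi> \<in> test_functions \<Omega>" for \<phi>
  proof -
    have [measurable]: "\<phi> \<in> borel_measurable borel" by (rule test_functions_measurable[OF \<phi>])
    have "(LINT x|lborel. G x * \<phi> x) = (LINT x|lebesgue. G x * \<phi> x)"
      by (rule integral_completion[symmetric]) measurable
    also have "\<dots> = (LINT x|lebesgue. indicator \<Omega> x *\<^sub>R (g x * \<phi> x))"
    proof (rule integral_cong_AE)
      show "(\<lambda>x. G x * \<phi> x) \<in> borel_measurable lebesgue" by (rule measurable_completion) measurable
      have "integrable (lebesgue_on \<Omega>) (\<lambda>x. g x * \<phi> x)"
        by (rule L2_mult_integrable[OF g test_functions_L2[OF \<Omega>(1) \<phi>]])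
      then show "(\<lambda>x. indicator \<Omega> x *\<^sub>R (g x * \<phi> x)) \<in> borel_measurable lebesgue"
        using sl by (simp add: integrable_restrict_space borel_measurable_integrable)
      show "AE x in lebesgue. G x * \<phi> x = indicator \<Omega> x *\<^sub>R (g x * \<phi> x)"
        using G_eq' by eventually_elim (auto simp: indicator_def test_functions_outside[OF \<phi>])
    qed
    also have "\<dots> = L2_inner \<Omega> g \<phi>" unfolding L2_inner_def using sl by (simp add: integral_restrict_space)
    finally show ?thesis using orth[OF \<phi>] by simp
  qed
  have box_zero: "(LINT x:box a b|lborel. G x) = 0" if ab: "cbox a b \<subseteq> \<Omega>" for a b
  proof -
    have "(\<lambda>n. LINT x|lborel. G x * bump n a b x) \<longlonglongrightarrow> (LINT x|lborel. G x * indicator (box a b) x)"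
    proof (rule integral_dominated_convergence[where w = "\<lambda>x. norm (G x)"])
      show "(\<lambda>x. G x * bump n a b x) \<in> borel_measurable lborel" for n
        using test_functions_measurable[OF bump_in_test_functions[OF ab]] by measurable
      show "AE x in lborel. (\<lambda>n. G x * bump n a b x) \<longlonglongrightarrow> G x * indicator (box a b) x"
        by (intro AE_I2 tendsto_mult_left bump_tendsto)
      show "AE x in lborel. norm (G x * bump n a b x) \<le> norm (G x)" for n
        using bump_bounds[of n a b] by (auto simp: abs_mult intro!: AE_I2 mult_left_le)
    qed (use G_int in auto)
    then have "(LINT x|lborel. G x * indicator (box a b) x) = 0"
      using G_orth[OF bump_in_test_functions[OF ab]] LIMSEQ_unique[OF _ tendsto_const[of 0]] by simp
    then show ?thesis by (simp add: set_lebesgue_integral_def mult.commute)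
  qed
  have cover: "AE x in lborel. x \<in> box a b \<longrightarrow> G x = 0" if ab: "cbox a b \<subseteq> \<Omega>" for a b
  proof -
    have G_set: "set_integrable lborel A G" if "A \<in> sets borel" for A
      using G_int that unfolding set_integrable_def by (intro integrable_mult_indicator) auto
    have zero: "(LINT x:A \<inter> box a b|lborel. G x) = 0" if "A \<in> sets borel" for A
    proof -
      have "box c d \<in> range (\<lambda>(a, b). box a b)" for c d :: "real ^ 'n"
        by (rule range_eqI[of _ _ "(c, d)"]) simp
      then have "Int_stable (range (\<lambda>(a, b). box a b :: (real ^ 'n) set))"
        by (intro Int_stableI) (auto simp only: box_Int_box split_beta)
      moreover have "range (\<lambda>(a, b). box a b :: (real ^ 'n) set) \<subseteq> Pow UNIV" by simp
      moreover have "A \<in> sigma_sets UNIV (range (\<lambda>(a, b). box a b))"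
        using that borel_eq_box by (metis sets_measure_of subset_UNIV Pow_UNIV)
      ultimately show ?thesis
      proof (induction rule: sigma_sets_induct_disjoint)
        case (basic A)
        then obtain c d where "A = box c d" by auto
        then obtain c' d' where cd: "A \<inter> box a b = box c' d'" by (auto simp: box_Int_box)
        show ?case
        proof (cases "box c' d' = {}")
          case False
          then have "cbox c' d' \<subseteq> cbox a b"
            using cd closure_mono[of "box c' d'" "box a b"] by (metis closure_box empty_subsetI inf_le2 inf_bot_right)
          then show ?thesis using box_zero[of c' d'] ab cd by simp
        qed (simp add: cd set_lebesgue_integral_def)
      next
        case (compl A)
        then have A: "A \<in> sets borel" using borel_eq_box by (metis sets_measure_of subset_UNIV Pow_UNIV)
        have "(LINT x:(A \<inter> box a b) \<union> ((UNIV - A) \<inter> box a b)|lborel. G x)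
            = (LINT x:A \<inter> box a b|lborel. G x) + (LINT x:(UNIV - A) \<inter> box a b|lborel. G x)"
          using A by (intro set_integral_Un G_set) auto
        moreover have "(A \<inter> box a b) \<union> ((UNIV - A) \<inter> box a b) = box a b" by auto
        ultimately show ?case using compl.IH box_zero[OF ab] by simp
      next
        case (union A)
        then have A: "A i \<in> sets borel" for i
          using borel_eq_box by (metis sets_measure_of subset_UNIV Pow_UNIV range_subsetD)
        have "(LINT x:(\<Union>i. A i \<inter> box a b)|lborel. G x) = (\<Sum>i. LINT x:A i \<inter> box a b|lborel. G x)"
          using A union.hyps(1)
          by (intro lebesgue_integral_countable_add G_set) (auto simp: disjoint_family_on_def)
        then show ?case using union.IH by (simp flip: UN_extend_simps)
      qed (simp add: set_lebesgue_integral_def)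
    qed
    have "AE x in lborel. indicator (box a b) x *\<^sub>R G x = 0"
    proof (rule sigma_finite_measure.density_zero[OF sigma_finite_lborel])
      show "integrable lborel (\<lambda>x. indicator (box a b) x *\<^sub>R G x)"
        using G_int by (intro integrable_mult_indicator) auto
      show "(LINT x:A|lborel. indicator (box a b) x *\<^sub>R G x) = 0" if "A \<in> sets lborel" for A
        using zero[of A] that by (simp add: set_lebesgue_integral_def indicator_inter_arith mult.assoc)
    qed
    then show ?thesis by (auto simp: indicator_def)
  qed
  have "AE x in lborel. x \<in> \<Omega> \<longrightarrow> G x = 0"
  proof -
    obtain D where D: "countable D" "\<And>X. X \<in> D \<Longrightarrow> \<exists>a b. X = cbox a b" "\<And>X. X \<in> D \<Longrightarrow> X \<subseteq> \<Omega>" "\<Union>D = \<Omega>"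
      using open_countable_Union_open_cbox[OF \<Omega>(1)] by (metis PowD subsetD)
    have "AE x in lborel. \<forall>X\<in>D. x \<in> X \<longrightarrow> G x = 0"
    proof (rule AE_ball_countable')
      show "countable D" by fact
      fix X assume X: "X \<in> D"
      then obtain a b where ab: "X = cbox a b" using D by blast
      have "emeasure lborel (cbox a b - box a b) = 0"
        using emeasure_lborel_cbox_eq[of a b] emeasure_lborel_box_eq[of a b] box_subset_cbox[of a b]
        by (subst emeasure_Diff) (auto simp: emeasure_lborel_cbox_eq emeasure_lborel_box_eq)
      then have "AE x in lborel. x \<notin> cbox a b - box a b"
        by (intro AE_not_in null_setsI) auto
      then show "AE x in lborel. x \<in> X \<longrightarrow> G x = 0"
        using cover[of a b] D(3)[OF X] ab by (auto elim: eventually_elim2)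
    qed
    then show ?thesis by eventually_elim (use D(4) in blast)
  qed
  then have "AE x in lebesgue. x \<in> \<Omega> \<longrightarrow> G x = 0" by (rule AE_completion)
  with G_eq' have "AE x in lebesgue. x \<in> \<Omega> \<longrightarrow> g x = 0"
    by eventually_elim (auto simp: indicator_def split: if_splits)
  then show ?thesis using sl by (simp add: AE_restrict_space_iff)
qed

section \<open>Sobolev spaces\<close>

lemma semi_inner_space_add:
  assumes "semi_inner_space V p" "semi_inner_space V q" "0 \<le> r"
  shows "semi_inner_space V (\<lambda>u v. p u v + r * q u v)"
proof -
  interpret p: semi_inner_space V p by fact
  interpret q: semi_inner_space V q by fact
  show ?thesis
    by unfold_locales (use \<open>0 \<le> r\<close> in \<open>auto simp: p.mem_intros p.ip_simps q.ip_simps p.ip_nonneg q.ip_nonneg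
        distrib_left right_diff_distrib intro: p.ip_commute q.ip_commute arg_cong2[where f = "\<lambda>x y. x + r * y"]\<close>)
qed

lemma semi_inner_space_subspace:
  assumes "semi_inner_space V p" "W \<subseteq> V" "(\<lambda>x. 0) \<in> W"
    and "\<And>u v. u \<in> W \<Longrightarrow> v \<in> W \<Longrightarrow> (\<lambda>x. u x + v x) \<in> W"
    and "\<And>u r. u \<in> W \<Longrightarrow> (\<lambda>x. r * u x) \<in> W"
  shows "semi_inner_space W p"
proof -
  interpret p: semi_inner_space V p by fact
  show ?thesis
    by unfold_locales (use assms in \<open>auto simp: p.ip_simps p.ip_nonneg subset_iff intro: p.ip_commute\<close>)
qed

definition grad_inner :: "(real ^ 'n::finite) set \<Rightarrow> (real ^ 'n \<Rightarrow> real) \<Rightarrow> (real ^ 'n \<Rightarrow> real) \<Rightarrow> real"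
  where "grad_inner \<Omega> u v = (\<Sum>i\<in>UNIV. L2_inner \<Omega> (weak_partial \<Omega> i u) (weak_partial \<Omega> i v))"

definition grad_norm :: "(real ^ 'n::finite) set \<Rightarrow> (real ^ 'n \<Rightarrow> real) \<Rightarrow> real"
  where "grad_norm \<Omega> u = sqrt (grad_inner \<Omega> u u)"

text \<open>
  The factor 1 gives the definition the shape \<open>p u v + r * q u v\<close> in which semi-inner products are added.
\<close>
definition H1_inner :: "(real ^ 'n::finite) set \<Rightarrow> (real ^ 'n \<Rightarrow> real) \<Rightarrow> (real ^ 'n \<Rightarrow> real) \<Rightarrow> real"
  where "H1_inner \<Omega> u v = L2_inner \<Omega> u v + 1 * grad_inner \<Omega> u v"

lemma H1_norm_eq: "H1_norm \<Omega> u = sqrt (H1_inner \<Omega> u u)"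
proof -
  have "(L2_norm \<Omega> v)\<^sup>2 = L2_inner \<Omega> v v" for v
    by (simp add: L2_norm_def L2_inner_def)
  then show ?thesis by (simp add: H1_norm_def H1_inner_def grad_inner_def)
qed

text \<open>
  The choice operator in \<open>weak_partial\<close> is harmless because weak derivatives are unique up to null sets.
  Linearity of \<open>weak_partial\<close>, and with it every bilinear form below, therefore holds almost everywhere
  or after integration only.
\<close>
locale bounded_open_set =
  fixes \<Omega> :: "(real ^ 'n::finite) set"
  assumes open_\<Omega>: "open \<Omega>" and bounded_\<Omega>: "bounded \<Omega>"
begin

abbreviation (input) "L2 \<equiv> L2_space \<Omega>"
abbreviation (input) "H1 \<equiv> H1_space \<Omega>"
abbreviation (input) "H10 \<equiv> H10_space \<Omega>"
abbreviation (input) "tests \<equiv> test_functions \<Omega>"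
abbreviation (input) "ip \<equiv> L2_inner \<Omega>"
abbreviation (input) "nrm \<equiv> L2_norm \<Omega>"
abbreviation (input) "wpart \<equiv> weak_partial \<Omega>"
abbreviation (input) "gnorm \<equiv> grad_norm \<Omega>"
abbreviation (input) "H1nrm \<equiv> H1_norm \<Omega>"

lemma lmeasurable_\<Omega>: "\<Omega> \<in> lmeasurable"
  using open_\<Omega> bounded_\<Omega> by (simp add: lmeasurable_open)

lemma weak_partial_unique:
  assumes "is_weak_partial \<Omega> i u g" "is_weak_partial \<Omega> i u g'" "g \<in> L2" "g' \<in> L2"
  shows "AE x in lebesgue_on \<Omega>. g x = g' x"
proof -
  have "AE x in lebesgue_on \<Omega>. g x - g' x = 0"
  proof (rule fundamental_lemma[OF open_\<Omega> bounded_\<Omega> L2.diff_mem[OF assms(3,4)]])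
    fix \<phi> assume "\<phi> \<in> tests"
    then show "ip (\<lambda>x. g x - g' x) \<phi> = 0"
      using assms by (simp add: L2.ip_simps test_functions_L2[OF open_\<Omega>] is_weak_partial_def)
  qed
  then show ?thesis by simp
qed

lemma weak_partial:
  assumes "u \<in> H1"
  shows weak_partial_L2: "wpart i u \<in> L2"
    and is_weak_partial_weak_partial: "is_weak_partial \<Omega> i u (wpart i u)"
proof -
  have "\<exists>g. g \<in> L2 \<and> is_weak_partial \<Omega> i u g" using assms by (auto simp: H1_space_def)
  from someI_ex[OF this] show "wpart i u \<in> L2" "is_weak_partial \<Omega> i u (wpart i u)"
    by (auto simp: weak_partial_def)
qed

lemma H1_L2: "u \<in> H1 \<Longrightarrow> u \<in> L2"
  by (simp add: H1_space_def)

lemma weak_partial_eq_AE: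
  assumes "u \<in> H1" "is_weak_partial \<Omega> i u g" "g \<in> L2"
  shows "AE x in lebesgue_on \<Omega>. wpart i u x = g x"
  by (rule weak_partial_unique) (use assms weak_partial in auto)

lemma is_weak_partial_add:
  assumes "u \<in> H1" "v \<in> H1"
  shows "is_weak_partial \<Omega> i (\<lambda>x. u x + v x) (\<lambda>x. wpart i u x + wpart i v x)"
  unfolding is_weak_partial_def
proof
  fix \<phi> assume \<phi>: "\<phi> \<in> tests"
  then show "ip (\<lambda>x. u x + v x) (partial i \<phi>)
      = - ip (\<lambda>x. wpart i u x + wpart i v x) \<phi>"
    using assms is_weak_partial_weak_partial[OF assms(1), of i] is_weak_partial_weak_partial[OF assms(2), of i]
    by (simp add: L2.ip_simps H1_L2 weak_partial_L2 test_functions_L2[OF open_\<Omega>] test_functions_partial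
        is_weak_partial_def)
qed

lemma is_weak_partial_scale:
  assumes "u \<in> H1"
  shows "is_weak_partial \<Omega> i (\<lambda>x. r * u x) (\<lambda>x. r * wpart i u x)"
  unfolding is_weak_partial_def
proof
  fix \<phi> assume \<phi>: "\<phi> \<in> tests"
  then show "ip (\<lambda>x. r * u x) (partial i \<phi>) = - ip (\<lambda>x. r * wpart i u x) \<phi>"
    using assms is_weak_partial_weak_partial[OF assms(1), of i]
    by (simp add: L2.ip_simps H1_L2 weak_partial_L2 test_functions_L2[OF open_\<Omega>] test_functions_partial
        is_weak_partial_def)
qed

lemma H1I: "u \<in> L2 \<Longrightarrow> (\<And>i. is_weak_partial \<Omega> i u (g i)) \<Longrightarrow> (\<And>i. g i \<in> L2) \<Longrightarrow> u \<in> H1"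
  unfolding H1_space_def by blast

lemma H1_add_mem: "u \<in> H1 \<Longrightarrow> v \<in> H1 \<Longrightarrow> (\<lambda>x. u x + v x) \<in> H1"
  by (rule H1I) (auto intro: is_weak_partial_add weak_partial_L2 L2.add_mem H1_L2)

lemma H1_scale_mem: "u \<in> H1 \<Longrightarrow> (\<lambda>x. r * u x) \<in> H1"
  by (rule H1I) (auto intro: is_weak_partial_scale weak_partial_L2 L2.scale_mem H1_L2)

lemma weak_partial_add_AE:
  "u \<in> H1 \<Longrightarrow> v \<in> H1 \<Longrightarrow>
   AE x in lebesgue_on \<Omega>. wpart i (\<lambda>x. u x + v x) x = wpart i u x + wpart i v x"
  by (intro weak_partial_eq_AE is_weak_partial_add H1_add_mem L2.add_mem weak_partial_L2)

lemma weak_partial_scale_AE: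
  "u \<in> H1 \<Longrightarrow> AE x in lebesgue_on \<Omega>. wpart i (\<lambda>x. r * u x) x = r * wpart i u x"
  by (intro weak_partial_eq_AE is_weak_partial_scale H1_scale_mem L2.scale_mem weak_partial_L2)

lemma test_function_is_weak_partial:
  assumes "\<phi> \<in> tests"
  shows "is_weak_partial \<Omega> i \<phi> (partial i \<phi>)"
  unfolding is_weak_partial_def L2_inner_def
  using integration_by_parts[OF open_\<Omega> _ test_functions_C_k[OF assms]] by blast

lemma test_functions_H1: "\<phi> \<in> tests \<Longrightarrow> \<phi> \<in> H1"
  by (rule H1I[where g = "\<lambda>i. partial i \<phi>"])
    (auto intro: test_function_is_weak_partial test_functions_L2[OF open_\<Omega>] test_functions_partial)

lemma H1_zero: "(\<lambda>x. 0) \<in> H1"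
  by (intro test_functions_H1 test_functions_zero)

lemma semi_inner_space_grad: "semi_inner_space (H1) (grad_inner \<Omega>)"
proof (unfold_locales)
  fix u v assume u: "u \<in> H1" and v: "v \<in> H1"
  show "grad_inner \<Omega> u v = grad_inner \<Omega> v u"
    unfolding grad_inner_def by (intro sum.cong refl L2.ip_commute weak_partial_L2 u v)
  fix w assume w: "w \<in> H1"
  have "ip (wpart i (\<lambda>x. u x + v x)) (wpart i w)
      = ip (\<lambda>x. wpart i u x + wpart i v x) (wpart i w)" for i
    by (intro L2_inner_cong_AE weak_partial_add_AE weak_partial_L2 L2.add_mem H1_add_mem u v w) simp
  then show "grad_inner \<Omega> (\<lambda>x. u x + v x) w = grad_inner \<Omega> u w + grad_inner \<Omega> v w"
    using u v w by (simp add: grad_inner_def L2.ip_simps weak_partial_L2 sum.distrib)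
next
  fix u w r assume u: "u \<in> H1" and w: "w \<in> H1"
  have "ip (wpart i (\<lambda>x. r * u x)) (wpart i w)
      = ip (\<lambda>x. r * wpart i u x) (wpart i w)" for i
    by (intro L2_inner_cong_AE weak_partial_scale_AE weak_partial_L2 L2.scale_mem H1_scale_mem u w) simp
  then show "grad_inner \<Omega> (\<lambda>x. r * u x) w = r * grad_inner \<Omega> u w"
    using u w by (simp add: grad_inner_def L2.ip_simps weak_partial_L2 sum_distrib_left)
next
  fix u assume "u \<in> H1"
  then show "0 \<le> grad_inner \<Omega> u u"
    unfolding grad_inner_def by (intro sum_nonneg L2.ip_nonneg weak_partial_L2)
qed (auto intro: H1_zero H1_add_mem H1_scale_mem)

sublocale grad: semi_inner_space "H1" "grad_inner \<Omega>"
  rewrites "semi_inner_space.seminorm (grad_inner \<Omega>) = gnorm"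
proof -
  show "semi_inner_space (H1) (grad_inner \<Omega>)" by (rule semi_inner_space_grad)
  show "semi_inner_space.seminorm (grad_inner \<Omega>) = gnorm"
    by (intro ext) (simp add: semi_inner_space.seminorm_def[OF semi_inner_space_grad] grad_norm_def)
qed

lemma semi_inner_space_H1: "semi_inner_space (H1) (H1_inner \<Omega>)"
  unfolding H1_inner_def[abs_def]
  by (intro semi_inner_space_add semi_inner_space_grad semi_inner_space_subspace[OF semi_inner_space_L2])
    (auto intro: H1_L2 H1_zero H1_add_mem H1_scale_mem)

sublocale H1: semi_inner_space "H1" "H1_inner \<Omega>"
  rewrites "semi_inner_space.seminorm (H1_inner \<Omega>) = H1nrm"
proof -
  show "semi_inner_space (H1) (H1_inner \<Omega>)" by (rule semi_inner_space_H1)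
  show "semi_inner_space.seminorm (H1_inner \<Omega>) = H1nrm"
    by (intro ext) (simp add: semi_inner_space.seminorm_def[OF semi_inner_space_H1] H1_norm_eq)
qed

lemma H1_norm_power2: "u \<in> H1 \<Longrightarrow> (H1nrm u)\<^sup>2 = (nrm u)\<^sup>2 + (gnorm u)\<^sup>2"
  by (simp add: H1.seminorm_power2 L2.seminorm_power2 grad.seminorm_power2 H1_L2 H1_inner_def)

lemma L2_norm_le_H1: "u \<in> H1 \<Longrightarrow> nrm u \<le> H1nrm u"
  by (rule power2_le_imp_le) (auto simp: H1_norm_power2 H1.seminorm_nonneg)

lemma grad_norm_le_H1: "u \<in> H1 \<Longrightarrow> gnorm u \<le> H1nrm u"
  by (rule power2_le_imp_le) (auto simp: H1_norm_power2 H1.seminorm_nonneg)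

lemma weak_partial_norm_le:
  assumes "u \<in> H1"
  shows "nrm (wpart i u) \<le> gnorm u"
proof (rule power2_le_imp_le)
  have "ip (wpart i u) (wpart i u) \<le> grad_inner \<Omega> u u"
    unfolding grad_inner_def
    by (rule member_le_sum) (auto intro: L2.ip_nonneg weak_partial_L2 assms)
  then show "(nrm (wpart i u))\<^sup>2 \<le> (gnorm u)\<^sup>2"
    using assms by (simp add: L2.seminorm_power2 grad.seminorm_power2 weak_partial_L2)
qed (simp add: grad.seminorm_nonneg assms)

lemma weak_partial_diff_norm:
  assumes "u \<in> H1" "v \<in> H1"
  shows "nrm (\<lambda>x. wpart i u x - wpart i v x)
    = nrm (wpart i (\<lambda>x. u x - v x))"
proof (rule L2_norm_cong_AE)
  have "AE x in lebesgue_on \<Omega>. wpart i (\<lambda>x. u x + -1 * v x) x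
      = wpart i u x + wpart i (\<lambda>x. -1 * v x) x"
    by (intro weak_partial_add_AE assms H1_scale_mem)
  with weak_partial_scale_AE[OF assms(2), of i "-1"]
  show "AE x in lebesgue_on \<Omega>. wpart i u x - wpart i v x
      = wpart i (\<lambda>x. u x - v x) x"
    by eventually_elim simp
qed (intro L2.diff_mem weak_partial_L2 H1.diff_mem assms)+

text \<open>
  The functions and their weak derivatives converge separately in \<open>L\<^sup>2\<close>, and the defining identity of a
  weak derivative is continuous in both of its members.
\<close>
lemma H1_complete: "semi_inner_space.complete (H1) (H1_inner \<Omega>)"
  unfolding H1.complete_def
proof (intro allI impI)
  fix u assume "semi_inner_space.Cauchy_in (H1) (H1_inner \<Omega>) u"
  then have u: "\<And>n. u n \<in> H1"
    and cauchy: "\<And>e. e > 0 \<Longrightarrow> \<exists>N. \<forall>m\<ge>N. \<forall>n\<ge>N. H1nrm (\<lambda>x. u m x - u n x) < e"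
    unfolding H1.Cauchy_in_def by auto
  have d: "(\<lambda>x. u m x - u n x) \<in> H1" for m n by (intro H1.diff_mem u)
  have lim: "\<exists>l\<in>L2. (\<lambda>n. nrm (\<lambda>x. v n x - l x)) \<longlonglongrightarrow> 0"
    if v: "\<And>n. v n \<in> L2"
      and le: "\<And>m n. nrm (\<lambda>x. v m x - v n x) \<le> H1nrm (\<lambda>x. u m x - u n x)" for v
  proof -
    have "semi_inner_space.Cauchy_in (L2) (ip) v"
      unfolding L2.Cauchy_in_def using v cauchy le_less_trans[OF le] by meson
    then show ?thesis using L2_complete[OF lmeasurable_\<Omega>] unfolding L2.complete_def by blast
  qed
  obtain l where l: "l \<in> L2" "(\<lambda>n. nrm (\<lambda>x. u n x - l x)) \<longlonglongrightarrow> 0"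
    using lim[OF H1_L2[OF u] L2_norm_le_H1[OF d]] by (elim bexE) blast
  have "\<exists>g\<in>L2. (\<lambda>n. nrm (\<lambda>x. wpart i (u n) x - g x)) \<longlonglongrightarrow> 0" for i
  proof (rule lim)
    show "nrm (\<lambda>x. wpart i (u m) x - wpart i (u n) x)
        \<le> H1nrm (\<lambda>x. u m x - u n x)" for m n
      using weak_partial_diff_norm[OF u u, of i m n] weak_partial_norm_le[OF d, of i m n]
        grad_norm_le_H1[OF d, of m n] by linarith
  qed (intro weak_partial_L2 u)
  then have "\<forall>i. \<exists>g. g \<in> L2 \<and> (\<lambda>n. nrm (\<lambda>x. wpart i (u n) x - g x)) \<longlonglongrightarrow> 0"
    by blast
  from choice[OF this] obtain g where g: "\<And>i. g i \<in> L2"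
    "\<And>i. (\<lambda>n. nrm (\<lambda>x. wpart i (u n) x - g i x)) \<longlonglongrightarrow> 0" by blast
  have weak: "is_weak_partial \<Omega> i l (g i)" for i
    unfolding is_weak_partial_def
  proof
    fix \<phi> assume \<phi>: "\<phi> \<in> tests"
    note L = test_functions_L2[OF open_\<Omega>]
    have 1: "(\<lambda>n. ip (u n) (partial i \<phi>)) \<longlonglongrightarrow> ip l (partial i \<phi>)"
      by (intro L2.ip_tendsto H1_L2 u l L test_functions_partial \<phi>)
    have 2: "(\<lambda>n. - ip (wpart i (u n)) \<phi>) \<longlonglongrightarrow> - ip (g i) \<phi>"
      by (intro tendsto_minus L2.ip_tendsto weak_partial_L2 u g L \<phi>)
    have "ip (u n) (partial i \<phi>) = - ip (wpart i (u n)) \<phi>" for n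
      using is_weak_partial_weak_partial[OF u] \<phi> unfolding is_weak_partial_def by blast
    then show "ip l (partial i \<phi>) = - ip (g i) \<phi>"
      using LIMSEQ_unique[OF 1] 2 by simp
  qed
  have lH: "l \<in> H1" by (rule H1I[OF l(1) weak g(1)])
  have "nrm (wpart i (\<lambda>x. u n x - l x)) = nrm (\<lambda>x. wpart i (u n) x - g i x)" for i n
    unfolding weak_partial_diff_norm[OF u lH, symmetric]
  proof (rule L2_norm_cong_AE)
    show "AE x in lebesgue_on \<Omega>. wpart i (u n) x - wpart i l x = wpart i (u n) x - g i x"
      using weak_partial_eq_AE[OF lH weak g(1), of i] by eventually_elim simp
  qed (intro L2.diff_mem weak_partial_L2 u lH g)+
  then have "H1nrm (\<lambda>x. u n x - l x) = sqrt ((nrm (\<lambda>x. u n x - l x))\<^sup>2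
      + (\<Sum>i\<in>UNIV. (nrm (\<lambda>x. wpart i (u n) x - g i x))\<^sup>2))" for n
    by (simp add: H1_norm_def)
  moreover have "(\<lambda>n. sqrt ((nrm (\<lambda>x. u n x - l x))\<^sup>2
      + (\<Sum>i\<in>UNIV. (nrm (\<lambda>x. wpart i (u n) x - g i x))\<^sup>2))) \<longlonglongrightarrow> sqrt (0\<^sup>2 + (\<Sum>i\<in>(UNIV :: 'n set). 0\<^sup>2))"
    by (intro tendsto_intros l g)
  ultimately have "(\<lambda>n. H1nrm (\<lambda>x. u n x - l x)) \<longlonglongrightarrow> 0" by simp
  with lH show "\<exists>l\<in>H1. (\<lambda>n. H1nrm (\<lambda>x. u n x - l x)) \<longlonglongrightarrow> 0" by blast
qed

lemma H10_H1: "u \<in> H10 \<Longrightarrow> u \<in> H1"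
  by (simp add: H10_space_def)

lemma H10_approx:
  assumes "u \<in> H10" "0 < e"
  obtains \<phi> where "\<phi> \<in> tests" "H1nrm (\<lambda>x. \<phi> x - u x) < e"
proof -
  obtain \<phi> where \<phi>: "\<And>n. \<phi> n \<in> tests" "(\<lambda>n. H1nrm (\<lambda>x. \<phi> n x - u x)) \<longlonglongrightarrow> 0"
    using assms(1) by (auto simp: H10_space_def)
  then have "\<forall>\<^sub>F n in sequentially. H1nrm (\<lambda>x. \<phi> n x - u x) < e"
    using assms(2) by (auto dest: order_tendstoD(2))
  then obtain n where "H1nrm (\<lambda>x. \<phi> n x - u x) < e" by (auto dest: eventually_happens)
  then show ?thesis using that \<phi>(1) by blast
qed

lemma H10I:
  assumes u: "u \<in> H1"
    and approx: "\<And>e. 0 < e \<Longrightarrow> \<exists>\<phi>\<in>tests. H1nrm (\<lambda>x. \<phi> x - u x) < e"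
  shows "u \<in> H10"
proof -
  obtain \<phi> where \<phi>: "\<And>n. \<phi> n \<in> tests" "\<And>n. H1nrm (\<lambda>x. \<phi> n x - u x) < 1 / real (Suc n)"
    using approx[of "1 / real (Suc n)" for n] by (metis of_nat_0_less_iff zero_less_Suc zero_less_divide_1_iff)
  have "(\<lambda>n. H1nrm (\<lambda>x. \<phi> n x - u x)) \<longlonglongrightarrow> 0"
  proof (rule tendsto_sandwich[OF _ _ tendsto_const LIMSEQ_Suc[OF lim_1_over_n]])
    show "\<forall>\<^sub>F n in sequentially. 0 \<le> H1nrm (\<lambda>x. \<phi> n x - u x)"
      by (intro always_eventually allI H1.seminorm_nonneg H1.diff_mem[OF test_functions_H1[OF \<phi>(1)] u])
    show "\<forall>\<^sub>F n in sequentially. H1nrm (\<lambda>x. \<phi> n x - u x) \<le> 1 / real (Suc n)"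
      using \<phi>(2) by (intro always_eventually allI less_imp_le)
  qed
  then show ?thesis using u \<phi>(1) by (auto simp: H10_space_def)
qed

lemma test_functions_H10: "\<phi> \<in> tests \<Longrightarrow> \<phi> \<in> H10"
proof (rule H10I)
  fix e :: real assume "\<phi> \<in> tests" "0 < e"
  moreover have "H1nrm (\<lambda>x. 0) = 0"
    using H1.seminorm_scale[OF H1_zero, of 0] by simp
  ultimately show "\<exists>\<psi>\<in>tests. H1nrm (\<lambda>x. \<psi> x - \<phi> x) < e"
    by (intro bexI[of _ \<phi>]) auto
qed (rule test_functions_H1)

lemma H10_add_mem:
  assumes u: "u \<in> H10" and v: "v \<in> H10"
  shows "(\<lambda>x. u x + v x) \<in> H10"
proof (rule H10I)
  fix e :: real assume e: "0 < e"
  obtain \<phi> where \<phi>: "\<phi> \<in> tests" "H1nrm (\<lambda>x. \<phi> x - u x) < e / 2"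
    using H10_approx[OF u, of "e / 2"] e by auto
  obtain \<psi> where \<psi>: "\<psi> \<in> tests" "H1nrm (\<lambda>x. \<psi> x - v x) < e / 2"
    using H10_approx[OF v, of "e / 2"] e by auto
  have "H1nrm (\<lambda>x. (\<phi> x - u x) + (\<psi> x - v x)) < e"
    using H1.seminorm_triangle[of "\<lambda>x. \<phi> x - u x" "\<lambda>x. \<psi> x - v x"] \<phi> \<psi> u v
    by (fastforce intro: H1.diff_mem H10_H1 test_functions_H1)
  then show "\<exists>\<phi>\<in>tests. H1nrm (\<lambda>x. \<phi> x - (u x + v x)) < e"
    by (intro bexI[of _ "\<lambda>x. \<phi> x + \<psi> x"] test_functions_add \<phi> \<psi>) (simp add: algebra_simps)
qed (intro H1_add_mem H10_H1 u v)

lemma H10_scale_mem: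
  assumes u: "u \<in> H10"
  shows "(\<lambda>x. r * u x) \<in> H10"
proof (rule H10I)
  fix e :: real assume e: "0 < e"
  obtain \<phi> where \<phi>: "\<phi> \<in> tests" "H1nrm (\<lambda>x. \<phi> x - u x) < e / (\<bar>r\<bar> + 1)"
    using H10_approx[OF u, of "e / (\<bar>r\<bar> + 1)"] e by auto
  have d: "(\<lambda>x. \<phi> x - u x) \<in> H1" by (intro H1.diff_mem test_functions_H1 H10_H1 \<phi> u)
  have "\<bar>r\<bar> * H1nrm (\<lambda>x. \<phi> x - u x) \<le> (\<bar>r\<bar> + 1) * H1nrm (\<lambda>x. \<phi> x - u x)"
    using H1.seminorm_nonneg[OF d] by (intro mult_right_mono) auto
  also have "\<dots> < e" using \<phi>(2) by (simp add: field_simps)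
  finally have "H1nrm (\<lambda>x. r * (\<phi> x - u x)) < e" using H1.seminorm_scale[OF d] by simp
  then show "\<exists>\<phi>\<in>tests. H1nrm (\<lambda>x. \<phi> x - r * u x) < e"
    by (intro bexI[of _ "\<lambda>x. r * \<phi> x"] test_functions_scale \<phi>) (simp add: algebra_simps)
qed (intro H1_scale_mem H10_H1 u)

lemma H10_subspace:
  assumes "semi_inner_space V p" "H10 \<subseteq> V"
  shows "semi_inner_space (H10) p"
  using assms by (rule semi_inner_space_subspace)
    (auto intro: H10_add_mem H10_scale_mem test_functions_H10 test_functions_zero)

lemma H10_closed:
  assumes u: "\<And>n. u n \<in> H10" and l: "l \<in> H1"
    and lim: "(\<lambda>n. H1nrm (\<lambda>x. u n x - l x)) \<longlonglongrightarrow> 0"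
  shows "l \<in> H10"
proof (rule H10I[OF l])
  fix e :: real assume e: "0 < e"
  have "\<forall>\<^sub>F n in sequentially. H1nrm (\<lambda>x. u n x - l x) < e / 2"
    using order_tendstoD(2)[OF lim, of "e / 2"] e by simp
  then obtain n where n: "H1nrm (\<lambda>x. u n x - l x) < e / 2" by (auto dest: eventually_happens)
  obtain \<phi> where \<phi>: "\<phi> \<in> tests" "H1nrm (\<lambda>x. \<phi> x - u n x) < e / 2"
    using H10_approx[OF u, of "e / 2"] e by auto
  have "H1nrm (\<lambda>x. (\<phi> x - u n x) + (u n x - l x)) < e"
    using H1.seminorm_triangle[of "\<lambda>x. \<phi> x - u n x" "\<lambda>x. u n x - l x"] \<phi> n u l
    by (fastforce intro: H1.diff_mem H10_H1 test_functions_H1)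
  then show "\<exists>\<phi>\<in>tests. H1nrm (\<lambda>x. \<phi> x - l x) < e"
    using \<phi>(1) by auto
qed

text \<open>
  Test functions separate square integrable functions, so any representer may be used to compute the
  norm of a functional.
\<close>
lemma represented_by_norm:
  assumes "represented_by \<Omega> F g"
  shows "functional_L2_norm \<Omega> F = nrm g"
proof -
  define g' where "g' = (SOME g. represented_by \<Omega> F g)"
  have g': "represented_by \<Omega> F g'" unfolding g'_def by (rule someI[of "represented_by \<Omega> F", OF assms])
  have L: "g \<in> L2" "g' \<in> L2" using assms g' by (auto simp: represented_by_def)
  have "AE x in lebesgue_on \<Omega>. g' x - g x = 0"
  proof (rule fundamental_lemma[OF open_\<Omega> bounded_\<Omega> L2.diff_mem[OF L(2,1)]])
    fix \<phi> assume \<phi>: "\<phi> \<in> tests"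
    then have "F \<phi> = ip g \<phi>" "F \<phi> = ip g' \<phi>"
      using assms g' test_functions_H10 by (auto simp: represented_by_def)
    then show "ip (\<lambda>x. g' x - g x) \<phi> = 0"
      using L \<phi> by (simp add: L2.ip_simps test_functions_L2[OF open_\<Omega>])
  qed
  then have "nrm g' = nrm g" by (intro L2_norm_cong_AE L) simp
  then show ?thesis by (simp add: functional_L2_norm_def g'_def)
qed

text \<open>
  Integration by parts in \<open>\<parallel>\<phi>\<parallel>\<^sup>2 = \<integral> \<partial>\<^sub>i(x\<^sub>i) \<phi>\<^sup>2 = - 2 \<integral> x\<^sub>i \<phi> \<partial>\<^sub>i\<phi>\<close>, where \<open>\<bar>x\<^sub>i\<bar> \<le> R\<close>.
\<close>
lemma Poincare_test_functions:
  assumes \<phi>: "\<phi> \<in> tests" and R0: "0 \<le> R" and R: "\<And>x. x \<in> \<Omega> \<Longrightarrow> norm x \<le> R"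
  shows "nrm \<phi> \<le> 2 * R * nrm (partial i \<phi>)"
proof -
  let ?X = "\<lambda>x. x $ i * \<phi> x"
  have C: "C_k k ?X" for k by (intro C_k_mult C_k_coordinate test_functions_C_k[OF \<phi>])
  have test: "?X \<in> tests" "(\<lambda>x. x $ i * partial i \<phi> x) \<in> tests"
    by (intro test_functions_mult C_k_coordinate test_functions_partial \<phi>)+
  note L = test_functions_L2[OF open_\<Omega>]
  have "(\<lambda>x :: real ^ 'n. x $ i) differentiable (at x)" for x
    using C_k_coordinate[of 1 i] by simp
  then have "partial i ?X = (\<lambda>x. x $ i * partial i \<phi> x + partial i (\<lambda>x. x $ i) x * \<phi> x)"
    by (intro partial_mult test_functions_differentiable[OF \<phi>])
  moreover have "partial i (\<lambda>x :: real ^ 'n. x $ i) x = 1" for x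
    using partial_eqI[OF coordinate_has_derivative, of i i x] by (simp add: axis_def)
  ultimately have dX: "partial i ?X = (\<lambda>x. x $ i * partial i \<phi> x + \<phi> x)" by simp
  have "ip ?X (partial i \<phi>) = - ip (\<lambda>x. x $ i * partial i \<phi> x + \<phi> x) \<phi>"
    using integration_by_parts[OF open_\<Omega> \<phi> C, of i] by (simp add: L2_inner_def dX)
  also have "\<dots> = - ip (\<lambda>x. x $ i * partial i \<phi> x) \<phi> - ip \<phi> \<phi>"
    using test \<phi> by (simp add: L2.ip_simps L)
  also have "ip (\<lambda>x. x $ i * partial i \<phi> x) \<phi> = ip ?X (partial i \<phi>)"
    by (simp add: L2_inner_def mult_ac)
  finally have "ip \<phi> \<phi> = - 2 * ip ?X (partial i \<phi>)" by simp
  moreover have "\<bar>ip ?X (partial i \<phi>)\<bar> \<le> nrm ?X * nrm (partial i \<phi>)"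
    by (intro L2.Cauchy_Schwarz L test test_functions_partial \<phi>)
  moreover have "nrm ?X \<le> R * nrm \<phi>"
  proof -
    have "ip ?X ?X \<le> ip (\<lambda>x. R * \<phi> x) (\<lambda>x. R * \<phi> x)"
      unfolding L2_inner_def
    proof (rule integral_mono)
      fix x assume "x \<in> space (lebesgue_on \<Omega>)"
      then have "\<bar>x $ i\<bar> \<le> R" using R component_le_norm_cart[of x i] by fastforce
      then have "(x $ i * \<phi> x)\<^sup>2 \<le> (R * \<phi> x)\<^sup>2"
        unfolding power_mult_distrib using R0 by (intro mult_right_mono) (auto simp: abs_le_square_iff[symmetric])
      then show "x $ i * \<phi> x * (x $ i * \<phi> x) \<le> R * \<phi> x * (R * \<phi> x)" by (simp add: power2_eq_square)
    qed (intro L2_mult_integrable L2.scale_mem L test \<phi>)+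
    then have "nrm ?X \<le> nrm (\<lambda>x. R * \<phi> x)" by (simp add: L2_norm_def)
    then show ?thesis using L2.seminorm_scale[OF L[OF \<phi>], of R] R0 by simp
  qed
  moreover have nn: "0 \<le> nrm \<phi>" "0 \<le> nrm (partial i \<phi>)"
    by (intro L2.seminorm_nonneg L test_functions_partial \<phi>)+
  moreover have "a \<le> 2 * R * p"
    if "a\<^sup>2 = - 2 * c" "\<bar>c\<bar> \<le> q * p" "q \<le> R * a" "0 \<le> a" "0 \<le> p" for a c p q :: real
  proof -
    have "q * p \<le> R * a * p" using that by (intro mult_right_mono)
    then have "a * a \<le> 2 * (R * a * p)" using that unfolding power2_eq_square by linarith
    then have "a * a \<le> (2 * R * p) * a" by (simp add: mult_ac)
    moreover have "0 \<le> 2 * R * p" using that R0 by simp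
    ultimately show ?thesis using that mult_right_le_imp_le[of a a "2 * R * p"] by (cases "a = 0") auto
  qed
  ultimately show ?thesis using L2.seminorm_power2[OF L[OF \<phi>]] by metis
qed

theorem Poincare:
  obtains P where "0 < P" "\<And>u. u \<in> H10 \<Longrightarrow> nrm u \<le> P * gnorm u"
proof -
  obtain R where R: "0 < R" "\<And>x. x \<in> \<Omega> \<Longrightarrow> norm x \<le> R"
    using bounded_\<Omega> by (auto simp: bounded_pos)
  have "nrm u \<le> 2 * R * gnorm u" if u: "u \<in> H10" for u
  proof (rule field_le_epsilon)
    fix e :: real assume e: "0 < e"
    define d where "d = e / (1 + 2 * R)"
    have "d * (1 + 2 * R) = e" "0 < d" using e R by (simp_all add: d_def)
    then have d: "0 < d" "d + 2 * R * d = e" by (simp_all add: algebra_simps)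
    obtain \<phi> where \<phi>: "\<phi> \<in> tests" "H1nrm (\<lambda>x. \<phi> x - u x) < d"
      using H10_approx[OF u d(1)] by blast
    have H: "\<phi> \<in> H1" "u \<in> H1" "(\<lambda>x. \<phi> x - u x) \<in> H1"
      using \<phi> u by (auto intro: H1.diff_mem H10_H1 test_functions_H1)
    fix i :: 'n
    have i: "nrm (partial i \<phi>) \<le> gnorm \<phi>"
    proof -
      have "nrm (wpart i \<phi>) = nrm (partial i \<phi>)"
        by (intro L2_norm_cong_AE weak_partial_eq_AE test_function_is_weak_partial weak_partial_L2 H
            test_functions_L2[OF open_\<Omega>] test_functions_partial \<phi>)
      then show ?thesis using weak_partial_norm_le[OF H(1), of i] by simp
    qed
    have "nrm u \<le> nrm \<phi> + nrm (\<lambda>x. \<phi> x - u x)"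
      using L2.seminorm_triangle_diff[OF H1_L2[OF H(1)] H1_L2[OF H(3)]] by simp
    also have "nrm \<phi> \<le> 2 * R * gnorm \<phi>"
      using Poincare_test_functions[OF \<phi>(1) _ R(2), of i] mult_left_mono[OF i, of "2 * R"] R(1) by linarith
    also have "gnorm \<phi> \<le> gnorm u + gnorm (\<lambda>x. \<phi> x - u x)"
      using grad.seminorm_triangle[OF H(2,3)] by simp
    finally have "nrm u \<le> 2 * R * (gnorm u + gnorm (\<lambda>x. \<phi> x - u x)) + nrm (\<lambda>x. \<phi> x - u x)"
      using R by simp
    moreover have "gnorm (\<lambda>x. \<phi> x - u x) \<le> d" "nrm (\<lambda>x. \<phi> x - u x) \<le> d"
      using \<phi>(2) grad_norm_le_H1[OF H(3)] L2_norm_le_H1[OF H(3)] by auto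
    moreover have "2 * R * gnorm (\<lambda>x. \<phi> x - u x) \<le> 2 * R * d"
      using R calculation(2) by (intro mult_left_mono) auto
    ultimately show "nrm u \<le> 2 * R * gnorm u + e"
      using d(2) by (simp add: distrib_left)
  qed
  then show ?thesis using that[of "2 * R"] R by simp
qed

end

section \<open>The modulus of continuity\<close>

text \<open>
  The part over \<open>(0, p]\<close> of the Dini-type integral of \<open>\<omega>\<close> that is assumed to be finite.
\<close>
definition dini :: "(real \<Rightarrow> real) \<Rightarrow> real \<Rightarrow> real"
  where "dini \<omega> p = (LINT t:{0<..p}|lborel. \<omega> t * t powr (-3/2))"

text \<open>
  The integrand is non-increasing, so its values at right end points give a lower bound for the integral.
  In this form the integral controls sums over time steps with a constant
  that does not depend on the mesh.
\<close>
lemma dini_increment: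
  assumes \<omega>: "admissible_modulus T \<omega>" and pq: "0 \<le> p" "p < q" "q \<le> T"
  shows "(q - p) * (\<omega> q * q powr (-3/2)) \<le> dini \<omega> q - dini \<omega> p"
proof -
  let ?f = "\<lambda>t. \<omega> t * t powr (-3/2)"
  have int: "set_integrable lborel {0<..T} ?f" using \<omega> by (simp add: admissible_modulus_def)
  have int1: "set_integrable lborel {0<..p} ?f" and int2: "set_integrable lborel {p<..q} ?f"
    by (rule set_integrable_subset[OF int]; use pq in auto)+
  have "{0<..q} = {0<..p} \<union> {p<..q}" using pq by auto
  then have "dini \<omega> q = dini \<omega> p + (LINT t:{p<..q}|lborel. ?f t)"
    unfolding dini_def using set_integral_Un[OF _ int1 int2] by simp
  moreover have "(LINT t:{p<..q}|lborel. ?f q) \<le> (LINT t:{p<..q}|lborel. ?f t)"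
  proof (rule set_integral_mono[OF _ int2])
    show "set_integrable lborel {p<..q} (\<lambda>t. ?f q)"
      unfolding set_integrable_def by (intro integrable_scaleR_left integrable_real_indicator) (use pq in auto)
    fix t assume t: "t \<in> {p<..q}"
    have "antimono_on {0<..T} (\<lambda>t. \<omega> t / t powr (3/2))" using \<omega> by (simp add: admissible_modulus_def)
    then have "\<omega> q / q powr (3/2) \<le> \<omega> t / t powr (3/2)"
      using t pq by (auto simp: monotone_on_def)
    then show "?f q \<le> ?f t" by (simp add: powr_minus_divide)
  qed
  moreover have "(LINT t:{p<..q}|lborel. ?f q) = (q - p) * ?f q"
    using pq by (simp add: set_lebesgue_integral_def)
  ultimately show ?thesis by linarith
qed

lemma dini_0: "dini \<omega> 0 = 0"
  by (simp add: dini_def set_lebesgue_integral_def)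

lemma modulus_nonneg: "admissible_modulus T \<omega> \<Longrightarrow> t \<in> {0..T} \<Longrightarrow> 0 \<le> \<omega> t"
  by (simp add: admissible_modulus_def)

lemma modulus_mono: "admissible_modulus T \<omega> \<Longrightarrow> 0 \<le> s \<Longrightarrow> s \<le> t \<Longrightarrow> t \<le> T \<Longrightarrow> \<omega> s \<le> \<omega> t"
  unfolding admissible_modulus_def by (auto simp: monotone_on_def)

lemma dini_mono:
  assumes \<omega>: "admissible_modulus T \<omega>" and pq: "0 \<le> p" "p \<le> q" "q \<le> T"
  shows "dini \<omega> p \<le> dini \<omega> q"
proof (cases "p = q")
  case False
  then have "0 \<le> (q - p) * (\<omega> q * q powr (-3/2))"
    using modulus_nonneg[OF \<omega>, of q] pq by (intro mult_nonneg_nonneg) auto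
  with dini_increment[OF \<omega> pq(1) _ pq(3)] False pq show ?thesis by simp
qed simp

text \<open>
  By monotonicity of \<open>\<omega>(t) / t\<^sup>3\<^sup>/\<^sup>2\<close> the integral over \<open>(0, s]\<close> is at least \<open>s \<omega>(s) s\<^sup>-\<^sup>3\<^sup>/\<^sup>2\<close>; in
  particular \<open>\<omega>\<close> tends to zero at zero.
\<close>
lemma modulus_le_sqrt:
  assumes \<omega>: "admissible_modulus T \<omega>" and s: "0 < s" "s \<le> T"
  shows "\<omega> s \<le> dini \<omega> T * sqrt s"
proof -
  have "s * (\<omega> s * s powr (-3/2)) \<le> dini \<omega> T"
    using dini_increment[OF \<omega> order_refl s] dini_mono[OF \<omega> _ s(2) order_refl] s by (simp add: dini_0)
  moreover have "s * (s powr (-3/2) * s powr (1/2)) = 1"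
    unfolding powr_add[symmetric] using s by (simp add: powr_neg_one)
  moreover have "(s * (\<omega> s * s powr (-3/2))) * s powr (1/2) = \<omega> s * (s * (s powr (-3/2) * s powr (1/2)))"
    by (simp only: mult_ac)
  ultimately have "\<omega> s * 1 \<le> dini \<omega> T * s powr (1/2)"
    using mult_right_mono[of "s * (\<omega> s * s powr (-3/2))" "dini \<omega> T" "s powr (1/2)"]
    by (metis powr_ge_zero)
  then show ?thesis using s by (simp add: powr_half_sqrt)
qed

lemma modulus_0:
  assumes \<omega>: "admissible_modulus T \<omega>" and T: "0 < T"
  shows "\<omega> 0 = 0"
proof -
  have "\<omega> 0 \<le> dini \<omega> T * sqrt 0"
  proof (rule tendsto_lowerbound)
    show "((\<lambda>s. dini \<omega> T * sqrt s) \<longlongrightarrow> dini \<omega> T * sqrt 0) (at_right 0)"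
      by (intro tendsto_intros)
    show "\<forall>\<^sub>F s in at_right 0. \<omega> 0 \<le> dini \<omega> T * sqrt s"
      unfolding eventually_at_right_field
    proof (intro exI[of _ T] conjI allI impI T)
      fix s assume "0 < s" "s < T"
      then show "\<omega> 0 \<le> dini \<omega> T * sqrt s"
        using modulus_mono[OF \<omega>, of 0 s] modulus_le_sqrt[OF \<omega>, of s] by simp
    qed
  qed simp
  then show ?thesis using modulus_nonneg[OF \<omega>, of 0] T by simp
qed

lemma modulus_le_sqrt':
  assumes "admissible_modulus T \<omega>" "0 < T" "0 \<le> s" "s \<le> T"
  shows "\<omega> s \<le> dini \<omega> T * sqrt s"
  using modulus_le_sqrt[of T \<omega> s] modulus_0[of T \<omega>] assms by (cases "s = 0") auto

section \<open>Time slices of the coefficients\<close>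

lemma borel_measurable_lebesgue_cong_AE:
  fixes f g :: "'a::euclidean_space \<Rightarrow> real"
  assumes f: "f \<in> borel_measurable lebesgue" and eq: "AE x in lebesgue. f x = g x"
  shows "g \<in> borel_measurable lebesgue"
proof (rule measurableI)
  fix A :: "real set" assume A: "A \<in> sets borel"
  show "g -` A \<inter> space lebesgue \<in> sets lebesgue"
  proof (rule completion.in_sets_AE)
    show "f -` A \<inter> space lebesgue \<in> sets lebesgue" using f A by (rule measurable_sets)
    show "AE x in lebesgue. x \<in> f -` A \<inter> space lebesgue \<longleftrightarrow> x \<in> g -` A \<inter> space lebesgue"
      using eq by eventually_elim simp
  qed simp
qed simp

lemma borel_measurable_lebesgue_on_cong_AE:
  fixes f g :: "'a::euclidean_space \<Rightarrow> real"
  assumes S: "S \<in> sets lebesgue" and f: "f \<in> borel_measurable (lebesgue_on S)"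
    and eq: "AE x in lebesgue_on S. f x = g x"
  shows "g \<in> borel_measurable (lebesgue_on S)"
proof -
  have "(\<lambda>x. if x \<in> S then f x else 0) \<in> borel_measurable lebesgue"
    using f S by (simp add: borel_measurable_if)
  moreover have "AE x in lebesgue. x \<in> S \<longrightarrow> f x = g x"
    using eq S by (simp add: AE_restrict_space_iff)
  then have "AE x in lebesgue. (if x \<in> S then f x else 0) = (if x \<in> S then g x else 0)"
    by eventually_elim simp
  ultimately have "(\<lambda>x. if x \<in> S then g x else 0) \<in> borel_measurable lebesgue"
    by (rule borel_measurable_lebesgue_cong_AE)
  then show ?thesis using S by (simp add: borel_measurable_if)
qed

lemma AE_lborel_dense:
  fixes p q :: real
  assumes "AE t in lborel. P t" "p < q"
  shows "\<exists>t. p < t \<and> t < q \<and> P t"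
proof (rule ccontr)
  assume none: "\<not> ?thesis"
  obtain N where N: "\<And>t. t \<in> space lborel - N \<Longrightarrow> P t" "N \<in> null_sets lborel"
    using AE_E3[OF assms(1)] by blast
  have "{p<..<q} \<subseteq> N"
  proof
    fix t assume "t \<in> {p<..<q}"
    then have "\<not> P t" using none by auto
    then show "t \<in> N" using N(1)[of t] by auto
  qed
  then have "emeasure lborel {p<..<q} \<le> emeasure lborel N"
    using N(2) by (intro emeasure_mono) auto
  then show False using N(2) assms(2) by (simp add: null_sets_def)
qed

lemma AE_lebesgue_on_Times:
  fixes \<Omega> :: "(real ^ 'n::finite) set" and T :: real
  assumes "open \<Omega>" and ae: "AE (t, x) in lebesgue_on ({0<..<T} \<times> \<Omega>). P t x"
  shows "AE t in lborel. t \<in> {0<..<T} \<longrightarrow> (AE x in lebesgue_on \<Omega>. P t x)"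
proof -
  have S: "{0<..<T} \<times> \<Omega> \<in> sets lebesgue" using assms(1) by (intro sets_completionI_sets) (auto intro!: borel_open open_Times open_greaterThanLessThan)
  have "AE z in lebesgue. z \<in> {0<..<T} \<times> \<Omega> \<longrightarrow> (case z of (t, x) \<Rightarrow> P t x)"
    using ae S by (simp add: AE_restrict_space_iff)
  then have "AE z in lborel \<Otimes>\<^sub>M lborel. z \<in> {0<..<T} \<times> \<Omega> \<longrightarrow> (case z of (t, x) \<Rightarrow> P t x)"
    unfolding AE_completion_iff lborel_prod .
  then have "AE t in lborel. AE x in lborel. (t, x) \<in> {0<..<T} \<times> \<Omega> \<longrightarrow> P t x"
    using lborel_pair.AE_pair by fastforce
  then show ?thesis
  proof eventually_elim
    case (elim t)
    show ?case
    proof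
      assume "t \<in> {0<..<T}"
      with elim have "AE x in lborel. x \<in> \<Omega> \<longrightarrow> P t x" by simp
      then have "AE x in lebesgue. x \<in> \<Omega> \<longrightarrow> P t x" by (rule AE_completion)
      then show "AE x in lebesgue_on \<Omega>. P t x"
        using assms(1) by (simp add: AE_restrict_space_iff borel_open)
    qed
  qed
qed

lemma slice_measurable:
  fixes \<Omega> :: "(real ^ 'n::finite) set" and f :: "real \<Rightarrow> real ^ 'n \<Rightarrow> real"
  assumes \<Omega>: "open \<Omega>" and f: "(\<lambda>(t, x). f t x) \<in> borel_measurable (lebesgue_on ({0<..<T} \<times> \<Omega>))"
  shows "AE t in lborel. t \<in> {0<..<T} \<longrightarrow> f t \<in> borel_measurable (lebesgue_on \<Omega>)"
proof -
  let ?S = "{0<..<T} \<times> \<Omega>"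
  have S: "?S \<in> sets lebesgue" using \<Omega> by (intro sets_completionI_sets) (auto intro!: borel_open open_Times open_greaterThanLessThan)
  have "(\<lambda>z. if z \<in> ?S then (case z of (t, x) \<Rightarrow> f t x) else 0) \<in> borel_measurable lebesgue"
    using f S by (simp add: borel_measurable_if)
  then obtain g where g: "g \<in> borel_measurable lborel"
    and eq: "AE z in lborel. (if z \<in> ?S then (case z of (t, x) \<Rightarrow> f t x) else 0) = g z"
    using completion_ex_borel_measurable_real by blast
  have g': "g \<in> borel_measurable (lborel \<Otimes>\<^sub>M lborel)" using g by (simp add: lborel_prod)
  have "AE z in lborel \<Otimes>\<^sub>M lborel. (if z \<in> ?S then (case z of (t, x) \<Rightarrow> f t x) else 0) = g z"
    unfolding lborel_prod by (rule eq)
  then have "AE t in lborel. AE x in lborel. (if (t, x) \<in> ?S then f t x else 0) = g (t, x)"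
    using lborel_pair.AE_pair by fastforce
  then show ?thesis
  proof eventually_elim
    case (elim t)
    show ?case
    proof
      assume t: "t \<in> {0<..<T}"
      have "(\<lambda>x. g (t, x)) \<in> borel_measurable lborel" using g' by measurable
      then have "(\<lambda>x. g (t, x)) \<in> borel_measurable lebesgue" by (rule measurable_completion)
      moreover have "AE x in lebesgue. g (t, x) = (if x \<in> \<Omega> then f t x else 0)"
        using AE_completion[OF elim] by eventually_elim (use t in auto)
      ultimately have "(\<lambda>x. if x \<in> \<Omega> then f t x else 0) \<in> borel_measurable lebesgue"
        by (rule borel_measurable_lebesgue_cong_AE)
      then show "f t \<in> borel_measurable (lebesgue_on \<Omega>)"
        using \<Omega> by (simp add: borel_measurable_if borel_open)
    qed
  qed
qed

lemma essentially_bounded_AE: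
  assumes "essentially_bounded M g"
  obtains K where "AE x in M. \<bar>g x\<bar> \<le> K"
proof -
  have "AE x in M. ereal \<bar>g x\<bar> \<le> esssup M (\<lambda>x. ereal \<bar>g x\<bar>)" by (rule esssup_AE)
  moreover obtain K where "esssup M (\<lambda>x. ereal \<bar>g x\<bar>) \<le> ereal K"
    using assms unfolding essentially_bounded_def
    by (cases "esssup M (\<lambda>x. ereal \<bar>g x\<bar>)") (auto intro: that)
  ultimately have "AE x in M. \<bar>g x\<bar> \<le> K"
    by (auto elim!: eventually_mono dest: order_trans)
  then show ?thesis by (rule that)
qed

definition slice_bounds ::
  "real \<Rightarrow> real \<Rightarrow> ('n::finite \<Rightarrow> 'n \<Rightarrow> real ^ 'n \<Rightarrow> real) \<Rightarrow> real ^ 'n \<Rightarrow> bool"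
  where "slice_bounds K \<alpha> b x \<longleftrightarrow> (\<forall>i j. \<bar>b i j x\<bar> \<le> K) \<and> (\<forall>i j. b i j x = b j i x) \<and>
    (\<forall>\<xi>. \<alpha> * (norm \<xi>)\<^sup>2 \<le> (\<Sum>i\<in>UNIV. \<Sum>j\<in>UNIV. b i j x * \<xi> $ i * \<xi> $ j))"

text \<open>
  Bounds, symmetry and coercivity are assumed for almost every \<open>(t, x)\<close>, hence hold on almost every time
  slice by Fubini.  The good times are dense and the coefficients are continuous in time, so the
  properties pass to the limit on every slice in \<open>[0, T]\<close>.
\<close>
theorem admissible_coefficients_slices:
  fixes \<Omega> :: "(real ^ 'n::finite) set"
  assumes \<Omega>: "open \<Omega>" and T: "0 < T" and a: "admissible_coefficients \<Omega> T \<alpha> \<omega> a"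
  obtains K where "\<And>t i j. t \<in> {0..T} \<Longrightarrow> a i j t \<in> borel_measurable (lebesgue_on \<Omega>)"
    and "\<And>t. t \<in> {0..T} \<Longrightarrow> AE x in lebesgue_on \<Omega>. slice_bounds K \<alpha> (\<lambda>i j. a i j t) x"
proof -
  have sl: "\<Omega> \<in> sets lebesgue" using \<Omega> by (simp add: borel_open)
  define k where "k i j = (SOME r. AE z in lebesgue_on ({0<..<T} \<times> \<Omega>). \<bar>case z of (t, x) \<Rightarrow> a i j t x\<bar> \<le> r)"
    for i j
  have k: "AE z in lebesgue_on ({0<..<T} \<times> \<Omega>). \<bar>case z of (t, x) \<Rightarrow> a i j t x\<bar> \<le> k i j" for i j
  proof -
    have "essentially_bounded (lebesgue_on ({0<..<T} \<times> \<Omega>)) (\<lambda>(t, x). a i j t x)"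
      using a by (simp add: admissible_coefficients_def)
    then have "\<exists>r. AE z in lebesgue_on ({0<..<T} \<times> \<Omega>). \<bar>case z of (t, x) \<Rightarrow> a i j t x\<bar> \<le> r"
      by (rule essentially_bounded_AE) blast
    then show ?thesis unfolding k_def by (rule someI_ex)
  qed
  define K where "K = (\<Sum>i\<in>UNIV. \<Sum>j\<in>UNIV. \<bar>k i j\<bar>)"
  have kK: "k i j \<le> K" for i j
  proof -
    have "\<bar>k i j\<bar> \<le> (\<Sum>j\<in>UNIV. \<bar>k i j\<bar>)" by (rule member_le_sum) auto
    also have "\<dots> \<le> K" unfolding K_def by (rule member_le_sum) (auto intro: sum_nonneg)
    finally show ?thesis by simp
  qed
  have "AE z in lebesgue_on ({0<..<T} \<times> \<Omega>). \<forall>i j. \<bar>case z of (t, x) \<Rightarrow> a i j t x\<bar> \<le> k i j"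
    using k by (simp add: AE_all_countable)
  moreover have "AE z in lebesgue_on ({0<..<T} \<times> \<Omega>). case z of (t, x) \<Rightarrow> \<forall>i j. a i j t x = a j i t x"
    "AE z in lebesgue_on ({0<..<T} \<times> \<Omega>). case z of (t, x) \<Rightarrow>
        \<forall>\<xi>. (\<Sum>i\<in>UNIV. \<Sum>j\<in>UNIV. a i j t x * \<xi> $ i * \<xi> $ j) \<ge> \<alpha> * (norm \<xi>)\<^sup>2"
    using a unfolding admissible_coefficients_def by auto
  ultimately have "AE z in lebesgue_on ({0<..<T} \<times> \<Omega>). case z of (t, x) \<Rightarrow> slice_bounds K \<alpha> (\<lambda>i j. a i j t) x"
    by eventually_elim (auto simp: slice_bounds_def intro: order_trans[OF _ kK])
  from AE_lebesgue_on_Times[OF \<Omega> this]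
  have ae1: "AE t in lborel. t \<in> {0<..<T} \<longrightarrow> (AE x in lebesgue_on \<Omega>. slice_bounds K \<alpha> (\<lambda>i j. a i j t) x)" .
  have "AE t in lborel. t \<in> {0<..<T} \<longrightarrow> a i j t \<in> borel_measurable (lebesgue_on \<Omega>)" for i j
    using a by (intro slice_measurable[OF \<Omega>]) (auto simp: admissible_coefficients_def essentially_bounded_def)
  then have ae2: "AE t in lborel. \<forall>i j. t \<in> {0<..<T} \<longrightarrow> a i j t \<in> borel_measurable (lebesgue_on \<Omega>)"
    unfolding AE_all_countable by blast
  \<comment> \<open>the times whose slice inherits all properties\<close>
  define good where "good t \<longleftrightarrow> t \<in> {0<..<T} \<longrightarrow> (\<forall>i j. a i j t \<in> borel_measurable (lebesgue_on \<Omega>)) \<and>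
      (AE x in lebesgue_on \<Omega>. slice_bounds K \<alpha> (\<lambda>i j. a i j t) x)" for t
  have good: "AE t in lborel. good t" using ae1 ae2 by eventually_elim (auto simp: good_def)
  have cont: "AE x in lebesgue_on \<Omega>. \<forall>i j. continuous_on {0..T} (\<lambda>t. a i j t x)"
    using a by (simp add: admissible_coefficients_def)
  have "(\<forall>i j. a i j t \<in> borel_measurable (lebesgue_on \<Omega>)) \<and>
      (AE x in lebesgue_on \<Omega>. slice_bounds K \<alpha> (\<lambda>i j. a i j t) x)" if t: "t \<in> {0..T}" for t
  proof -
    have "\<exists>s. max 0 (t - 1 / real (Suc n)) < s \<and> s < min T (t + 1 / real (Suc n)) \<and> good s" for n
    proof (rule AE_lborel_dense[OF good])
      have *: "max 0 (t - e) < min T (t + e)" if "0 < e" for e using that t T by auto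
      have "0 < 1 / real (Suc n)" by simp
      from *[OF this] show "max 0 (t - 1 / real (Suc n)) < min T (t + 1 / real (Suc n))" .
    qed
    then obtain s where s: "\<And>n. max 0 (t - 1 / real (Suc n)) < s n" "\<And>n. s n < min T (t + 1 / real (Suc n))"
      "\<And>n. good (s n)" by metis
    have sT: "s n \<in> {0<..<T}" for n using s(1,2)[of n] by auto
    have lim: "s \<longlonglongrightarrow> t"
    proof (rule tendsto_sandwich)
      show "(\<lambda>n. t - 1 / real (Suc n)) \<longlonglongrightarrow> t" "(\<lambda>n. t + 1 / real (Suc n)) \<longlonglongrightarrow> t"
        using tendsto_diff[OF tendsto_const LIMSEQ_Suc[OF lim_1_over_n], of t]
          tendsto_add[OF tendsto_const LIMSEQ_Suc[OF lim_1_over_n], of t] by (simp_all del: of_nat_Suc)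
    qed (use s(1,2) in \<open>auto intro!: always_eventually less_imp_le\<close>)
    have meas: "a i j (s n) \<in> borel_measurable (lebesgue_on \<Omega>)"
      and bnd: "AE x in lebesgue_on \<Omega>. slice_bounds K \<alpha> (\<lambda>i j. a i j (s n)) x" for i j n
      using s(3)[of n] sT[of n] by (auto simp: good_def)
    have conv: "AE x in lebesgue_on \<Omega>. \<forall>i j. (\<lambda>n. a i j (s n) x) \<longlonglongrightarrow> a i j t x"
      using cont
    proof eventually_elim
      case (elim x)
      show ?case
      proof (intro allI)
        fix i j
        have "continuous_on {0..T} (\<lambda>t. a i j t x)" using elim by blast
        then show "(\<lambda>n. a i j (s n) x) \<longlonglongrightarrow> a i j t x"
          by (rule continuous_on_tendsto_compose[OF _ lim t])
            (use sT in \<open>auto intro!: always_eventually less_imp_le\<close>)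
      qed
    qed
    show ?thesis
    proof (intro conjI allI)
      fix i j
      have "(\<lambda>x. lim (\<lambda>n. a i j (s n) x)) \<in> borel_measurable (lebesgue_on \<Omega>)"
        using meas by (rule borel_measurable_lim_metric)
      moreover have "AE x in lebesgue_on \<Omega>. lim (\<lambda>n. a i j (s n) x) = a i j t x"
        using conv by eventually_elim (auto intro: limI)
      ultimately show "a i j t \<in> borel_measurable (lebesgue_on \<Omega>)"
        by (rule borel_measurable_lebesgue_on_cong_AE[OF sl])
    next
      have "AE x in lebesgue_on \<Omega>. \<forall>n. slice_bounds K \<alpha> (\<lambda>i j. a i j (s n)) x"
        using bnd by (simp add: AE_all_countable)
      with conv show "AE x in lebesgue_on \<Omega>. slice_bounds K \<alpha> (\<lambda>i j. a i j t) x"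
      proof eventually_elim
        case (elim x)
        then have c: "\<And>i j. (\<lambda>n. a i j (s n) x) \<longlonglongrightarrow> a i j t x" and b: "\<And>n. slice_bounds K \<alpha> (\<lambda>i j. a i j (s n)) x"
          by auto
        show ?case
          unfolding slice_bounds_def
        proof (intro conjI allI)
          fix i j
          show "\<bar>a i j t x\<bar> \<le> K"
            by (rule LIMSEQ_le_const2[OF tendsto_rabs[OF c]]) (use b in \<open>auto simp: slice_bounds_def\<close>)
          have "(\<lambda>n. a i j (s n) x) = (\<lambda>n. a j i (s n) x)" using b by (auto simp: slice_bounds_def)
          then show "a i j t x = a j i t x" using c[of i j] c[of j i] LIMSEQ_unique by metis
        next
          fix \<xi> :: "real ^ 'n"
          have "(\<lambda>n. \<Sum>i\<in>UNIV. \<Sum>j\<in>UNIV. a i j (s n) x * \<xi> $ i * \<xi> $ j) \<longlonglongrightarrow> (\<Sum>i\<in>UNIV. \<Sum>j\<in>UNIV. a i j t x * \<xi> $ i * \<xi> $ j)"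
            by (intro tendsto_intros c)
          then show "\<alpha> * (norm \<xi>)\<^sup>2 \<le> (\<Sum>i\<in>UNIV. \<Sum>j\<in>UNIV. a i j t x * \<xi> $ i * \<xi> $ j)"
            by (rule LIMSEQ_le_const) (use b in \<open>auto simp: slice_bounds_def\<close>)
        qed
      qed
    qed
  qed
  then show ?thesis using that by blast
qed

section \<open>The bilinear forms and their time averages\<close>

lemma L2_weighted_integrable:
  assumes c: "c \<in> borel_measurable (lebesgue_on \<Omega>)" "AE x in lebesgue_on \<Omega>. \<bar>c x\<bar> \<le> B"
    and g: "g \<in> L2_space \<Omega>" and h: "h \<in> L2_space \<Omega>"
  shows "integrable (lebesgue_on \<Omega>) (\<lambda>x. c x * g x * h x)"
proof (rule Bochner_Integration.integrable_bound)
  show "integrable (lebesgue_on \<Omega>) (\<lambda>x. B * (g x * h x))"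
    by (intro integrable_mult_right L2_mult_integrable g h)
  show "(\<lambda>x. c x * g x * h x) \<in> borel_measurable (lebesgue_on \<Omega>)"
    using c g h by (auto simp: L2_space_def)
  show "AE x in lebesgue_on \<Omega>. norm (c x * g x * h x) \<le> norm (B * (g x * h x))"
    using c(2)
  proof eventually_elim
    case (elim x)
    then have "\<bar>c x\<bar> * \<bar>g x * h x\<bar> \<le> \<bar>B\<bar> * \<bar>g x * h x\<bar>" by (intro mult_right_mono) auto
    then show ?case by (simp add: abs_mult mult.assoc)
  qed
qed

lemma L2_weighted_bound:
  assumes c: "c \<in> borel_measurable (lebesgue_on \<Omega>)" "AE x in lebesgue_on \<Omega>. \<bar>c x\<bar> \<le> B"
    and B: "0 \<le> B" and g: "g \<in> L2_space \<Omega>" and h: "h \<in> L2_space \<Omega>"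
  shows "\<bar>LINT x|lebesgue_on \<Omega>. c x * g x * h x\<bar> \<le> B * (L2_norm \<Omega> g * L2_norm \<Omega> h)"
proof -
  have abs_norm: "L2_norm \<Omega> (\<lambda>x. \<bar>u x\<bar>) = L2_norm \<Omega> u" for u
    by (simp add: L2_norm_def L2_inner_def flip: abs_mult)
  have "\<bar>LINT x|lebesgue_on \<Omega>. c x * g x * h x\<bar> \<le> (LINT x|lebesgue_on \<Omega>. \<bar>c x * g x * h x\<bar>)"
    by (rule integral_abs_bound)
  also have "\<dots> \<le> (LINT x|lebesgue_on \<Omega>. B * (\<bar>g x\<bar> * \<bar>h x\<bar>))"
  proof (rule integral_mono_AE)
    show "integrable (lebesgue_on \<Omega>) (\<lambda>x. \<bar>c x * g x * h x\<bar>)"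
      by (intro integrable_abs L2_weighted_integrable[OF c g h])
    show "integrable (lebesgue_on \<Omega>) (\<lambda>x. B * (\<bar>g x\<bar> * \<bar>h x\<bar>))"
      by (intro integrable_mult_right L2_mult_integrable L2_abs_mem g h)
    show "AE x in lebesgue_on \<Omega>. \<bar>c x * g x * h x\<bar> \<le> B * (\<bar>g x\<bar> * \<bar>h x\<bar>)"
      using c(2)
    proof eventually_elim
      case (elim x)
      then have "\<bar>c x\<bar> * (\<bar>g x\<bar> * \<bar>h x\<bar>) \<le> B * (\<bar>g x\<bar> * \<bar>h x\<bar>)" by (intro mult_right_mono) auto
      then show ?case by (simp add: abs_mult mult.assoc)
    qed
  qed
  also have "\<dots> = B * L2_inner \<Omega> (\<lambda>x. \<bar>g x\<bar>) (\<lambda>x. \<bar>h x\<bar>)" by (simp add: L2_inner_def)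
  also have "\<dots> \<le> B * (L2_norm \<Omega> g * L2_norm \<Omega> h)"
    using L2.Cauchy_Schwarz[OF L2_abs_mem[OF g] L2_abs_mem[OF h]] B by (intro mult_left_mono) (auto simp: abs_norm)
  finally show ?thesis .
qed

definition time_mean :: "real \<Rightarrow> real \<Rightarrow> (real \<Rightarrow> real) \<Rightarrow> real"
  where "time_mean p q f = 1 / (q - p) * (LINT t|lebesgue_on {p<..q}. f t)"

lemma integrable_Ioc:
  assumes "continuous_on {p..q} (f :: real \<Rightarrow> real)"
  shows "integrable (lebesgue_on {p<..q}) f"
proof -
  have "integrable lebesgue (\<lambda>t. indicator {p..q} t *\<^sub>R f t)"
    using continuous_imp_integrable_real[OF assms] by (simp add: integrable_restrict_space)
  then have "integrable lebesgue (\<lambda>t. indicator {p<..q} t *\<^sub>R (indicator {p..q} t *\<^sub>R f t))"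
    by (rule integrable_mult_indicator[rotated]) simp
  also have "(\<lambda>t. indicator {p<..q} t *\<^sub>R (indicator {p..q} t *\<^sub>R f t)) = (\<lambda>t. indicator {p<..q} t *\<^sub>R f t)"
    by (auto simp: indicator_def fun_eq_iff)
  finally show ?thesis by (simp add: integrable_restrict_space)
qed

lemma time_mean_add:
  "continuous_on {p..q} f \<Longrightarrow> continuous_on {p..q} g \<Longrightarrow>
   time_mean p q (\<lambda>t. f t + g t) = time_mean p q f + time_mean p q g"
  by (simp add: time_mean_def integrable_Ioc distrib_left)

lemma time_mean_scale: "time_mean p q (\<lambda>t. r * f t) = r * time_mean p q f"
  by (simp add: time_mean_def)

lemma integral_const_Ioc: "p \<le> q \<Longrightarrow> (LINT t|lebesgue_on {p<..q}. (r :: real)) = (q - p) * r"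
  by (simp add: measure_restrict_space)

lemma time_mean_bounds:
  assumes f: "continuous_on {p..q} f" and pq: "p < q"
    and bnd: "\<And>t. p < t \<Longrightarrow> t \<le> q \<Longrightarrow> l \<le> f t \<and> f t \<le> (h :: real)"
  shows "l \<le> time_mean p q f" "time_mean p q f \<le> h"
proof -
  have c: "integrable (lebesgue_on {p<..q}) (\<lambda>t. r :: real)" for r
    by (intro integrable_Ioc) simp
  have "(LINT t|lebesgue_on {p<..q}. l) \<le> (LINT t|lebesgue_on {p<..q}. f t)"
    "(LINT t|lebesgue_on {p<..q}. f t) \<le> (LINT t|lebesgue_on {p<..q}. h)"
    by (intro integral_mono c integrable_Ioc f; use bnd in simp)+
  then show "l \<le> time_mean p q f" "time_mean p q f \<le> h"
    unfolding time_mean_def integral_const_Ioc[OF less_imp_le[OF pq]] using pq by (simp_all add: field_simps)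
qed

lemma time_mean_diff_bound:
  assumes f: "continuous_on {p..q} f" "p < q" "continuous_on {p'..q'} f" "p' < q'"
    and bnd: "\<And>t t'. p < t \<Longrightarrow> t \<le> q \<Longrightarrow> p' < t' \<Longrightarrow> t' \<le> q' \<Longrightarrow> \<bar>f t - f t'\<bar> \<le> (B :: real)"
  shows "\<bar>time_mean p q f - time_mean p' q' f\<bar> \<le> B"
proof -
  have 1: "f t' - B \<le> time_mean p q f \<and> time_mean p q f \<le> f t' + B" if "p' < t'" "t' \<le> q'" for t'
  proof -
    have "f t' - B \<le> f t \<and> f t \<le> f t' + B" if "p < t" "t \<le> q" for t
      using bnd[OF that \<open>p' < t'\<close> \<open>t' \<le> q'\<close>] by (simp add: abs_le_iff)
    from time_mean_bounds[OF f(1,2) this] show ?thesis by simp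
  qed
  have "time_mean p q f - B \<le> f t' \<and> f t' \<le> time_mean p q f + B" if "p' < t'" "t' \<le> q'" for t'
    using 1[OF that] by simp
  from time_mean_bounds[OF f(3,4) this] show ?thesis by (simp add: abs_le_iff)
qed

text \<open>
  The hypotheses on the coefficients in the form that holds on every time slice; \<open>K\<close> is a bound for all
  coefficients.
\<close>
locale parabolic_problem = bounded_open_set \<Omega> for \<Omega> :: "(real ^ 'n::finite) set" +
  fixes T \<alpha> K :: real and \<omega> :: "real \<Rightarrow> real" and a :: "'n \<Rightarrow> 'n \<Rightarrow> real \<Rightarrow> real ^ 'n \<Rightarrow> real"
  assumes T_pos: "0 < T" and \<alpha>_pos: "0 < \<alpha>"
    and modulus: "admissible_modulus T \<omega>"
    and a_meas: "t \<in> {0..T} \<Longrightarrow> a i j t \<in> borel_measurable (lebesgue_on \<Omega>)"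
    and a_slice: "t \<in> {0..T} \<Longrightarrow> AE x in lebesgue_on \<Omega>. slice_bounds K \<alpha> (\<lambda>i j. a i j t) x"
    and a_modulus: "s \<in> {0..T} \<Longrightarrow> t \<in> {0..T} \<Longrightarrow> AE x in lebesgue_on \<Omega>. \<bar>a i j s x - a i j t x\<bar> \<le> \<omega> \<bar>s - t\<bar>"
begin

text \<open>
  The number of coefficients \<open>a\<^sub>i\<^sub>j\<close>: the price for estimating the terms of the double sum over \<open>i\<close> and \<open>j\<close>
  one by one.
\<close>
definition coeff_count :: real where "coeff_count = (real CARD('n))\<^sup>2"

lemma coeff_count_pos: "0 < coeff_count" by (simp add: coeff_count_def)

lemma a_bound: "t \<in> {0..T} \<Longrightarrow> AE x in lebesgue_on \<Omega>. \<bar>a i j t x\<bar> \<le> \<bar>K\<bar>"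
  by (rule eventually_mono[OF a_slice]) (auto simp: slice_bounds_def intro: order_trans[OF _ abs_ge_self])

lemma a_term_integrable:
  "t \<in> {0..T} \<Longrightarrow> u \<in> H1 \<Longrightarrow> v \<in> H1 \<Longrightarrow>
   integrable (lebesgue_on \<Omega>) (\<lambda>x. a i j t x * wpart i u x * wpart j v x)"
  by (intro L2_weighted_integrable[OF a_meas a_bound] weak_partial_L2)

lemma a_form_sum:
  assumes "t \<in> {0..T}" "u \<in> H1" "v \<in> H1"
  shows "a_form \<Omega> a t u v
    = (\<Sum>i\<in>UNIV. \<Sum>j\<in>UNIV. LINT x|lebesgue_on \<Omega>. a i j t x * wpart i u x * wpart j v x)"
  unfolding a_form_def using a_term_integrable[OF assms] by simp

lemma a_form_commute:
  assumes "t \<in> {0..T}" "u \<in> H1" "v \<in> H1"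
  shows "a_form \<Omega> a t u v = a_form \<Omega> a t v u"
proof -
  have eq: "(LINT x|lebesgue_on \<Omega>. a i j t x * wpart i u x * wpart j v x)
      = (LINT x|lebesgue_on \<Omega>. a j i t x * wpart j v x * wpart i u x)" for i j
  proof (rule integral_cong_AE)
    show "AE x in lebesgue_on \<Omega>. a i j t x * wpart i u x * wpart j v x
        = a j i t x * wpart j v x * wpart i u x"
      using a_slice[OF assms(1)] by eventually_elim (auto simp: slice_bounds_def)
  qed (intro borel_measurable_integrable a_term_integrable assms)+
  show ?thesis
    unfolding a_form_sum[OF assms] a_form_sum[OF assms(1,3,2)]
    by (subst sum.swap) (intro sum.cong refl eq)
qed

lemma a_form_add:
  assumes t: "t \<in> {0..T}" and u: "u \<in> H1" and v: "v \<in> H1" and w: "w \<in> H1"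
  shows "a_form \<Omega> a t (\<lambda>x. u x + v x) w = a_form \<Omega> a t u w + a_form \<Omega> a t v w"
proof -
  have "(LINT x|lebesgue_on \<Omega>. a i j t x * wpart i (\<lambda>x. u x + v x) x * wpart j w x)
      = (LINT x|lebesgue_on \<Omega>. a i j t x * wpart i u x * wpart j w x
          + a i j t x * wpart i v x * wpart j w x)" for i j
  proof (rule integral_cong_AE)
    show "AE x in lebesgue_on \<Omega>. a i j t x * wpart i (\<lambda>x. u x + v x) x * wpart j w x
        = a i j t x * wpart i u x * wpart j w x
          + a i j t x * wpart i v x * wpart j w x"
      using weak_partial_add_AE[OF u v, of i] by eventually_elim (simp add: algebra_simps)
  qed (intro borel_measurable_integrable Bochner_Integration.integrable_add a_term_integrable H1_add_mem assms)+
  then show ?thesis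
    using a_term_integrable[OF t] u v w by (simp add: a_form_sum[OF t] H1_add_mem sum.distrib)
qed

lemma a_form_scale:
  assumes t: "t \<in> {0..T}" and u: "u \<in> H1" and w: "w \<in> H1"
  shows "a_form \<Omega> a t (\<lambda>x. r * u x) w = r * a_form \<Omega> a t u w"
proof -
  have "(LINT x|lebesgue_on \<Omega>. a i j t x * wpart i (\<lambda>x. r * u x) x * wpart j w x)
      = (LINT x|lebesgue_on \<Omega>. r * (a i j t x * wpart i u x * wpart j w x))" for i j
  proof (rule integral_cong_AE)
    show "AE x in lebesgue_on \<Omega>. a i j t x * wpart i (\<lambda>x. r * u x) x * wpart j w x
        = r * (a i j t x * wpart i u x * wpart j w x)"
      using weak_partial_scale_AE[OF u, of i r] by eventually_elim (simp add: algebra_simps)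
  qed (intro borel_measurable_integrable integrable_mult_right a_term_integrable H1_scale_mem assms)+
  then show ?thesis
    using u w by (simp add: a_form_sum[OF t] H1_scale_mem sum_distrib_left)
qed

lemma a_form_coercive:
  assumes t: "t \<in> {0..T}" and u: "u \<in> H1"
  shows "\<alpha> * (gnorm u)\<^sup>2 \<le> a_form \<Omega> a t u u"
proof -
  have sq: "integrable (lebesgue_on \<Omega>) (\<lambda>x. wpart i u x * wpart i u x)" for i
    by (intro L2_mult_integrable weak_partial_L2 u)
  have "\<alpha> * (gnorm u)\<^sup>2
      = (LINT x|lebesgue_on \<Omega>. \<alpha> * (\<Sum>i\<in>UNIV. wpart i u x * wpart i u x))"
    using sq u by (simp add: grad.seminorm_power2 grad_inner_def L2_inner_def)
  also have "\<dots> \<le> a_form \<Omega> a t u u"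
    unfolding a_form_def
  proof (rule integral_mono_AE)
    show "AE x in lebesgue_on \<Omega>. \<alpha> * (\<Sum>i\<in>UNIV. wpart i u x * wpart i u x)
        \<le> (\<Sum>i\<in>UNIV. \<Sum>j\<in>UNIV. a i j t x * wpart i u x * wpart j u x)"
      using a_slice[OF t]
    proof eventually_elim
      case (elim x)
      define \<xi> :: "real ^ 'n" where "\<xi> = (\<chi> i. wpart i u x)"
      have "(norm \<xi>)\<^sup>2 = (\<Sum>i\<in>UNIV. wpart i u x * wpart i u x)"
        by (simp add: power2_norm_eq_inner inner_vec_def \<xi>_def)
      then show ?case using elim by (auto simp: slice_bounds_def \<xi>_def dest: spec[of _ \<xi>])
    qed
    show "integrable (lebesgue_on \<Omega>) (\<lambda>x. \<Sum>i\<in>UNIV. \<Sum>j\<in>UNIV. a i j t x * wpart i u x * wpart j u x)"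
      by (intro Bochner_Integration.integrable_sum a_term_integrable t u)
  qed (intro integrable_mult_right Bochner_Integration.integrable_sum sq)
  finally show ?thesis .
qed

lemma sum_weighted_bound:
  assumes c: "\<And>i j. c i j \<in> borel_measurable (lebesgue_on \<Omega>)" "\<And>i j. AE x in lebesgue_on \<Omega>. \<bar>c i j x\<bar> \<le> B"
    and B: "0 \<le> B" and u: "u \<in> H1" and v: "v \<in> H1"
  shows "\<bar>\<Sum>i\<in>UNIV. \<Sum>j\<in>UNIV. LINT x|lebesgue_on \<Omega>. c i j x * wpart i u x * wpart j v x\<bar>
    \<le> B * coeff_count * (gnorm u * gnorm v)"
proof -
  have "\<bar>LINT x|lebesgue_on \<Omega>. c i j x * wpart i u x * wpart j v x\<bar>
      \<le> B * (gnorm u * gnorm v)" for i j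
  proof -
    have "nrm (wpart i u) * nrm (wpart j v) \<le> gnorm u * gnorm v"
      by (intro mult_mono weak_partial_norm_le L2.seminorm_nonneg grad.seminorm_nonneg weak_partial_L2 u v)
    then have "B * (nrm (wpart i u) * nrm (wpart j v)) \<le> B * (gnorm u * gnorm v)"
      using B by (rule mult_left_mono)
    with L2_weighted_bound[OF c(1,2) B weak_partial_L2[OF u] weak_partial_L2[OF v], of i j i j] show ?thesis by linarith
  qed
  then have "(\<Sum>i\<in>(UNIV :: 'n set). \<Sum>j\<in>(UNIV :: 'n set). \<bar>LINT x|lebesgue_on \<Omega>. c i j x * wpart i u x * wpart j v x\<bar>)
    \<le> (\<Sum>i\<in>(UNIV :: 'n set). \<Sum>j\<in>(UNIV :: 'n set). B * (gnorm u * gnorm v))"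
    by (intro sum_mono)
  also have "\<dots> = B * coeff_count * (gnorm u * gnorm v)" by (simp add: coeff_count_def power2_eq_square)
  finally show ?thesis
    by (rule order_trans[rotated]) (intro order_trans[OF sum_abs] sum_mono order_refl)
qed

lemma a_form_bound:
  assumes t: "t \<in> {0..T}" and u: "u \<in> H1" and v: "v \<in> H1"
  shows "\<bar>a_form \<Omega> a t u v\<bar> \<le> \<bar>K\<bar> * coeff_count * (gnorm u * gnorm v)"
  unfolding a_form_sum[OF t u v] by (rule sum_weighted_bound[OF a_meas[OF t] a_bound[OF t] _ u v]) simp

lemma a_form_modulus:
  assumes s: "s \<in> {0..T}" and t: "t \<in> {0..T}" and u: "u \<in> H1" and v: "v \<in> H1"
  shows "\<bar>a_form \<Omega> a s u v - a_form \<Omega> a t u v\<bar> \<le> \<omega> \<bar>s - t\<bar> * coeff_count * (gnorm u * gnorm v)"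
proof -
  have "a_form \<Omega> a s u v - a_form \<Omega> a t u v = (\<Sum>i\<in>UNIV. \<Sum>j\<in>UNIV.
      LINT x|lebesgue_on \<Omega>. (a i j s x - a i j t x) * wpart i u x * wpart j v x)"
    using a_term_integrable[OF s u v] a_term_integrable[OF t u v]
    unfolding a_form_sum[OF s u v] a_form_sum[OF t u v] by (simp add: left_diff_distrib sum_subtractf)
  moreover have "0 \<le> \<omega> \<bar>s - t\<bar>" using s t by (intro modulus_nonneg[OF modulus]) auto
  ultimately show ?thesis
    using sum_weighted_bound[of "\<lambda>i j x. a i j s x - a i j t x" "\<omega> \<bar>s - t\<bar>", OF _ a_modulus[OF s t] _ u v] a_meas s t
    by simp
qed

lemma a_form_continuous:
  assumes u: "u \<in> H1" and v: "v \<in> H1"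
  shows "continuous_on {0..T} (\<lambda>t. a_form \<Omega> a t u v)"
  unfolding continuous_on_def
proof
  fix t assume t: "t \<in> {0..T}"
  let ?C = "dini \<omega> T * coeff_count * (gnorm u * gnorm v)"
  have "((\<lambda>s. a_form \<Omega> a s u v - a_form \<Omega> a t u v) \<longlongrightarrow> 0) (at t within {0..T})"
  proof (rule Lim_null_comparison)
    have "((\<lambda>s. sqrt \<bar>s - t\<bar> * ?C) \<longlongrightarrow> sqrt \<bar>t - t\<bar> * ?C) (at t within {0..T})"
      by (intro tendsto_intros)
    then show "((\<lambda>s. sqrt \<bar>s - t\<bar> * ?C) \<longlongrightarrow> 0) (at t within {0..T})" by simp
    show "\<forall>\<^sub>F s in at t within {0..T}. norm (a_form \<Omega> a s u v - a_form \<Omega> a t u v) \<le> sqrt \<bar>s - t\<bar> * ?C"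
      unfolding eventually_at_filter
    proof (intro always_eventually allI impI)
      fix s assume "s \<in> {0..T}"
      then have s: "s \<in> {0..T}" .
      have "\<omega> \<bar>s - t\<bar> \<le> dini \<omega> T * sqrt \<bar>s - t\<bar>"
        using s t by (intro modulus_le_sqrt'[OF modulus T_pos]) auto
      then have "\<omega> \<bar>s - t\<bar> * (coeff_count * (gnorm u * gnorm v)) \<le> dini \<omega> T * sqrt \<bar>s - t\<bar> * (coeff_count * (gnorm u * gnorm v))"
        using coeff_count_pos grad.seminorm_nonneg[OF u] grad.seminorm_nonneg[OF v] by (intro mult_right_mono) auto
      then show "norm (a_form \<Omega> a s u v - a_form \<Omega> a t u v) \<le> sqrt \<bar>s - t\<bar> * ?C"
        using a_form_modulus[OF s t u v] by (simp add: mult_ac)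
    qed
  qed
  then show "((\<lambda>s. a_form \<Omega> a s u v) \<longlongrightarrow> a_form \<Omega> a t u v) (at t within {0..T})"
    by (simp add: LIM_zero_iff)
qed

definition mean_form :: "real \<Rightarrow> real \<Rightarrow> (real ^ 'n \<Rightarrow> real) \<Rightarrow> (real ^ 'n \<Rightarrow> real) \<Rightarrow> real"
  where "mean_form p q u v = time_mean p q (\<lambda>t. a_form \<Omega> a t u v)"

lemma a_form_continuous_sub:
  "0 \<le> p \<Longrightarrow> q \<le> T \<Longrightarrow> u \<in> H1 \<Longrightarrow> v \<in> H1 \<Longrightarrow> continuous_on {p..q} (\<lambda>t. a_form \<Omega> a t u v)"
  by (rule continuous_on_subset[OF a_form_continuous]) auto

lemma time_mean_cong: "(\<And>t. p < t \<Longrightarrow> t \<le> q \<Longrightarrow> f t = g t) \<Longrightarrow> time_mean p q f = time_mean p q g"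
  unfolding time_mean_def by (auto intro!: arg_cong2[where f = "(*)"] Bochner_Integration.integral_cong)

lemma mean_form_coercive:
  assumes "0 \<le> p" "p < q" "q \<le> T" "u \<in> H1"
  shows "\<alpha> * (gnorm u)\<^sup>2 \<le> mean_form p q u u"
proof -
  have "\<alpha> * (gnorm u)\<^sup>2 \<le> a_form \<Omega> a t u u \<and> a_form \<Omega> a t u u \<le> \<bar>K\<bar> * coeff_count * (gnorm u * gnorm u)"
    if "p < t" "t \<le> q" for t
    using a_form_coercive[of t u] a_form_bound[of t u u] that assms by auto
  from time_mean_bounds(1)[where f = "\<lambda>t. a_form \<Omega> a t u u", OF _ assms(2) this] show ?thesis
    using a_form_continuous_sub assms unfolding mean_form_def by blast
qed

lemma mean_form_bound:
  assumes "0 \<le> p" "p < q" "q \<le> T" "u \<in> H1" "v \<in> H1"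
  shows "\<bar>mean_form p q u v\<bar> \<le> \<bar>K\<bar> * coeff_count * (gnorm u * gnorm v)"
proof -
  let ?B = "\<bar>K\<bar> * coeff_count * (gnorm u * gnorm v)"
  have "- ?B \<le> a_form \<Omega> a t u v \<and> a_form \<Omega> a t u v \<le> ?B" if "p < t" "t \<le> q" for t
    using a_form_bound[of t u v] that assms by (auto simp: abs_le_iff)
  from time_mean_bounds[where f = "\<lambda>t. a_form \<Omega> a t u v", OF _ assms(2) this] show ?thesis
    using a_form_continuous_sub[of p q u v] assms unfolding mean_form_def by (simp add: abs_le_iff)
qed

lemma semi_inner_space_mean_form:
  assumes pq: "0 \<le> p" "p < q" "q \<le> T"
  shows "semi_inner_space (H10) (mean_form p q)"
proof
  fix u v w r
  assume u: "u \<in> H10"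
  show "0 \<le> mean_form p q u u"
    using mean_form_coercive[OF pq H10_H1[OF u]] \<alpha>_pos by (smt (verit) mult_nonneg_nonneg zero_le_power2)
  assume w: "w \<in> H10"
  show "mean_form p q u w = mean_form p q w u"
    unfolding mean_form_def by (rule time_mean_cong, rule a_form_commute) (use pq u w in \<open>auto intro: H10_H1\<close>)
  have "mean_form p q (\<lambda>x. r * u x) w = time_mean p q (\<lambda>t. r * a_form \<Omega> a t u w)"
    unfolding mean_form_def by (rule time_mean_cong, rule a_form_scale) (use pq u w in \<open>auto intro: H10_H1\<close>)
  then show "mean_form p q (\<lambda>x. r * u x) w = r * mean_form p q u w"
    by (simp add: time_mean_scale mean_form_def)
  assume v: "v \<in> H10"
  have "mean_form p q (\<lambda>x. u x + v x) w = time_mean p q (\<lambda>t. a_form \<Omega> a t u w + a_form \<Omega> a t v w)"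
    unfolding mean_form_def by (rule time_mean_cong, rule a_form_add) (use pq u v w in \<open>auto intro: H10_H1\<close>)
  also have "\<dots> = mean_form p q u w + mean_form p q v w"
    unfolding mean_form_def using pq u v w
    by (intro time_mean_add a_form_continuous_sub) (auto intro: H10_H1)
  finally show "mean_form p q (\<lambda>x. u x + v x) w = mean_form p q u w + mean_form p q v w" .
qed (auto intro: H10_add_mem H10_scale_mem test_functions_H10 test_functions_zero)

lemma mean_form_modulus:
  assumes pq: "0 \<le> p" "p < q" "q \<le> p'" "p' < q'" "q' \<le> T" and u: "u \<in> H1" and v: "v \<in> H1"
  shows "\<bar>mean_form p' q' u v - mean_form p q u v\<bar> \<le> \<omega> (q' - p) * coeff_count * (gnorm u * gnorm v)"
  unfolding mean_form_def
proof (rule time_mean_diff_bound)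
  fix s t assume st: "p' < s" "s \<le> q'" "p < t" "t \<le> q"
  then have "\<bar>a_form \<Omega> a s u v - a_form \<Omega> a t u v\<bar> \<le> \<omega> \<bar>s - t\<bar> * coeff_count * (gnorm u * gnorm v)"
    using pq by (intro a_form_modulus u v) auto
  also have "\<dots> \<le> \<omega> (q' - p) * coeff_count * (gnorm u * gnorm v)"
    using st pq coeff_count_pos grad.seminorm_nonneg[OF u] grad.seminorm_nonneg[OF v]
    by (intro mult_right_mono modulus_mono[OF modulus]) auto
  finally show "\<bar>a_form \<Omega> a s u v - a_form \<Omega> a t u v\<bar> \<le> \<omega> (q' - p) * coeff_count * (gnorm u * gnorm v)" .
qed (use pq in \<open>auto intro!: a_form_continuous_sub u v\<close>)

text \<open>
  Lax--Milgram in the symmetric case.  The left-hand side is an inner product on \<open>H\<^sup>1\<^sub>0\<close> whose norm is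
  equivalent to the \<open>H\<^sup>1\<close> norm, by coercivity and boundedness of the form, so \<open>H\<^sup>1\<^sub>0\<close> is complete for it
  and the Riesz representation applies.
\<close>
theorem resolvent_exists:
  assumes pq: "0 \<le> p" "p < q" "q \<le> T" and k: "0 < k" and \<phi>: "\<phi> \<in> L2"
  obtains z where "z \<in> H10"
    "\<And>v. v \<in> H10 \<Longrightarrow> ip z v + k * mean_form p q z v = ip \<phi> v"
proof -
  let ?e = "\<lambda>u v. ip u v + k * mean_form p q u v"
  have L: "u \<in> H10 \<Longrightarrow> u \<in> L2" for u by (intro H1_L2 H10_H1)
  interpret e: semi_inner_space "H10" ?e
    by (intro semi_inner_space_add H10_subspace[OF semi_inner_space_L2] semi_inner_space_mean_form pq)
      (use L k in auto)
  have e_eq: "(e.seminorm u)\<^sup>2 = (nrm u)\<^sup>2 + k * mean_form p q u u" if "u \<in> H10" for u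
    using e.seminorm_power2[OF that] L2.seminorm_power2[OF L[OF that]] by simp
  have L2_le: "nrm u \<le> e.seminorm u" if u: "u \<in> H10" for u
  proof (rule power2_le_imp_le)
    show "(nrm u)\<^sup>2 \<le> (e.seminorm u)\<^sup>2"
      using semi_inner_space.ip_nonneg[OF semi_inner_space_mean_form[OF pq] u] k by (simp add: e_eq[OF u])
  qed (rule e.seminorm_nonneg[OF u])
  define c where "c = sqrt (1 + 1 / (k * \<alpha>))"
  have c: "0 < c" "c\<^sup>2 = 1 + 1 / (k * \<alpha>)" using k \<alpha>_pos by (auto simp: c_def add_pos_pos)
  have H1_le: "H1nrm u \<le> c * e.seminorm u" if u: "u \<in> H10" for u
  proof (rule power2_le_imp_le)
    have "k * (\<alpha> * (gnorm u)\<^sup>2) \<le> k * mean_form p q u u"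
      using mean_form_coercive[OF pq H10_H1[OF u]] k by (intro mult_left_mono) auto
    then have "(gnorm u)\<^sup>2 * (k * \<alpha>) \<le> (e.seminorm u)\<^sup>2"
      using e_eq[OF u] by (simp add: mult_ac) (smt (verit) zero_le_power2)
    then have "(gnorm u)\<^sup>2 \<le> (e.seminorm u)\<^sup>2 / (k * \<alpha>)"
      using k \<alpha>_pos by (simp add: pos_le_divide_eq)
    moreover have "(nrm u)\<^sup>2 \<le> (e.seminorm u)\<^sup>2"
      using L2_le[OF u] L2.seminorm_nonneg[OF L[OF u]] by (intro power_mono)
    ultimately show "(H1nrm u)\<^sup>2 \<le> (c * e.seminorm u)\<^sup>2"
      by (simp add: H1_norm_power2 H10_H1[OF u] power_mult_distrib c distrib_right)
  qed (use c e.seminorm_nonneg[OF u] in auto)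
  define C where "C = sqrt (1 + k * (\<bar>K\<bar> * coeff_count))"
  have C: "C\<^sup>2 = 1 + k * (\<bar>K\<bar> * coeff_count)" "0 \<le> C" using k coeff_count_pos by (auto simp: C_def)
  have le_H1: "e.seminorm u \<le> C * H1nrm u" if u: "u \<in> H10" for u
  proof (rule power2_le_imp_le)
    have "k * mean_form p q u u \<le> k * (\<bar>K\<bar> * coeff_count * (gnorm u)\<^sup>2)"
      using mean_form_bound[OF pq H10_H1[OF u] H10_H1[OF u]] k
      by (intro mult_left_mono) (auto simp: power2_eq_square)
    also have "\<dots> \<le> k * (\<bar>K\<bar> * coeff_count) * (H1nrm u)\<^sup>2"
      using k coeff_count_pos by (auto simp: H1_norm_power2 H10_H1[OF u] mult_ac intro!: mult_left_mono)
    finally show "(e.seminorm u)\<^sup>2 \<le> (C * H1nrm u)\<^sup>2"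
      using power_mono[OF L2_norm_le_H1[OF H10_H1[OF u]] L2.seminorm_nonneg[OF L[OF u]], of 2]
      by (simp add: e_eq[OF u] power_mult_distrib C distrib_right)
  qed (use C H1.seminorm_nonneg[OF H10_H1[OF u]] in auto)
  have "e.complete"
    unfolding e.complete_def
  proof (intro allI impI)
    fix u assume "e.Cauchy_in u"
    then have u: "\<And>n. u n \<in> H10"
      and cauchy: "\<And>r. r > 0 \<Longrightarrow> \<exists>N. \<forall>m\<ge>N. \<forall>n\<ge>N. e.seminorm (\<lambda>x. u m x - u n x) < r"
      unfolding e.Cauchy_in_def by auto
    have "semi_inner_space.Cauchy_in (H1) (H1_inner \<Omega>) u"
      unfolding H1.Cauchy_in_def
    proof (intro conjI allI impI H10_H1 u)
      fix r :: real assume "0 < r"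
      then obtain N where N: "\<And>m n. N \<le> m \<Longrightarrow> N \<le> n \<Longrightarrow> e.seminorm (\<lambda>x. u m x - u n x) < r / c"
        using cauchy[of "r / c"] c by auto
      show "\<exists>N. \<forall>m\<ge>N. \<forall>n\<ge>N. H1nrm (\<lambda>x. u m x - u n x) < r"
      proof (intro exI allI impI)
        fix m n assume mn: "N \<le> m" "N \<le> n"
        have "H1nrm (\<lambda>x. u m x - u n x) \<le> c * e.seminorm (\<lambda>x. u m x - u n x)"
          by (intro H1_le e.diff_mem u)
        also have "\<dots> < r" using N[OF mn] c by (simp add: field_simps)
        finally show "H1nrm (\<lambda>x. u m x - u n x) < r" .
      qed
    qed
    then obtain l where l: "l \<in> H1" "(\<lambda>n. H1nrm (\<lambda>x. u n x - l x)) \<longlonglongrightarrow> 0"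
      using H1_complete unfolding H1.complete_def by blast
    have l0: "l \<in> H10" by (rule H10_closed[OF u l])
    have "(\<lambda>n. e.seminorm (\<lambda>x. u n x - l x)) \<longlonglongrightarrow> 0"
    proof (rule tendsto_sandwich[OF _ _ tendsto_const])
      show "(\<lambda>n. C * H1nrm (\<lambda>x. u n x - l x)) \<longlonglongrightarrow> 0"
        using tendsto_mult_left[OF l(2), of C] by simp
    qed (auto intro!: always_eventually le_H1 e.seminorm_nonneg e.diff_mem u l0)
    with l0 show "\<exists>l\<in>H10. (\<lambda>n. e.seminorm (\<lambda>x. u n x - l x)) \<longlonglongrightarrow> 0" by blast
  qed
  then show ?thesis
  proof (rule e.Riesz_representation[where F = "ip \<phi>" and K = "nrm \<phi>"])
    fix u v r assume u: "u \<in> H10"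
    show "ip \<phi> (\<lambda>x. r * u x) = r * ip \<phi> u" using u \<phi> by (simp add: L2.ip_simps L)
    have "\<bar>ip \<phi> u\<bar> \<le> nrm \<phi> * nrm u" by (intro L2.Cauchy_Schwarz \<phi> L u)
    also have "\<dots> \<le> nrm \<phi> * e.seminorm u" by (intro mult_left_mono L2_le u L2.seminorm_nonneg \<phi>)
    finally show "\<bar>ip \<phi> u\<bar> \<le> nrm \<phi> * e.seminorm u" .
    assume "v \<in> H10"
    then show "ip \<phi> (\<lambda>x. u x + v x) = ip \<phi> u + ip \<phi> v" using u \<phi> by (simp add: L2.ip_simps L)
  next
    fix z assume "z \<in> H10" "\<And>v. v \<in> H10 \<Longrightarrow> ?e z v = ip \<phi> v"
    then show thesis by (rule that)
  qed
qed

end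

context parabolic_problem
begin

section \<open>Smoothing of the backward Euler scheme\<close>

lemma H10_L2: "u \<in> H10 \<Longrightarrow> u \<in> L2"
  by (intro H1_L2 H10_H1)

text \<open>
  The energies \<open>(B\<^sup>p v\<^sub>j, v\<^sub>j)\<close> for \<open>p = 0, \<dots>, 3\<close>, with \<open>B v\<^sub>j\<close> replaced by the difference quotient \<open>w\<^sub>j\<close>, satisfy
  the hypotheses of the energy recursion.  The last estimate is the smoothing from \<open>H\<^sup>-\<^sup>1\<close> to \<open>L\<^sup>2\<close>
  in dual form; as a bound for the squared energy norm it contains the cube of the elapsed time.
\<close>
lemma backward_Euler_smoothing:
  fixes v :: "nat \<Rightarrow> real ^ 'n \<Rightarrow> real" and h :: "nat \<Rightarrow> real" and n :: nat
  assumes pq: "0 \<le> p" "p < q" "q \<le> T"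
    and h: "\<And>j. 1 \<le> j \<Longrightarrow> j \<le> n \<Longrightarrow> 0 < h j"
    and v0: "v 0 \<in> L2" and v: "\<And>j. 1 \<le> j \<Longrightarrow> j \<le> n \<Longrightarrow> v j \<in> H10"
    and w: "\<And>j. w j = (\<lambda>x. (v (j - 1) x - v j x) / h j)"
    and eq: "\<And>j \<eta>. 1 \<le> j \<Longrightarrow> j \<le> n \<Longrightarrow> \<eta> \<in> H10 \<Longrightarrow> mean_form p q (v j) \<eta> = ip (w j) \<eta>"
    and n: "1 \<le> n"
  shows "nrm (v n) \<le> nrm (v 0)"
    and "(\<Sum>j=1..n. h j) * nrm (w n) \<le> nrm (v 0)"
    and "2 \<le> n \<Longrightarrow> 0 < \<kappa> \<Longrightarrow>
      (\<And>j. 1 \<le> j \<Longrightarrow> j < n \<Longrightarrow> h j \<le> \<kappa> * h (j + 1) \<and> h (j + 1) \<le> \<kappa> * h j) \<Longrightarrow>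
      2 / (3 + \<kappa>)\<^sup>2 * (\<Sum>j=1..n. h j) ^ 3 * mean_form p q (w n) (w n) \<le> (nrm (v 0))\<^sup>2"
proof -
  let ?b = "mean_form p q"
  interpret b: semi_inner_space "H10" ?b by (rule semi_inner_space_mean_form[OF pq])
  have vL: "v j \<in> L2" if "j \<le> n" for j
    using v0 v[of j] that by (cases "j = 0") (auto intro: H10_L2)
  have wL: "w j \<in> L2" if "j \<le> n" for j
    unfolding w using that by (intro L2.divide_mem L2.diff_mem vL) auto
  have wH: "w j \<in> H10" if "2 \<le> j" "j \<le> n" for j
    unfolding w using that by (intro b.divide_mem b.diff_mem v) auto
  have v_step: "v (j - 1) = (\<lambda>x. v j x + h j * w j x)" if "1 \<le> j" "j \<le> n" for j
    using h[OF that] by (simp add: w)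
  \<comment> \<open>the difference quotients solve the same recursion as the iterates\<close>
  have w_step: "ip (\<lambda>x. w (j - 1) x - w j x) \<eta> = h j * ?b (w j) \<eta>"
    if "2 \<le> j" "j \<le> n" "\<eta> \<in> H10" for j \<eta>
  proof -
    have "ip (w (j - 1)) \<eta> = ?b (v (j - 1)) \<eta>" using eq[of "j - 1" \<eta>] that by simp
    also have "\<dots> = ?b (v j) \<eta> + h j * ?b (w j) \<eta>"
      using v_step[of j] v[of j] wH[of j] that by (simp add: b.ip_simps b.mem_intros)
    also have "?b (v j) \<eta> = ip (w j) \<eta>" using eq[of j \<eta>] that by simp
    finally show ?thesis using wL[of j] wL[of "j - 1"] that H10_L2[of \<eta>] by (simp add: L2.ip_simps)
  qed
  have L2_expand: "ip f f = ip g g + 2 * ip (\<lambda>x. f x - g x) g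
      + ip (\<lambda>x. f x - g x) (\<lambda>x. f x - g x)" if "f \<in> L2" "g \<in> L2" for f g
    using that by (simp add: L2.ip_simps L2.mem_intros L2.ip_commute[of g \<Omega> f])
  have b_expand: "?b f f = ?b g g + 2 * ?b g (\<lambda>x. f x - g x) + ?b (\<lambda>x. f x - g x) (\<lambda>x. f x - g x)"
    if "f \<in> H10" "g \<in> H10" for f g
    using that by (simp add: b.ip_simps b.mem_intros b.ip_commute[of f g])
  define q0 q1 q2 q3 where "q0 j = ip (v j) (v j)" and "q1 j = ?b (v j) (v j)"
    and "q2 j = ip (w j) (w j)" and "q3 j = ?b (w j) (w j)" for j
  have q0_step: "q0 (j - 1) = q0 j + 2 * h j * q1 j + (h j)\<^sup>2 * q2 j" if "1 \<le> j" "j \<le> n" for j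
  proof -
    have "q0 (j - 1) = q0 j + 2 * h j * ip (w j) (v j) + (h j)\<^sup>2 * q2 j"
      unfolding q0_def v_step[OF that] using vL[of j] wL[of j] that
      by (simp add: L2.ip_simps L2.mem_intros q2_def L2.ip_commute[of "v j" \<Omega> "w j"] power2_eq_square algebra_simps)
    then show ?thesis using eq[OF that v[OF that]] by (simp add: q1_def)
  qed
  have q1_step: "q1 (j - 1) = q1 j + 2 * h j * q2 j + (h j)\<^sup>2 * q3 j" if "2 \<le> j" "j \<le> n" for j
  proof -
    have j: "1 \<le> j" using that by simp
    have "q1 (j - 1) = q1 j + 2 * h j * ?b (v j) (w j) + (h j)\<^sup>2 * q3 j"
      unfolding q1_def v_step[OF j that(2)] using v[OF j that(2)] wH[OF that]
      by (simp add: b.ip_simps b.mem_intros q3_def b.ip_commute[of "w j" "v j"] power2_eq_square algebra_simps)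
    then show ?thesis using eq[OF j that(2) wH[OF that]] by (simp add: q2_def)
  qed
  have q2_step: "q2 (j - 1) \<ge> q2 j + 2 * h j * q3 j" if "2 \<le> j" "j \<le> n" for j
  proof -
    let ?x = "\<lambda>x. w (j - 1) x - w j x"
    have L: "w (j - 1) \<in> L2" "w j \<in> L2" using wL that by auto
    have "q2 (j - 1) = q2 j + 2 * ip ?x (w j) + ip ?x ?x"
      unfolding q2_def by (rule L2_expand[OF L])
    moreover have "0 \<le> ip ?x ?x" using L by (intro L2.ip_nonneg L2.diff_mem)
    ultimately show ?thesis using w_step[OF that wH[OF that]] by (simp add: q3_def)
  qed
  have q3_step: "q3 (j - 1) \<ge> q3 j" if "3 \<le> j" "j \<le> n" for j
  proof -
    let ?x = "\<lambda>x. w (j - 1) x - w j x"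
    have j: "2 \<le> j" using that by simp
    have H: "w (j - 1) \<in> H10" "w j \<in> H10" using wH that by auto
    have "q3 (j - 1) = q3 j + 2 * ?b (w j) ?x + ?b ?x ?x"
      unfolding q3_def by (rule b_expand[OF H])
    moreover have "0 \<le> ?b ?x ?x" using H by (intro b.ip_nonneg b.diff_mem)
    moreover have "0 \<le> ?b (w j) ?x"
    proof -
      have "0 \<le> ip ?x ?x" using H by (intro L2.ip_nonneg L2.diff_mem H10_L2)
      then have "0 \<le> h j * ?b (w j) ?x" using w_step[OF j that(2), of ?x] H by (simp add: b.diff_mem)
      then show ?thesis using h[of j] that by (simp add: zero_le_mult_iff)
    qed
    ultimately show ?thesis by linarith
  qed
  have nn: "0 \<le> q1 j" if "1 \<le> j" "j \<le> n" for j unfolding q1_def using v that by (intro b.ip_nonneg)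
  have nn0: "0 \<le> q0 j" "0 \<le> q2 j" if "j \<le> n" for j
    unfolding q0_def q2_def using vL wL that by (auto intro: L2.ip_nonneg)
  have nn3: "2 \<le> n \<Longrightarrow> 0 \<le> q3 n" unfolding q3_def by (intro b.ip_nonneg wH) auto
  note chain = backward_Euler_energy_chain[where h = h and ?q0.0 = q0 and ?q1.0 = q1 and ?q2.0 = q2 and ?q3.0 = q3 and n = n,
      OF h nn nn0(1)[OF order_refl] nn0(2)[OF order_refl] eq_refl[OF q0_step[symmetric]]
      eq_refl[OF q1_step[symmetric]] q2_step q3_step nn3 n]
  have q0_0: "q0 0 = (nrm (v 0))\<^sup>2" "q0 n = (nrm (v n))\<^sup>2" "q2 n = (nrm (w n))\<^sup>2"
    using vL[of n] wL[of n] v0 by (simp_all add: q0_def q2_def L2.seminorm_power2)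
  have "q0 n \<le> q0 0"
  proof -
    have "q0 n \<le> q0 j" if "j \<le> n" for j
      using that
    proof (induction j rule: inc_induct)
      case (step j)
      have "0 \<le> h (Suc j) * q1 (Suc j)" "0 \<le> (h (Suc j))\<^sup>2 * q2 (Suc j)"
        using h[of "Suc j"] nn[of "Suc j"] nn0(2)[of "Suc j"] step.hyps by simp_all
      then show ?case using q0_step[of "Suc j"] step by simp
    qed simp
    then show ?thesis by simp
  qed
  then show "nrm (v n) \<le> nrm (v 0)"
    unfolding q0_0 by (rule power2_le_imp_le) (rule L2.seminorm_nonneg[OF v0])
  have "((\<Sum>j=1..n. h j) * nrm (w n))\<^sup>2 \<le> (nrm (v 0))\<^sup>2"
    using chain(1) unfolding q0_0 power_mult_distrib by simp
  then show "(\<Sum>j=1..n. h j) * nrm (w n) \<le> nrm (v 0)"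
    by (rule power2_le_imp_le) (rule L2.seminorm_nonneg[OF v0])
  show "2 \<le> n \<Longrightarrow> 0 < \<kappa> \<Longrightarrow>
      (\<And>j. 1 \<le> j \<Longrightarrow> j < n \<Longrightarrow> h j \<le> \<kappa> * h (j + 1) \<and> h (j + 1) \<le> \<kappa> * h j) \<Longrightarrow>
      2 / (3 + \<kappa>)\<^sup>2 * (\<Sum>j=1..n. h j) ^ 3 * mean_form p q (w n) (w n) \<le> (nrm (v 0))\<^sup>2"
    using chain(2) unfolding q0_0 q3_def by blast
qed

lemma backward_Euler_exists:
  fixes h :: "nat \<Rightarrow> real"
  assumes pq: "0 \<le> p" "p < q" "q \<le> T" and \<phi>: "\<phi> \<in> L2"
    and h: "\<And>j. 1 \<le> j \<Longrightarrow> j \<le> n \<Longrightarrow> 0 < h j"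
  obtains v where "v 0 = \<phi>" "\<And>j. 1 \<le> j \<Longrightarrow> j \<le> n \<Longrightarrow> v j \<in> H10"
    "\<And>j \<eta>. 1 \<le> j \<Longrightarrow> j \<le> n \<Longrightarrow> \<eta> \<in> H10 \<Longrightarrow>
      mean_form p q (v j) \<eta> = ip (\<lambda>x. (v (j - 1) x - v j x) / h j) \<eta>"
proof -
  define R where "R k \<psi> = (SOME z. z \<in> H10 \<and>
    (\<forall>\<eta>\<in>H10. ip z \<eta> + k * mean_form p q z \<eta> = ip \<psi> \<eta>))" for k \<psi>
  have R: "R k \<psi> \<in> H10 \<and>
    (\<forall>\<eta>\<in>H10. ip (R k \<psi>) \<eta> + k * mean_form p q (R k \<psi>) \<eta> = ip \<psi> \<eta>)"
    if "0 < k" "\<psi> \<in> L2" for k \<psi>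
  proof -
    have "\<exists>z. z \<in> H10 \<and>
      (\<forall>\<eta>\<in>H10. ip z \<eta> + k * mean_form p q z \<eta> = ip \<psi> \<eta>)"
      by (rule resolvent_exists[OF pq that]) blast
    then show ?thesis unfolding R_def by (rule someI_ex)
  qed
  define v where "v = rec_nat \<phi> (\<lambda>j. R (h (Suc j)))"
  have v: "v 0 = \<phi>" "\<And>j. v (Suc j) = R (h (Suc j)) (v j)" by (simp_all add: v_def)
  have vL: "j \<le> n \<Longrightarrow> v j \<in> L2" for j
  proof (induction j)
    case (Suc j)
    then show ?case using R[of "h (Suc j)" "v j"] h[of "Suc j"] by (simp add: v H10_L2)
  qed (simp add: v \<phi>)
  have vR: "v j \<in> H10 \<and>
    (\<forall>\<eta>\<in>H10. ip (v j) \<eta> + h j * mean_form p q (v j) \<eta> = ip (v (j - 1)) \<eta>)"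
    if "1 \<le> j" "j \<le> n" for j
    using R[of "h j" "v (j - 1)"] v(2)[of "j - 1"] vL[of "j - 1"] h[of j] that by simp
  show ?thesis
  proof (rule that[of v])
    fix j \<eta> assume j: "1 \<le> j" "j \<le> n" and \<eta>: "\<eta> \<in> H10"
    have "h j * mean_form p q (v j) \<eta> = ip (v (j - 1)) \<eta> - ip (v j) \<eta>"
      using vR[OF j] \<eta> by (simp add: algebra_simps)
    then show "mean_form p q (v j) \<eta> = ip (\<lambda>x. (v (j - 1) x - v j x) / h j) \<eta>"
      using h[OF j] vL[of j] vL[of "j - 1"] j H10_L2[OF \<eta>]
      by (simp add: L2.ip_simps L2.mem_intros field_simps)
  qed (use v vR in auto)
qed

end

section \<open>The discrete estimate\<close>

text \<open>
  The constant that turns the energy bound with factor \<open>2 / (3 + \<kappa>)\<^sup>2\<close> into a bound of the gradient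
  for an \<open>\<alpha>\<close>-coercive form.
\<close>
definition smoothing_const :: "real \<Rightarrow> real \<Rightarrow> real"
  where "smoothing_const \<alpha> \<kappa> = sqrt ((3 + \<kappa>)\<^sup>2 / (2 * \<alpha>))"

text \<open>
  The dG(0) method as a recursion in \<open>m\<close>: \<open>U 0\<close> is the initial value, \<open>F m\<close> the mean of the source over the
  \<open>m\<close>-th interval, and \<open>A m\<close> represents the operator of that interval applied to \<open>U 0\<close>.  The numbers \<open>Fn\<close> and
  \<open>Gn\<close> bound the norms of the \<open>F m\<close> and of the \<open>A m\<close>.
\<close>
locale dG_scheme = parabolic_problem \<Omega> T \<alpha> K \<omega> a
  for \<Omega> :: "(real ^ 'n::finite) set" and T \<alpha> K \<omega> a +
  fixes \<kappa> :: real and M :: nat and \<tau> :: "nat \<Rightarrow> real"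
    and U F A :: "nat \<Rightarrow> real ^ 'n \<Rightarrow> real" and Fn Gn :: real
  assumes \<kappa>_pos: "0 < \<kappa>"
    and \<tau>_0: "\<tau> 0 = 0" and \<tau>_M: "\<tau> M = T" and \<tau>_mono: "\<And>m. m < M \<Longrightarrow> \<tau> m < \<tau> (Suc m)"
    and ratio: "\<And>m. 1 \<le> m \<Longrightarrow> m < M \<Longrightarrow> step \<tau> m \<le> \<kappa> * step \<tau> (m + 1) \<and> step \<tau> (m + 1) \<le> \<kappa> * step \<tau> m"
    and U: "\<And>m. m \<le> M \<Longrightarrow> U m \<in> H10"
    and F: "\<And>m. 1 \<le> m \<Longrightarrow> m \<le> M \<Longrightarrow> F m \<in> L2"
    and F_norm: "\<And>m. 1 \<le> m \<Longrightarrow> m \<le> M \<Longrightarrow> nrm (F m) \<le> Fn"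
    and equation: "\<And>m \<eta>. 1 \<le> m \<Longrightarrow> m \<le> M \<Longrightarrow> \<eta> \<in> H10 \<Longrightarrow>
      ip (\<lambda>x. U m x - U (m - 1) x) \<eta> + step \<tau> m * mean_form (\<tau> (m - 1)) (\<tau> m) (U m) \<eta>
      = step \<tau> m * ip (F m) \<eta>"
    and A: "\<And>m. 1 \<le> m \<Longrightarrow> m \<le> M \<Longrightarrow> A m \<in> L2"
    and A_norm: "\<And>m. 1 \<le> m \<Longrightarrow> m \<le> M \<Longrightarrow> nrm (A m) \<le> Gn"
    and A_eq: "\<And>m \<eta>. 1 \<le> m \<Longrightarrow> m \<le> M \<Longrightarrow> \<eta> \<in> H10 \<Longrightarrow>
      mean_form (\<tau> (m - 1)) (\<tau> m) (U 0) \<eta> = ip (A m) \<eta>"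
begin

abbreviation "k \<equiv> step \<tau>"
abbreviation "B m \<equiv> mean_form (\<tau> (m - 1)) (\<tau> m)"

lemma \<tau>_less: "l < m \<Longrightarrow> m \<le> M \<Longrightarrow> \<tau> l < \<tau> m"
proof (induction m)
  case (Suc m)
  then show ?case using \<tau>_mono[of m] by (cases "l = m") auto
qed simp

lemma \<tau>_le: "l \<le> m \<Longrightarrow> m \<le> M \<Longrightarrow> \<tau> l \<le> \<tau> m"
  using \<tau>_less[of l m] by (cases "l = m") auto

lemma \<tau>_range: "m \<le> M \<Longrightarrow> 0 \<le> \<tau> m \<and> \<tau> m \<le> T"
  using \<tau>_le[of 0 m] \<tau>_le[of m M] \<tau>_0 \<tau>_M by simp

lemma k_pos: "1 \<le> m \<Longrightarrow> m \<le> M \<Longrightarrow> 0 < k m"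
  using \<tau>_less[of "m - 1" m] by (simp add: step_def)

lemma interval: "1 \<le> m \<Longrightarrow> m \<le> M \<Longrightarrow> 0 \<le> \<tau> (m - 1) \<and> \<tau> (m - 1) < \<tau> m \<and> \<tau> m \<le> T"
  using \<tau>_range[of m] \<tau>_range[of "m - 1"] \<tau>_less[of "m - 1" m] by simp

lemma semi_inner_space_B: "1 \<le> m \<Longrightarrow> m \<le> M \<Longrightarrow> semi_inner_space (H10) (B m)"
  using interval by (intro semi_inner_space_mean_form) auto

text \<open>
  The equation determines the operator of the \<open>m\<close>-th interval applied to \<open>U m\<close>; in particular it is
  square integrable.
\<close>
definition AU :: "nat \<Rightarrow> real ^ 'n \<Rightarrow> real"
  where "AU m = (\<lambda>x. F m x - (U m x - U (m - 1) x) / k m)"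

lemma U_L2: "m \<le> M \<Longrightarrow> U m \<in> L2"
  by (intro H10_L2 U)

lemma AU_L2: "1 \<le> m \<Longrightarrow> m \<le> M \<Longrightarrow> AU m \<in> L2"
  unfolding AU_def by (intro L2.diff_mem L2.divide_mem F U_L2) auto

lemma AU_eq:
  assumes m: "1 \<le> m" "m \<le> M" and \<eta>: "\<eta> \<in> H10"
  shows "B m (U m) \<eta> = ip (AU m) \<eta>"
proof -
  have "ip (AU m) \<eta> = ip (F m) \<eta> - ip (\<lambda>x. U m x - U (m - 1) x) \<eta> / k m"
    unfolding AU_def using m F[OF m] U_L2[of m] U_L2[of "m - 1"] H10_L2[OF \<eta>]
    by (simp add: L2.ip_simps L2.mem_intros)
  then have "k m * ip (AU m) \<eta> = k m * ip (F m) \<eta> - ip (\<lambda>x. U m x - U (m - 1) x) \<eta>"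
    using k_pos[OF m] by (simp add: right_diff_distrib)
  with equation[OF m \<eta>] have "k m * B m (U m) \<eta> = k m * ip (AU m) \<eta>" by linarith
  then show ?thesis using k_pos[OF m] by simp
qed

lemma Fn_nonneg: "1 \<le> M \<Longrightarrow> 0 \<le> Fn"
  using L2.seminorm_nonneg[OF F[of 1]] F_norm[of 1] by simp

text \<open>
  Test the \<open>m\<close>-th equation with \<open>U m\<close> and drop the nonnegative energy.
\<close>
lemma U_norm:
  assumes "m \<le> M"
  shows "nrm (U m) \<le> nrm (U 0) + \<tau> m * Fn"
  using assms
proof (induction m)
  case (Suc m)
  let ?u = "U (Suc m)" and ?v = "U m"
  note L = U_L2[of "Suc m"] U_L2[of m] F[of "Suc m"]
  have "k (Suc m) * B (Suc m) ?u ?u \<ge> 0"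
    using k_pos[of "Suc m"] Suc.prems semi_inner_space.ip_nonneg[OF semi_inner_space_B[of "Suc m"] U]
    by (intro mult_nonneg_nonneg) auto
  then have "ip ?u ?u - ip ?v ?u \<le> k (Suc m) * ip (F (Suc m)) ?u"
    using equation[of "Suc m" ?u] Suc.prems U[of "Suc m"] L by (simp add: L2.ip_simps)
  moreover have "ip ?v ?u \<le> nrm ?v * nrm ?u"
    using L2.Cauchy_Schwarz[of ?v \<Omega> ?u] L Suc.prems by simp
  moreover have "k (Suc m) * ip (F (Suc m)) ?u \<le> k (Suc m) * (Fn * nrm ?u)"
  proof (intro mult_left_mono)
    have "ip (F (Suc m)) ?u \<le> nrm (F (Suc m)) * nrm ?u"
      using L2.Cauchy_Schwarz[of "F (Suc m)" \<Omega> ?u] L Suc.prems by simp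
    also have "\<dots> \<le> Fn * nrm ?u"
      using F_norm[of "Suc m"] L Suc.prems by (intro mult_right_mono L2.seminorm_nonneg) auto
    finally show "ip (F (Suc m)) ?u \<le> Fn * nrm ?u" .
  qed (use k_pos[of "Suc m"] Suc.prems in auto)
  ultimately have "(nrm ?u)\<^sup>2 \<le> nrm ?v * nrm ?u + k (Suc m) * (Fn * nrm ?u)"
    using L Suc.prems by (simp add: L2.seminorm_power2)
  then have "nrm ?u * nrm ?u \<le> (nrm ?v + k (Suc m) * Fn) * nrm ?u"
    by (simp add: power2_eq_square algebra_simps)
  moreover have "0 \<le> nrm ?v + k (Suc m) * Fn" "0 \<le> nrm ?u"
    using L2.seminorm_nonneg[of ?v \<Omega>] L2.seminorm_nonneg[of ?u \<Omega>] L Suc.prems k_pos[of "Suc m"] Fn_nonneg by auto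
  ultimately have "nrm ?u \<le> nrm ?v + k (Suc m) * Fn"
    using mult_right_le_imp_le[of "nrm ?u" "nrm ?u" "nrm ?v + k (Suc m) * Fn"]
    by (cases "nrm ?u = 0") auto
  then show ?case using Suc by (simp add: step_def algebra_simps)
qed (simp add: \<tau>_0)

abbreviation "dual_const \<equiv> smoothing_const \<alpha> \<kappa>"

lemma dual_const_pos: "0 < dual_const"
  using \<alpha>_pos \<kappa>_pos by (simp add: smoothing_const_def)

text \<open>
  The coefficients are frozen at the interval \<open>m\<close>, and the scheme with data \<open>\<phi>\<close> is run backwards in time
  from \<open>m\<close> to \<open>1\<close>.  The index shift \<open>l = m + 1 - j\<close> relates it to a forward recursion.  After freezing, \<open>w l\<close>
  plays the role of \<open>A\<^sub>k\<^sub>,\<^sub>m z l\<close>, and \<open>\<tau> m - \<tau> (l - 1)\<close> is the time that has elapsed.  The gradient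
  bound excludes \<open>l = m\<close>, where \<open>w m\<close> is no smoother than \<open>\<phi>\<close>.
\<close>
lemma dual_problem:
  assumes m: "1 \<le> m" "m \<le> M" and \<phi>: "\<phi> \<in> L2"
  obtains z w where "z (m + 1) = \<phi>"
    "\<And>l. 1 \<le> l \<Longrightarrow> l \<le> m \<Longrightarrow> z l \<in> H10"
    "\<And>l. 1 \<le> l \<Longrightarrow> l \<le> m \<Longrightarrow> w l \<in> L2"
    "\<And>l. 1 \<le> l \<Longrightarrow> l < m \<Longrightarrow> w l \<in> H10"
    "\<And>l. 1 \<le> l \<Longrightarrow> l \<le> m \<Longrightarrow> z (l + 1) = (\<lambda>x. z l x + k l * w l x)"
    "\<And>l \<eta>. 1 \<le> l \<Longrightarrow> l \<le> m \<Longrightarrow> \<eta> \<in> H10 \<Longrightarrow> B m (z l) \<eta> = ip (w l) \<eta>"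
    "nrm (z 1) \<le> nrm \<phi>"
    "\<And>l. 1 \<le> l \<Longrightarrow> l \<le> m \<Longrightarrow> (\<tau> m - \<tau> (l - 1)) * nrm (w l) \<le> nrm \<phi>"
    "\<And>l. 1 \<le> l \<Longrightarrow> l < m \<Longrightarrow> gnorm (w l) \<le> dual_const * (\<tau> m - \<tau> (l - 1)) powr (-3/2) * nrm \<phi>"
proof -
  have pq: "0 \<le> \<tau> (m - 1)" "\<tau> (m - 1) < \<tau> m" "\<tau> m \<le> T" using interval[OF m] by auto
  define h where "h j = k (m + 1 - j)" for j
  have h: "0 < h j" if "1 \<le> j" "j \<le> m" for j
    unfolding h_def using that m by (intro k_pos) auto
  obtain v where v0: "v 0 = \<phi>" and v: "\<And>j. 1 \<le> j \<Longrightarrow> j \<le> m \<Longrightarrow> v j \<in> H10"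
    and veq: "\<And>j \<eta>. 1 \<le> j \<Longrightarrow> j \<le> m \<Longrightarrow> \<eta> \<in> H10 \<Longrightarrow>
      B m (v j) \<eta> = ip (\<lambda>x. (v (j - 1) x - v j x) / h j) \<eta>"
    using backward_Euler_exists[OF pq \<phi>, of m h] h by blast
  define y where "y j = (\<lambda>x. (v (j - 1) x - v j x) / h j)" for j
  have vL: "v j \<in> L2" if "j \<le> m" for j
    using v[of j] \<phi> that by (cases "j = 0") (auto simp: v0 intro: H10_L2)
  have h_sum: "(\<Sum>j=1..n. h j) = \<tau> m - \<tau> (m - n)" if "n \<le> m" for n
    using that
  proof (induction n)
    case (Suc n)
    then show ?case by (simp add: h_def step_def)
  qed simp
  have v0L: "v 0 \<in> L2" using v0 \<phi> by simp
  have smooth: "nrm (v n) \<le> nrm \<phi>"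
      "(\<tau> m - \<tau> (m - n)) * nrm (y n) \<le> nrm \<phi>"
      "2 \<le> n \<Longrightarrow> 2 / (3 + \<kappa>)\<^sup>2 * (\<tau> m - \<tau> (m - n)) ^ 3 * B m (y n) (y n) \<le> (nrm \<phi>)\<^sup>2"
    if n: "1 \<le> n" "n \<le> m" for n
  proof -
    have y: "y j = (\<lambda>x. (v (j - 1) x - v j x) / h j)" for j by (simp add: y_def)
    have ratio': "h j \<le> \<kappa> * h (j + 1) \<and> h (j + 1) \<le> \<kappa> * h j" if "1 \<le> j" "j < n" for j
      using ratio[of "m - j"] that n m by (simp add: h_def Suc_diff_le)
    have prems: "0 < h j" "v j \<in> H10" "\<eta> \<in> H10 \<Longrightarrow> B m (v j) \<eta> = ip (y j) \<eta>"
      if "1 \<le> j" "j \<le> n" for j \<eta>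
      using h[of j] v[of j] veq[of j \<eta>] that n by (auto simp: y_def)
    note S = backward_Euler_smoothing[OF pq prems(1) v0L prems(2) y prems(3) n(1), unfolded h_sum[OF n(2)] v0]
    show "nrm (v n) \<le> nrm \<phi>" by (rule S(1))
    show "(\<tau> m - \<tau> (m - n)) * nrm (y n) \<le> nrm \<phi>" by (rule S(2))
    show "2 \<le> n \<Longrightarrow> 2 / (3 + \<kappa>)\<^sup>2 * (\<tau> m - \<tau> (m - n)) ^ 3 * B m (y n) (y n) \<le> (nrm \<phi>)\<^sup>2"
      by (rule S(3)[OF _ _ _ _ _ _ _ _ \<kappa>_pos ratio'])
  qed
  have yH: "y j \<in> H10" if "2 \<le> j" "j \<le> m" for j
  proof -
    interpret b: semi_inner_space "H10" "B m" by (rule semi_inner_space_B[OF m])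
    show ?thesis unfolding y_def using that by (intro b.divide_mem b.diff_mem v) auto
  qed
  show ?thesis
  proof (rule that[of "\<lambda>l. v (m + 1 - l)" "\<lambda>l. y (m + 1 - l)"])
    show "v (m + 1 - (m + 1)) = \<phi>" by (simp add: v0)
    show "nrm (v (m + 1 - 1)) \<le> nrm \<phi>" using smooth(1)[of m] m by simp
    fix l :: nat assume l: "1 \<le> l"
    {
      assume lm: "l \<le> m"
      have n: "1 \<le> m + 1 - l" "m + 1 - l \<le> m" using l lm by auto
      show "v (m + 1 - l) \<in> H10" by (rule v[OF n])
      show "y (m + 1 - l) \<in> L2"
        unfolding y_def using n by (intro L2.divide_mem L2.diff_mem vL) auto
      show "v (m + 1 - (l + 1)) = (\<lambda>x. v (m + 1 - l) x + k l * y (m + 1 - l) x)"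
        using h[OF n] lm by (simp add: y_def h_def)
      show "(\<tau> m - \<tau> (l - 1)) * nrm (y (m + 1 - l)) \<le> nrm \<phi>"
        using smooth(2)[OF n] l lm by simp
      fix \<eta> assume "\<eta> \<in> H10"
      then show "B m (v (m + 1 - l)) \<eta> = ip (y (m + 1 - l)) \<eta>"
        using veq[OF n] by (simp add: y_def)
    next
      assume lm: "l < m"
      have n: "1 \<le> m + 1 - l" "m + 1 - l \<le> m" "2 \<le> m + 1 - l" using l lm by auto
      show yl: "y (m + 1 - l) \<in> H10" by (rule yH[OF n(3,2)])
      define s where "s = \<tau> m - \<tau> (l - 1)"
      have s: "0 < s" using \<tau>_less[of "l - 1" m] l lm m by (simp add: s_def)
      define g where "g = gnorm (y (m + 1 - l))"
      have g0: "0 \<le> g" unfolding g_def by (intro grad.seminorm_nonneg H10_H1 yl)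
      have 1: "2 / (3 + \<kappa>)\<^sup>2 * s ^ 3 * B m (y (m + 1 - l)) (y (m + 1 - l)) \<le> (nrm \<phi>)\<^sup>2"
        using smooth(3)[OF n] l lm by (simp add: s_def)
      have "2 / (3 + \<kappa>)\<^sup>2 * s ^ 3 * (\<alpha> * g\<^sup>2) \<le> 2 / (3 + \<kappa>)\<^sup>2 * s ^ 3 * B m (y (m + 1 - l)) (y (m + 1 - l))"
        unfolding g_def using s mean_form_coercive[OF pq H10_H1[OF yl]] by (intro mult_left_mono) auto
      with 1 have "2 / (3 + \<kappa>)\<^sup>2 * s ^ 3 * (\<alpha> * g\<^sup>2) \<le> (nrm \<phi>)\<^sup>2" by linarith
      then have "g\<^sup>2 \<le> (3 + \<kappa>)\<^sup>2 / (2 * \<alpha>) * (nrm \<phi>)\<^sup>2 / s ^ 3"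
        using s \<alpha>_pos \<kappa>_pos by (simp add: field_simps)
      also have "\<dots> = (dual_const * s powr (-3/2) * nrm \<phi>)\<^sup>2"
      proof -
        have "(s powr (-3/2))\<^sup>2 = 1 / s ^ 3"
          using s by (simp add: power2_eq_square powr_minus_divide powr_realpow flip: powr_add)
        moreover have "dual_const\<^sup>2 = (3 + \<kappa>)\<^sup>2 / (2 * \<alpha>)" using \<alpha>_pos by (simp add: smoothing_const_def)
        ultimately show ?thesis by (simp add: power_mult_distrib)
      qed
      finally have "g \<le> dual_const * s powr (-3/2) * nrm \<phi>"
        by (rule power2_le_imp_le) (use dual_const_pos L2.seminorm_nonneg[OF \<phi>] in simp)
      then show "gnorm (y (m + 1 - l)) \<le> dual_const * (\<tau> m - \<tau> (l - 1)) powr (-3/2) * nrm \<phi>"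
        by (simp add: g_def s_def)
    }
  qed
qed

end

context dG_scheme
begin

text \<open>
  Discrete variation of constants in weak form.  Testing the \<open>l\<close>-th equation with \<open>w l\<close> and using symmetry
  of the frozen form makes \<open>(U l, w (l + 1)) - (U (l - 1), w l)\<close> telescope.  What remains is the source,
  the initial value, and the error of freezing the coefficients; the latter has no term for \<open>l = m\<close>
  because there the frozen form is the true one, and \<open>w m\<close> could not be inserted into it.
\<close>
lemma duality_identity:
  assumes m: "1 \<le> m" "m \<le> M" and \<phi>: "\<phi> \<in> L2"
    and z_last: "z (m + 1) = \<phi>"
    and z: "\<And>l. 1 \<le> l \<Longrightarrow> l \<le> m \<Longrightarrow> z l \<in> H10"
    and w: "\<And>l. 1 \<le> l \<Longrightarrow> l \<le> m \<Longrightarrow> w l \<in> L2"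
    and w_H10: "\<And>l. 1 \<le> l \<Longrightarrow> l < m \<Longrightarrow> w l \<in> H10"
    and z_step: "\<And>l. 1 \<le> l \<Longrightarrow> l \<le> m \<Longrightarrow> z (l + 1) = (\<lambda>x. z l x + k l * w l x)"
    and z_eq: "\<And>l \<eta>. 1 \<le> l \<Longrightarrow> l \<le> m \<Longrightarrow> \<eta> \<in> H10 \<Longrightarrow> B m (z l) \<eta> = ip (w l) \<eta>"
  shows "ip (AU m) \<phi> = (\<Sum>l=1..m. k l * ip (F l) (w l))
    + (\<Sum>l=1..<m. k l * (B m (U l) (w l) - B l (U l) (w l))) + ip (A m) (z 1)"
proof -
  interpret b: semi_inner_space "H10" "B m" by (rule semi_inner_space_B[OF m])
  have step: "ip (U l) (w (l + 1)) - ip (U (l - 1)) (w l)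
      = k l * ip (F l) (w l) + k l * (B m (U l) (w l) - B l (U l) (w l))"
    if l: "1 \<le> l" "l < m" for l
  proof -
    have lM: "l \<le> M" and lm: "l \<le> m" and l1: "1 \<le> l + 1" "l + 1 \<le> m" using l m by auto
    note mem = U[OF lM] U_L2[OF lM] U_L2[of "l - 1"] w_H10[OF l] w[OF l(1) lm] F[OF l(1) lM] z[OF l(1) lm] w[OF l1]
    have "ip (U l) (w (l + 1)) = ip (w (l + 1)) (U l)"
      by (rule L2.ip_commute[OF mem(2,8)])
    also have "\<dots> = B m (z (l + 1)) (U l)" by (rule z_eq[OF l1 U[OF lM], symmetric])
    also have "\<dots> = B m (z l) (U l) + B m (\<lambda>x. k l * w l x) (U l)"
      unfolding z_step[OF l(1) lm] by (rule b.ip_add_left[OF mem(7) b.scale_mem[OF mem(4)] mem(1)])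
    also have "B m (\<lambda>x. k l * w l x) (U l) = k l * B m (U l) (w l)"
      unfolding b.ip_scale_left[OF mem(4,1)] b.ip_commute[OF mem(4,1)] ..
    also have "B m (z l) (U l) = ip (w l) (U l)" by (rule z_eq[OF l(1) lm U[OF lM]])
    also have "\<dots> = ip (U l) (w l)" by (rule L2.ip_commute[OF mem(5,2)])
    finally have "ip (U l) (w (l + 1)) = ip (U l) (w l) + k l * B m (U l) (w l)" .
    moreover have "ip (\<lambda>x. U l x - U (l - 1) x) (w l) + k l * B l (U l) (w l) = k l * ip (F l) (w l)"
      by (rule equation[OF l(1) lM w_H10[OF l]])
    moreover have "ip (\<lambda>x. U l x - U (l - 1) x) (w l) = ip (U l) (w l) - ip (U (l - 1)) (w l)"
      using mem lM by (intro L2.ip_diff_left) auto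
    ultimately show ?thesis by (simp add: right_diff_distrib)
  qed
  have telescope: "ip (U n) (w (n + 1)) - ip (U 0) (w 1)
      = (\<Sum>l=1..n. k l * ip (F l) (w l)) + (\<Sum>l=1..n. k l * (B m (U l) (w l) - B l (U l) (w l)))"
    if "n < m" for n
    using that
  proof (induction n)
    case (Suc n)
    then show ?case using step[of "Suc n"] by simp
  qed simp
  note mem = U_L2[OF m(2)] U_L2[of "m - 1"] w[OF m(1) order_refl] F[OF m] z[OF m(1) order_refl]
    H10_L2[OF z[OF m(1) order_refl]] AU_L2[OF m]
  have \<phi>_eq: "\<phi> = (\<lambda>x. z m x + k m * w m x)"
    unfolding z_last[symmetric] by (rule z_step[OF m(1) order_refl])
  have "ip (AU m) \<phi> = ip (AU m) (z m) + k m * ip (AU m) (w m)"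
    unfolding \<phi>_eq using mem by (simp add: L2.ip_simps L2.mem_intros)
  also have "ip (AU m) (z m) = ip (U m) (w m)"
  proof -
    have "ip (AU m) (z m) = B m (U m) (z m)" by (rule AU_eq[OF m mem(5), symmetric])
    also have "\<dots> = B m (z m) (U m)" by (rule b.ip_commute[OF U[OF m(2)] mem(5)])
    also have "\<dots> = ip (w m) (U m)" by (rule z_eq[OF m(1) order_refl U[OF m(2)]])
    also have "\<dots> = ip (U m) (w m)" by (rule L2.ip_commute[OF mem(3,1)])
    finally show ?thesis .
  qed
  also have "k m * ip (AU m) (w m)
      = k m * ip (F m) (w m) - ip (U m) (w m) + ip (U (m - 1)) (w m)"
  proof -
    have "ip (AU m) (w m)
        = ip (F m) (w m) - (ip (U m) (w m) - ip (U (m - 1)) (w m)) / k m"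
      unfolding AU_def using mem m by (simp add: L2.ip_simps L2.mem_intros)
    moreover have alg: "k m * (r - d / k m) = k m * r - d" for r d
      using k_pos[OF m] by (simp add: right_diff_distrib)
    ultimately have "k m * ip (AU m) (w m)
        = k m * ip (F m) (w m) - (ip (U m) (w m) - ip (U (m - 1)) (w m))"
      by (simp only: alg)
    then show ?thesis by linarith
  qed
  also have "ip (U (m - 1)) (w m) = ip (U 0) (w 1)
      + ((\<Sum>l=1..m-1. k l * ip (F l) (w l)) + (\<Sum>l=1..m-1. k l * (B m (U l) (w l) - B l (U l) (w l))))"
    using telescope[of "m - 1"] m by simp
  also have "ip (U 0) (w 1) = ip (A m) (z 1)"
  proof -
    have z1: "z 1 \<in> H10" "w 1 \<in> L2" using z[of 1] w[of 1] m by auto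
    have "ip (w 1) (U 0) = B m (z 1) (U 0)" using z_eq[of 1 "U 0"] m U[of 0] by simp
    also have "\<dots> = B m (U 0) (z 1)" using z1 U[of 0] by (intro b.ip_commute) auto
    also have "\<dots> = ip (A m) (z 1)" by (rule A_eq[OF m z1(1)])
    finally show ?thesis using L2.ip_commute[OF U_L2[of 0] z1(2)] by (metis le0)
  qed
  finally have main: "ip (AU m) \<phi> = ip (U m) (w m)
      + (k m * ip (F m) (w m) - ip (U m) (w m) + (ip (A m) (z 1)
      + ((\<Sum>l=1..m-1. k l * ip (F l) (w l)) + (\<Sum>l=1..m-1. k l * (B m (U l) (w l) - B l (U l) (w l))))))" .
  have ivl: "{1..<m} = {1..m-1}" using m by auto
  have last: "(\<Sum>l=1..m. f l) = (\<Sum>l=1..m-1. f l) + f m" for f :: "nat \<Rightarrow> real"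
    using m sum.cl_ivl_Suc[of f 1 "m - 1"] by simp
  show ?thesis unfolding main ivl last by linarith
qed

text \<open>
  The duality identity with \<open>\<phi>\<close> equal to \<open>AU m\<close> itself.  Each frozen-coefficient error is at most
  \<open>\<omega>\<close> of the elapsed time times two gradient norms, and the smoothing of the dual problem supplies
  the power \<open>-3/2\<close> that matches the Dini condition.
\<close>
lemma AU_bound:
  assumes m: "1 \<le> m" "m \<le> M" and E: "\<And>l. 1 \<le> l \<Longrightarrow> l \<le> M \<Longrightarrow> gnorm (U l) \<le> E" "0 \<le> E"
  shows "nrm (AU m) \<le> Fn * (\<Sum>l=1..m. k l / (\<tau> m - \<tau> (l - 1)))
    + coeff_count * dual_const * E * (\<Sum>l=1..<m. k l * (\<omega> (\<tau> m - \<tau> (l - 1)) * (\<tau> m - \<tau> (l - 1)) powr (-3/2))) + Gn"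
proof -
  define \<phi> where "\<phi> = AU m"
  have \<phi>: "\<phi> \<in> L2" unfolding \<phi>_def by (rule AU_L2[OF m])
  define P where "P = nrm \<phi>"
  have P: "0 \<le> P" unfolding P_def by (rule L2.seminorm_nonneg[OF \<phi>])
  define s where "s l = \<tau> m - \<tau> (l - 1)" for l
  have s: "0 < s l" "s l \<le> T" if "1 \<le> l" "l \<le> m" for l
  proof -
    have "l - 1 < m" "l - 1 \<le> M" using that m by auto
    then show "0 < s l" "s l \<le> T"
      using \<tau>_less[of "l - 1" m] \<tau>_range[of m] \<tau>_range[of "l - 1"] m by (auto simp: s_def)
  qed
  obtain z w where z_last: "z (m + 1) = \<phi>"
    and z: "\<And>l. 1 \<le> l \<Longrightarrow> l \<le> m \<Longrightarrow> z l \<in> H10"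
    and w: "\<And>l. 1 \<le> l \<Longrightarrow> l \<le> m \<Longrightarrow> w l \<in> L2"
    and w_H10: "\<And>l. 1 \<le> l \<Longrightarrow> l < m \<Longrightarrow> w l \<in> H10"
    and z_step: "\<And>l. 1 \<le> l \<Longrightarrow> l \<le> m \<Longrightarrow> z (l + 1) = (\<lambda>x. z l x + k l * w l x)"
    and z_eq: "\<And>l \<eta>. 1 \<le> l \<Longrightarrow> l \<le> m \<Longrightarrow> \<eta> \<in> H10 \<Longrightarrow> B m (z l) \<eta> = ip (w l) \<eta>"
    and z1: "nrm (z 1) \<le> P"
    and w_bound: "\<And>l. 1 \<le> l \<Longrightarrow> l \<le> m \<Longrightarrow> s l * nrm (w l) \<le> P"
    and w_grad: "\<And>l. 1 \<le> l \<Longrightarrow> l < m \<Longrightarrow> gnorm (w l) \<le> dual_const * s l powr (-3/2) * P"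
    unfolding s_def P_def by (rule dual_problem[OF m \<phi>]) blast
  have id: "ip \<phi> \<phi> = (\<Sum>l=1..m. k l * ip (F l) (w l))
    + (\<Sum>l=1..<m. k l * (B m (U l) (w l) - B l (U l) (w l))) + ip (A m) (z 1)"
    using duality_identity[OF m \<phi> z_last z w w_H10 z_step z_eq] by (simp add: \<phi>_def)
  have 1: "(\<Sum>l=1..m. k l * ip (F l) (w l)) \<le> (\<Sum>l=1..m. Fn * (k l / s l) * P)"
  proof (rule sum_mono)
    fix l assume "l \<in> {1..m}"
    then have l: "1 \<le> l" "l \<le> m" "l \<le> M" using m by auto
    have wl: "nrm (w l) \<le> P / s l" using w_bound[OF l(1,2)] s[OF l(1,2)] by (simp add: field_simps)
    have "ip (F l) (w l) \<le> nrm (F l) * nrm (w l)"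
      using L2.Cauchy_Schwarz[OF F[OF l(1,3)] w[OF l(1,2)]] by linarith
    also have "\<dots> \<le> Fn * (P / s l)"
      using F_norm[OF l(1,3)] wl L2.seminorm_nonneg[OF F[OF l(1,3)]] L2.seminorm_nonneg[OF w[OF l(1,2)]]
      by (intro mult_mono) auto
    finally have "k l * ip (F l) (w l) \<le> k l * (Fn * (P / s l))"
      using k_pos[OF l(1,3)] by (intro mult_left_mono) auto
    then show "k l * ip (F l) (w l) \<le> Fn * (k l / s l) * P" by (simp add: mult_ac)
  qed
  have 2: "(\<Sum>l=1..<m. k l * (B m (U l) (w l) - B l (U l) (w l)))
      \<le> (\<Sum>l=1..<m. coeff_count * dual_const * E * (k l * (\<omega> (s l) * s l powr (-3/2))) * P)"
  proof (rule sum_mono)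
    fix l assume "l \<in> {1..<m}"
    then have l: "1 \<le> l" "l < m" "l \<le> m" "l \<le> M" using m by auto
    have \<omega>: "0 \<le> \<omega> (s l)" using s[OF l(1,3)] by (intro modulus_nonneg[OF modulus]) auto
    have iv: "0 \<le> \<tau> (l - 1)" "\<tau> (l - 1) < \<tau> l" "\<tau> l \<le> \<tau> (m - 1)" "\<tau> (m - 1) < \<tau> m" "\<tau> m \<le> T"
      using interval[OF l(1,4)] interval[OF m] \<tau>_le[of l "m - 1"] l m by auto
    have "B m (U l) (w l) - B l (U l) (w l) \<le> \<omega> (s l) * coeff_count * (gnorm (U l) * gnorm (w l))"
      using mean_form_modulus[OF iv H10_H1[OF U[OF l(4)]] H10_H1[OF w_H10[OF l(1,2)]]] by (simp add: s_def abs_le_iff)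
    also have "\<dots> \<le> \<omega> (s l) * coeff_count * (E * (dual_const * s l powr (-3/2) * P))"
      using \<omega> coeff_count_pos E(2) E(1)[OF l(1,4)] w_grad[OF l(1,2)] grad.seminorm_nonneg[OF H10_H1[OF w_H10[OF l(1,2)]]]
      by (intro mult_left_mono mult_mono) auto
    finally have "k l * (B m (U l) (w l) - B l (U l) (w l)) \<le> k l * (\<omega> (s l) * coeff_count * (E * (dual_const * s l powr (-3/2) * P)))"
      using k_pos[OF l(1,4)] by (intro mult_left_mono) auto
    then show "k l * (B m (U l) (w l) - B l (U l) (w l)) \<le> coeff_count * dual_const * E * (k l * (\<omega> (s l) * s l powr (-3/2))) * P"
      by (simp add: mult_ac)
  qed
  have 3: "ip (A m) (z 1) \<le> Gn * P"
  proof -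
    have "ip (A m) (z 1) \<le> nrm (A m) * nrm (z 1)"
      using L2.Cauchy_Schwarz[OF A[OF m] H10_L2[OF z[of 1]]] m by simp
    also have "\<dots> \<le> Gn * P"
      using A_norm[OF m] z1 L2.seminorm_nonneg[OF A[OF m]] L2.seminorm_nonneg[OF H10_L2[OF z[of 1]]] m
      by (intro mult_mono) auto
    finally show ?thesis .
  qed
  let ?R = "Fn * (\<Sum>l=1..m. k l / s l) + coeff_count * dual_const * E * (\<Sum>l=1..<m. k l * (\<omega> (s l) * s l powr (-3/2))) + Gn"
  have "P * P = ip \<phi> \<phi>" using L2.seminorm_power2[OF \<phi>] by (simp add: P_def power2_eq_square)
  also have "\<dots> \<le> ?R * P"
    using id 1 2 3 by (simp add: sum_distrib_left sum_distrib_right distrib_right)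
  finally have PP: "P * P \<le> ?R * P" .
  have "0 \<le> ?R"
  proof -
    have "0 \<le> Fn" using Fn_nonneg m by simp
    moreover have "0 \<le> Gn" using order_trans[OF L2.seminorm_nonneg[OF A[OF m]] A_norm[OF m]] .
    moreover have "0 \<le> (\<Sum>l=1..m. k l / s l)"
    proof (rule sum_nonneg)
      fix l assume "l \<in> {1..m}"
      then show "0 \<le> k l / s l" using k_pos[of l] s[of l] m by auto
    qed
    moreover have "0 \<le> (\<Sum>l=1..<m. k l * (\<omega> (s l) * s l powr (-3/2)))"
    proof (rule sum_nonneg)
      fix l assume "l \<in> {1..<m}"
      then show "0 \<le> k l * (\<omega> (s l) * s l powr (-3/2))"
        using k_pos[of l] s[of l] m modulus_nonneg[OF modulus, of "s l"] by auto
    qed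
    ultimately show ?thesis using E(2) coeff_count_pos dual_const_pos
      by (intro add_nonneg_nonneg mult_nonneg_nonneg) auto
  qed
  then have "P \<le> ?R" using PP P mult_right_le_imp_le[of P P ?R] by (cases "P = 0") auto
  then show ?thesis by (simp add: P_def \<phi>_def s_def)
qed

lemma sum_dini:
  assumes m: "1 \<le> m" "m \<le> M"
  shows "(\<Sum>l=1..<m. k l * (\<omega> (\<tau> m - \<tau> (l - 1)) * (\<tau> m - \<tau> (l - 1)) powr (-3/2))) \<le> dini \<omega> T"
proof -
  have "(\<Sum>l=1..<m. k l * (\<omega> (\<tau> m - \<tau> (l - 1)) * (\<tau> m - \<tau> (l - 1)) powr (-3/2)))
      \<le> (\<Sum>l=1..<m. dini \<omega> (\<tau> m - \<tau> (l - 1)) - dini \<omega> (\<tau> m - \<tau> l))"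
  proof (rule sum_mono)
    fix l assume "l \<in> {1..<m}"
    then have l: "1 \<le> l" "l < m" by auto
    have "l - 1 < l" "l - 1 \<le> M" using l m by auto
    then have "0 \<le> \<tau> m - \<tau> l" "\<tau> m - \<tau> l < \<tau> m - \<tau> (l - 1)" "\<tau> m - \<tau> (l - 1) \<le> T"
      using \<tau>_le[of l m] \<tau>_less[of "l - 1" l] \<tau>_range[of m] \<tau>_range[of "l - 1"] l m by auto
    from dini_increment[OF modulus this]
    show "k l * (\<omega> (\<tau> m - \<tau> (l - 1)) * (\<tau> m - \<tau> (l - 1)) powr (-3/2))
        \<le> dini \<omega> (\<tau> m - \<tau> (l - 1)) - dini \<omega> (\<tau> m - \<tau> l)"
      by (simp add: step_def)
  qed
  also have "\<dots> \<le> dini \<omega> T"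
  proof -
    have "(\<Sum>l=1..<n. dini \<omega> (\<tau> m - \<tau> (l - 1)) - dini \<omega> (\<tau> m - \<tau> l)) = dini \<omega> (\<tau> m - \<tau> 0) - dini \<omega> (\<tau> m - \<tau> (n - 1))"
      if "1 \<le> n" for n
      using that
    proof (induction n rule: dec_induct)
      case (step n)
      then show ?case by simp
    qed simp
    moreover have "dini \<omega> (\<tau> m - \<tau> 0) \<le> dini \<omega> T"
      using \<tau>_range[of m] m by (intro dini_mono[OF modulus]) (auto simp: \<tau>_0)
    moreover have "dini \<omega> 0 \<le> dini \<omega> (\<tau> m - \<tau> (m - 1))"
      using interval[OF m] by (intro dini_mono[OF modulus]) auto
    ultimately show ?thesis using m by (simp add: dini_0)
  qed
  finally show ?thesis .
qed

text \<open>
  The terms with \<open>l < m\<close> are bounded by increments of the logarithm through \<open>ln x \<le> x - 1\<close>; the term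
  \<open>l = m\<close> equals 1.
\<close>
lemma sum_log:
  assumes m: "1 \<le> m" "m \<le> M"
  shows "(\<Sum>l=1..m. k l / (\<tau> m - \<tau> (l - 1))) \<le> 1 + ln (T / k m)"
proof -
  define s where "s l = \<tau> m - \<tau> (l - 1)" for l
  have s: "0 < s l" if "l \<le> m" for l using \<tau>_less[of "l - 1" m] that m by (auto simp: s_def)
  have "(\<Sum>l=1..<m. k l / s l) \<le> (\<Sum>l=1..<m. ln (s l) - ln (s (l + 1)))"
  proof (rule sum_mono)
    fix l assume "l \<in> {1..<m}"
    then have l: "1 \<le> l" "l \<le> m" "l + 1 \<le> m" by auto
    have "ln (s (l + 1) / s l) \<le> s (l + 1) / s l - 1"
      using s[OF l(2)] s[OF l(3)] by (intro ln_le_minus_one) simp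
    moreover have "s (l + 1) / s l - 1 = - (k l / s l)"
      using s[OF l(2)] by (simp add: s_def step_def field_simps)
    moreover have "ln (s (l + 1) / s l) = ln (s (l + 1)) - ln (s l)" using s[OF l(2)] s[OF l(3)] by (simp add: ln_div)
    ultimately show "k l / s l \<le> ln (s l) - ln (s (l + 1))" by linarith
  qed
  also have "\<dots> = ln (s 1) - ln (s m)"
    using m(1) by (induction m rule: dec_induct) auto
  also have "\<dots> = ln (\<tau> m / k m)"
    using s[of 1] s[of m] m k_pos[OF m] by (simp add: s_def step_def \<tau>_0 ln_div)
  also have "\<dots> \<le> ln (T / k m)"
    using k_pos[OF m] \<tau>_range[OF m(2)] s[of 1] m by (subst ln_le_cancel_iff) (auto simp: s_def \<tau>_0 divide_right_mono)
  finally have "(\<Sum>l=1..<m. k l / s l) \<le> ln (T / k m)" .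
  moreover have "{1..m} = insert m {1..<m}" using m by auto
  then have "(\<Sum>l=1..m. k l / s l) = (\<Sum>l=1..<m. k l / s l) + k m / s m" by simp
  moreover have "k m / s m = 1" using k_pos[OF m] by (simp add: s_def step_def)
  ultimately show ?thesis by (simp add: s_def)
qed

text \<open>
  Let \<open>X\<close> be the maximum of \<open>\<parallel>AU m\<parallel>\<close>.  Coercivity bounds the squared gradient of \<open>U l\<close> by
  \<open>\<parallel>AU l\<parallel> \<parallel>U l\<parallel> / \<alpha>\<close>, and \<open>\<parallel>U l\<parallel>\<close> is under control by the energy estimate and Poincare's
  inequality for the initial value.  Hence the freezing error is at most a multiple of \<open>sqrt X\<close> and is
  absorbed by the left-hand side.
\<close>
theorem discrete_estimate:
  assumes M: "1 \<le> M" and P: "0 < P" "\<And>u. u \<in> H10 \<Longrightarrow> nrm u \<le> P * gnorm u"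
    and L: "\<And>m. 1 \<le> m \<Longrightarrow> m \<le> M \<Longrightarrow> 1 + ln (T / k m) \<le> L"
    and m: "1 \<le> m" "m \<le> M"
  defines "D \<equiv> (coeff_count * dual_const * dini \<omega> T)\<^sup>2 / \<alpha>"
  shows "nrm (AU m) \<le> 2 * (L * Fn + Gn) + D * (P\<^sup>2 / \<alpha> * Gn + T * Fn)"
proof -
  define X where "X = (MAX m\<in>{1..M}. nrm (AU m))"
  have X: "nrm (AU l) \<le> X" if "1 \<le> l" "l \<le> M" for l
    unfolding X_def using that by (intro Max_ge) auto
  obtain m0 where m0: "1 \<le> m0" "m0 \<le> M" "X = nrm (AU m0)"
  proof -
    have "X \<in> (\<lambda>m. nrm (AU m)) ` {1..M}" unfolding X_def using M by (intro Max_in) auto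
    then show ?thesis using that by auto
  qed
  have X0: "0 \<le> X" unfolding m0(3) by (rule L2.seminorm_nonneg[OF AU_L2[OF m0(1,2)]])
  have Fn: "0 \<le> Fn" by (rule Fn_nonneg[OF M])
  have Gn: "0 \<le> Gn" using order_trans[OF L2.seminorm_nonneg[OF A[OF m]] A_norm[OF m]] .
  have u0: "nrm (U 0) \<le> P\<^sup>2 / \<alpha> * Gn"
  proof -
    define g n where "g = gnorm (U 0)" and "n = nrm (U 0)"
    have g: "0 \<le> g" "0 \<le> n" unfolding g_def n_def
      by (intro grad.seminorm_nonneg H10_H1 U L2.seminorm_nonneg U_L2; simp)+
    have n: "n \<le> P * g" unfolding n_def g_def by (intro P U) simp
    have "\<alpha> * g\<^sup>2 \<le> B m (U 0) (U 0)"
      unfolding g_def using interval[OF m] U[of 0] by (intro mean_form_coercive H10_H1) auto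
    also have "\<dots> = ip (A m) (U 0)" using A_eq[OF m U[of 0]] by simp
    also have "\<dots> \<le> nrm (A m) * n"
      unfolding n_def using L2.Cauchy_Schwarz[OF A[OF m] U_L2[of 0]] by simp
    also have "\<dots> \<le> Gn * (P * g)"
      using A_norm[OF m] L2.seminorm_nonneg[OF A[OF m]] n g by (intro mult_mono) auto
    finally have "\<alpha> * g * g \<le> Gn * P * g" by (simp add: power2_eq_square mult_ac)
    then have "\<alpha> * g \<le> Gn * P"
      using g Gn P(1) mult_right_le_imp_le[of "\<alpha> * g" g "Gn * P"] by (cases "g = 0") auto
    then have Pg: "P * (\<alpha> * g) \<le> P * (Gn * P)" using P(1) by (intro mult_left_mono) auto
    have "\<alpha> * n \<le> \<alpha> * (P * g)" using n \<alpha>_pos by (intro mult_left_mono) auto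
    also have "\<dots> = P * (\<alpha> * g)" by (rule mult.left_commute)
    also note Pg
    finally have "\<alpha> * n \<le> P * (Gn * P)" .
    then show ?thesis using \<alpha>_pos by (simp add: n_def field_simps power2_eq_square)
  qed
  define Y where "Y = P\<^sup>2 / \<alpha> * Gn + T * Fn"
  have Y: "nrm (U l) \<le> Y" if "l \<le> M" for l
    using U_norm[OF that] u0 mult_right_mono[OF conjunct2[OF \<tau>_range[OF that]] Fn] by (simp add: Y_def)
  have Y0: "0 \<le> Y" using Y[of 0] L2.seminorm_nonneg[OF U_L2[of 0]] by simp
  define E where "E = sqrt (X * Y / \<alpha>)"
  have E0: "0 \<le> E" using X0 Y0 \<alpha>_pos by (simp add: E_def)
  have E: "gnorm (U l) \<le> E" if l: "1 \<le> l" "l \<le> M" for l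
  proof (rule power2_le_imp_le[OF _ E0])
    have "\<alpha> * (gnorm (U l))\<^sup>2 \<le> B l (U l) (U l)"
      using interval[OF l] U[OF l(2)] by (intro mean_form_coercive H10_H1) auto
    also have "\<dots> = ip (AU l) (U l)" by (rule AU_eq[OF l U[OF l(2)]])
    also have "\<dots> \<le> nrm (AU l) * nrm (U l)"
      using L2.Cauchy_Schwarz[OF AU_L2[OF l] U_L2[OF l(2)]] by linarith
    also have "\<dots> \<le> X * Y"
      using X[OF l] Y[OF l(2)] X0 L2.seminorm_nonneg[OF U_L2[OF l(2)]] by (intro mult_mono) auto
    finally show "(gnorm (U l))\<^sup>2 \<le> E\<^sup>2"
      using X0 Y0 \<alpha>_pos by (simp add: E_def field_simps)
  qed
  define d where "d = coeff_count * dual_const * dini \<omega> T"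
  have dini_nonneg: "0 \<le> dini \<omega> T" using dini_mono[OF modulus, of 0 T] T_pos by (simp add: dini_0)
  have d0: "0 \<le> d" unfolding d_def using coeff_count_pos dual_const_pos dini_nonneg by simp
  have "X \<le> Fn * (\<Sum>l=1..m0. k l / (\<tau> m0 - \<tau> (l - 1)))
    + coeff_count * dual_const * E * (\<Sum>l=1..<m0. k l * (\<omega> (\<tau> m0 - \<tau> (l - 1)) * (\<tau> m0 - \<tau> (l - 1)) powr (-3/2))) + Gn"
    unfolding m0(3) by (rule AU_bound[OF m0(1,2) E E0])
  also have "\<dots> \<le> Fn * L + coeff_count * dual_const * E * dini \<omega> T + Gn"
    using sum_log[OF m0(1,2)] L[OF m0(1,2)] sum_dini[OF m0(1,2)] Fn coeff_count_pos dual_const_pos E0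
    by (intro add_mono mult_left_mono order_refl) auto
  also have "\<dots> = L * Fn + Gn + d * E" by (simp add: d_def mult_ac)
  finally have XE: "X \<le> L * Fn + Gn + d * E" .
  \<comment> \<open>Young's inequality, weighted so that half of \<open>X\<close> can be absorbed\<close>
  have "2 * (d * E) \<le> X + D * Y"
  proof -
    have "E = sqrt X * sqrt (Y / \<alpha>)" using X0 Y0 by (simp add: E_def real_sqrt_mult[symmetric])
    moreover have "0 \<le> (sqrt X - d * sqrt (Y / \<alpha>))\<^sup>2" by simp
    ultimately have "2 * (d * E) \<le> X + d\<^sup>2 * (Y / \<alpha>)"
      using X0 Y0 \<alpha>_pos by (simp add: power2_diff power_mult_distrib mult_ac)
    then show ?thesis by (simp add: D_def d_def)
  qed
  moreover have "2 * (L * Fn + Gn) = 2 * (L * Fn) + 2 * Gn" by simp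
  ultimately show ?thesis unfolding Y_def[symmetric] using XE X[OF m] by linarith
qed

end

section \<open>From the variational formulation to the scheme\<close>

lemma sets_lebesgue_Ioo: "{0<..<T :: real} \<in> sets lebesgue"
  by simp

context parabolic_problem
begin

lemma a_form_zero_right: "a_form \<Omega> a t w (\<lambda>x. 0) = 0"
proof -
  have "AE x in lebesgue_on \<Omega>. wpart j (\<lambda>x. 0) x = 0" for j
    using weak_partial_scale_AE[OF H1_zero, of j 0] by simp
  then have "AE x in lebesgue_on \<Omega>. \<forall>j. wpart j (\<lambda>x. 0) x = 0"
    by (simp add: AE_all_countable)
  then show ?thesis
    unfolding a_form_def by (intro integral_eq_zero_AE) (auto elim!: eventually_mono)
qed

lemma integral_indicator_Ioc:
  assumes pq: "0 \<le> p" "p < q" "q \<le> T" and g: "continuous_on {p..q} g"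
  shows "(LINT t|lebesgue_on {0<..<T}. indicator {p<..q} t * g t) = (LINT t|lebesgue_on {p<..q}. (g t :: real))"
proof -
  have "integrable lebesgue (\<lambda>t. indicator {p<..q} t *\<^sub>R g t)"
    using integrable_Ioc[OF g] by (simp add: integrable_restrict_space)
  then have int: "integrable lebesgue (\<lambda>t. indicator {p<..q} t * g t)" by simp
  have "(LINT t|lebesgue_on {0<..<T}. indicator {p<..q} t * g t)
      = (LINT t|lebesgue. indicator {0<..<T} t *\<^sub>R (indicator {p<..q} t * g t))"
    by (simp add: integral_restrict_space)
  also have "\<dots> = (LINT t|lebesgue. indicator {p<..q} t *\<^sub>R g t)"
  proof (rule integral_cong_AE)
    have "AE t in lborel. t \<noteq> T" by (rule AE_lborel_singleton)
    then have "AE t in lebesgue. t \<noteq> T" by (rule AE_completion)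
    then show "AE t in lebesgue. indicator {0<..<T} t *\<^sub>R (indicator {p<..q} t * g t) = indicator {p<..q} t *\<^sub>R g t"
      by eventually_elim (use pq in \<open>auto simp: indicator_def\<close>)
    show "(\<lambda>t. indicator {0<..<T} t *\<^sub>R (indicator {p<..q} t * g t)) \<in> borel_measurable lebesgue"
      by (intro borel_measurable_integrable integrable_mult_indicator int) simp
  qed (use int in \<open>simp add: borel_measurable_integrable\<close>)
  also have "\<dots> = (LINT t|lebesgue_on {p<..q}. g t)" by (simp add: integral_restrict_space)
  finally show ?thesis .
qed

lemma Linfty_L2_bound:
  assumes f: "f \<in> Linfty_L2_space {0<..<T} \<Omega>"
  shows "AE t in lebesgue_on {0<..<T}. nrm (f t) \<le> Linfty_L2_norm {0<..<T} \<Omega> f"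
proof -
  let ?E = "esssup (lebesgue_on {0<..<T}) (\<lambda>t. ereal (nrm (f t)))"
  have E: "?E < \<infinity>" using f by (simp add: Linfty_L2_space_def)
  have "AE t in lebesgue_on {0<..<T}. ereal (nrm (f t)) \<le> ?E" by (rule esssup_AE)
  then show ?thesis
  proof eventually_elim
    case (elim t)
    with E show ?case by (cases ?E) (auto simp: Linfty_L2_norm_def)
  qed
qed

lemma Linfty_L2_inner_measurable:
  assumes f: "f \<in> Linfty_L2_space {0<..<T} \<Omega>" and v: "v \<in> L2"
  shows "(\<lambda>t. ip (f t) v) \<in> borel_measurable (lebesgue_on {0<..<T})"
proof -
  obtain s where s: "\<And>n. simple_function (lebesgue_on {0<..<T}) (s n)"
    "\<And>n t. t \<in> {0<..<T} \<Longrightarrow> s n t \<in> L2"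
    "AE t in lebesgue_on {0<..<T}. (\<lambda>n. nrm (\<lambda>x. s n t x - f t x)) \<longlonglongrightarrow> 0"
    using f unfolding Linfty_L2_space_def strongly_measurable_L2_def by blast
  have f_L2: "t \<in> {0<..<T} \<Longrightarrow> f t \<in> L2" for t using f by (simp add: Linfty_L2_space_def)
  have "(\<lambda>t. ip (s n t) v) \<in> borel_measurable (lebesgue_on {0<..<T})" for n
    using simple_function_compose1[OF s(1), of "\<lambda>u. ip u v" n] by (rule borel_measurable_simple_function)
  then have meas: "(\<lambda>t. lim (\<lambda>n. ip (s n t) v)) \<in> borel_measurable (lebesgue_on {0<..<T})"
    by (rule borel_measurable_lim_metric)
  show ?thesis
  proof (rule borel_measurable_lebesgue_on_cong_AE[OF sets_lebesgue_Ioo meas])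
    have "AE t in lebesgue_on {0<..<T}. t \<in> {0<..<T}" by (rule AE_I2) simp
    with s(3) show "AE t in lebesgue_on {0<..<T}. lim (\<lambda>n. ip (s n t) v) = ip (f t) v"
    proof eventually_elim
      case (elim t)
      then show ?case by (intro limI L2.ip_tendsto s f_L2 v)
    qed
  qed
qed

text \<open>
  The mean of the source over \<open>(p, q]\<close>.  It is obtained as the Riesz representer of the averaged
  functional \<open>v \<mapsto> \<integral> (f t, v)\<close>, which avoids a vector-valued integral.
\<close>
lemma source_mean_exists:
  assumes f: "f \<in> Linfty_L2_space {0<..<T} \<Omega>" and pq: "0 \<le> p" "p < q" "q \<le> T"
  obtains F where "F \<in> L2" "nrm F \<le> Linfty_L2_norm {0<..<T} \<Omega> f"
    "\<And>v. v \<in> L2 \<Longrightarrow> (LINT t|lebesgue_on {0<..<T}. indicator {p<..q} t * ip (f t) v) = (q - p) * ip F v"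
proof -
  define N where "N = Linfty_L2_norm {0<..<T} \<Omega> f"
  define \<Lambda> where "\<Lambda> v = (LINT t|lebesgue_on {0<..<T}. indicator {p<..q} t * ip (f t) v)" for v
  have f_L2: "t \<in> {0<..<T} \<Longrightarrow> f t \<in> L2" for t using f by (simp add: Linfty_L2_space_def)
  have const: "integrable (lebesgue_on {0<..<T}) (\<lambda>t. indicator {p<..q} t * (r :: real))"
    and const_int: "(LINT t|lebesgue_on {0<..<T}. indicator {p<..q} t * r) = (q - p) * r" for r
  proof -
    have "integrable lebesgue (\<lambda>t. indicator {p<..q} t *\<^sub>R r)"
      using integrable_Ioc[of p q "\<lambda>t. r"] integrable_restrict_space[of "{p<..q}" lebesgue "\<lambda>t. r"] by simp
    then have "integrable lebesgue (\<lambda>t. indicator {0<..<T} t *\<^sub>R (indicator {p<..q} t *\<^sub>R r))"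
      by (rule integrable_mult_indicator[rotated]) simp
    then have "integrable (lebesgue_on {0<..<T}) (\<lambda>t. indicator {p<..q} t *\<^sub>R r)"
      by (intro integrable_restrict_space[THEN iffD2]) (simp, assumption)
    then show "integrable (lebesgue_on {0<..<T}) (\<lambda>t. indicator {p<..q} t * r)"
      unfolding real_scaleR_def .
    show "(LINT t|lebesgue_on {0<..<T}. indicator {p<..q} t * r) = (q - p) * r"
      by (rule trans[OF integral_indicator_Ioc[OF pq continuous_on_const] integral_const_Ioc[OF less_imp_le[OF pq(2)]]])
  qed
  have bnd: "AE t in lebesgue_on {0<..<T}. \<bar>indicator {p<..q} t * ip (f t) v\<bar> \<le> indicator {p<..q} t * (N * nrm v)"
    if v: "v \<in> L2" for v
  proof -
    have "AE t in lebesgue_on {0<..<T}. t \<in> {0<..<T}" by (rule AE_I2) simp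
    with Linfty_L2_bound[OF f] show ?thesis
    proof eventually_elim
      case (elim t)
      have "\<bar>ip (f t) v\<bar> \<le> nrm (f t) * nrm v"
        by (rule L2.Cauchy_Schwarz[OF f_L2[OF elim(2)] v])
      also have "\<dots> \<le> N * nrm v"
        using elim(1) L2.seminorm_nonneg[OF v] unfolding N_def by (rule mult_right_mono)
      finally show ?case by (simp add: indicator_def)
    qed
  qed
  have int: "integrable (lebesgue_on {0<..<T}) (\<lambda>t. indicator {p<..q} t * ip (f t) v)"
    if v: "v \<in> L2" for v
  proof (rule Bochner_Integration.integrable_bound[OF const[of "N * nrm v"]])
    have "indicator {p<..q} \<in> borel_measurable (lebesgue_on {0<..<T})"
      by (intro measurable_restrict_space1 borel_measurable_indicator) simp
    then show "(\<lambda>t. indicator {p<..q} t * ip (f t) v) \<in> borel_measurable (lebesgue_on {0<..<T})"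
      by (intro borel_measurable_times Linfty_L2_inner_measurable f v)
    show "AE t in lebesgue_on {0<..<T}. norm (indicator {p<..q} t * ip (f t) v) \<le> norm (indicator {p<..q} t * (N * nrm v))"
      using bnd[OF v] by eventually_elim auto
  qed
  have \<Lambda>_bound: "\<bar>\<Lambda> v\<bar> \<le> (q - p) * N * nrm v" if v: "v \<in> L2" for v
  proof -
    have "\<bar>\<Lambda> v\<bar> \<le> (LINT t|lebesgue_on {0<..<T}. \<bar>indicator {p<..q} t * ip (f t) v\<bar>)"
      unfolding \<Lambda>_def by (rule integral_abs_bound)
    also have "\<dots> \<le> (LINT t|lebesgue_on {0<..<T}. indicator {p<..q} t * (N * nrm v))"
      by (intro integral_mono_AE integrable_abs int v const bnd)
    finally show ?thesis unfolding const_int mult.assoc .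
  qed
  define \<Phi> where "\<Phi> v = \<Lambda> v / (q - p)" for v
  obtain F where F: "F \<in> L2" "\<And>v. v \<in> L2 \<Longrightarrow> ip F v = \<Phi> v"
  proof (rule L2.Riesz_representation[OF L2_complete[OF lmeasurable_\<Omega>], of \<Phi> N])
    fix u v :: "real ^ 'n \<Rightarrow> real" and r assume u: "u \<in> L2"
    have "\<Lambda> (\<lambda>x. r * u x) = (LINT t|lebesgue_on {0<..<T}. r * (indicator {p<..q} t * ip (f t) u))"
      unfolding \<Lambda>_def using u by (intro Bochner_Integration.integral_cong refl) (simp add: L2.ip_scale_right f_L2)
    then show "\<Phi> (\<lambda>x. r * u x) = r * \<Phi> u" by (simp add: \<Phi>_def \<Lambda>_def)
    show "\<bar>\<Phi> u\<bar> \<le> N * nrm u" using \<Lambda>_bound[OF u] pq by (simp add: \<Phi>_def field_simps)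
    assume v: "v \<in> L2"
    have "\<Lambda> (\<lambda>x. u x + v x) = (LINT t|lebesgue_on {0<..<T}. indicator {p<..q} t * ip (f t) u
        + indicator {p<..q} t * ip (f t) v)"
      unfolding \<Lambda>_def using u v by (intro Bochner_Integration.integral_cong refl) (simp add: L2.ip_add_right f_L2 distrib_left)
    then show "\<Phi> (\<lambda>x. u x + v x) = \<Phi> u + \<Phi> v"
      using int[OF u] int[OF v] by (simp add: \<Phi>_def \<Lambda>_def add_divide_distrib)
  qed blast
  have F_norm: "nrm F \<le> N"
  proof -
    have N0: "0 \<le> N"
    proof (rule ccontr)
      assume "\<not> 0 \<le> N"
      have "AE t in lebesgue_on {0<..<T}. t \<in> {0<..<T}" by (rule AE_I2) simp
      with Linfty_L2_bound[OF f] have "AE t in lebesgue_on {0<..<T}. False"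
      proof eventually_elim
        case (elim t)
        then show ?case using \<open>\<not> 0 \<le> N\<close> L2.seminorm_nonneg[OF f_L2[OF elim(2)]] by (simp add: N_def)
      qed
      then have "AE t in lebesgue. t \<in> {0<..<T} \<longrightarrow> False" by (simp add: AE_restrict_space_iff)
      then have "AE t in lborel. t \<notin> {0<..<T}" by (simp only: AE_completion_iff) simp
      from AE_lborel_dense[OF this T_pos] show False by auto
    qed
    have "nrm F * nrm F = \<Phi> F" using F L2.seminorm_power2[OF F(1)] by (simp add: power2_eq_square)
    also have "\<dots> \<le> N * nrm F" using \<Lambda>_bound[OF F(1)] pq by (simp add: \<Phi>_def field_simps abs_le_iff)
    finally show ?thesis
      using N0 L2.seminorm_nonneg[OF F(1)] mult_right_le_imp_le[of "nrm F" "nrm F" N]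
      by (cases "nrm F = 0") auto
  qed
  show ?thesis
  proof (rule that[of F])
    fix v assume "v \<in> L2"
    then show "(LINT t|lebesgue_on {0<..<T}. indicator {p<..q} t * ip (f t) v) = (q - p) * ip F v"
      using F(2) pq by (simp add: \<Phi>_def \<Lambda>_def)
  qed (use F F_norm in \<open>auto simp: N_def\<close>)
qed

lemma A_mean_eq: "A_mean \<Omega> a \<tau> m u v = mean_form (\<tau> (m - 1)) (\<tau> m) u v"
  by (simp add: A_mean_def A_op_def mean_form_def time_mean_def)

text \<open>
  The test function that equals \<open>v\<close> on one time interval and vanishes on the others isolates the equation
  of that interval.
\<close>
lemma dG0_interval_equation:
  assumes \<tau>_0: "\<tau> 0 = 0" and \<tau>_M: "\<tau> M = T" and \<tau>_less: "\<And>l m. l < m \<Longrightarrow> m \<le> M \<Longrightarrow> \<tau> l < \<tau> m"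
    and u: "dG0_solution \<Omega> T a M \<tau> f u\<^sub>0 u" and u0: "u\<^sub>0 \<in> L2"
    and U: "\<And>m. U m = (if m = 0 then u\<^sub>0 else u (\<tau> m))"
    and m: "1 \<le> m" "m \<le> M" and v: "v \<in> H10"
  shows "ip (\<lambda>x. U m x - U (m - 1) x) v + step \<tau> m * mean_form (\<tau> (m - 1)) (\<tau> m) (U m) v
    = (LINT t|lebesgue_on {0<..<T}. indicator {\<tau> (m - 1)<..\<tau> m} t * ip (f t) v)"
proof -
  let ?I = "{\<tau> (m - 1)<..\<tau> m}"
  have \<tau>_le: "\<tau> l \<le> \<tau> n" if "l \<le> n" "n \<le> M" for l n using \<tau>_less[of l n] that by (cases "l = n") auto
  have iv: "0 \<le> \<tau> (m - 1)" "\<tau> (m - 1) < \<tau> m" "\<tau> m \<le> T"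
    using \<tau>_le[of 0 "m - 1"] \<tau>_less[of "m - 1" m] \<tau>_le[of m M] m \<tau>_0 \<tau>_M by auto
  have uX: "u \<in> X0_space \<Omega> M \<tau>" using u by (simp add: dG0_solution_def)
  have "\<exists>w\<in>H10. \<forall>t\<in>?I. u t = w"
    using uX m unfolding X0_space_def by auto
  then obtain y where y: "y \<in> H10" "\<And>t. t \<in> ?I \<Longrightarrow> u t = y" by blast
  have "u (\<tau> m) = y" using y(2)[of "\<tau> m"] iv(2) by simp
  with y have um: "u (\<tau> m) \<in> H10" and u_const: "\<And>t. t \<in> ?I \<Longrightarrow> u t = u (\<tau> m)" by simp_all
  define \<phi> where "\<phi> t = (if t \<in> ?I then v else (\<lambda>x. 0))" for t
  have zero: "(\<lambda>x. 0) \<in> H10" by (intro test_functions_H10 test_functions_zero)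
  have \<phi>_I: "\<phi> t = (if l = m then v else (\<lambda>x. 0))" if l: "l \<in> {1..M}" and t: "t \<in> {\<tau> (l - 1)<..\<tau> l}" for l t
  proof (cases "l = m")
    case False
    have M1: "m - 1 \<le> M" "l - 1 \<le> M" using m l by auto
    from False consider "l \<le> m - 1" | "m \<le> l - 1" by linarith
    then have "t \<notin> ?I"
    proof cases
      case 1
      then show ?thesis using \<tau>_le[of l "m - 1"] M1 t by auto
    next
      case 2
      then show ?thesis using \<tau>_le[of m "l - 1"] M1 t by auto
    qed
    then show ?thesis using False unfolding \<phi>_def by (simp only: if_False)
  qed (use t in \<open>simp add: \<phi>_def\<close>)
  have \<phi>_X: "\<phi> \<in> X0_space \<Omega> M \<tau>"
    unfolding X0_space_def using \<phi>_I v zero by auto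
  have \<phi>_node: "\<phi> (\<tau> l) = (if l = m then v else (\<lambda>x. 0))" if "l \<in> {1..M}" for l
    using that \<tau>_less[of "l - 1" l] by (intro \<phi>_I) auto
  have L0: "ip g (\<lambda>x. 0) = 0" for g by (simp add: L2_inner_def)
  have "(LINT t|lebesgue_on {0<..<T}. a_form \<Omega> a t (u t) (\<phi> t))
      = (LINT t|lebesgue_on {0<..<T}. indicator ?I t * a_form \<Omega> a t (u (\<tau> m)) v)"
  proof (rule Bochner_Integration.integral_cong[OF refl])
    fix t
    show "a_form \<Omega> a t (u t) (\<phi> t) = indicator ?I t * a_form \<Omega> a t (u (\<tau> m)) v"
    proof (cases "t \<in> ?I")
      case True
      then show ?thesis unfolding u_const[OF True] by (simp add: \<phi>_def)
    next
      case False
      then show ?thesis by (simp only: \<phi>_def if_False a_form_zero_right indicator_simps mult_zero_left not_False_eq_True)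
    qed
  qed
  also have "\<dots> = (LINT t|lebesgue_on ?I. a_form \<Omega> a t (u (\<tau> m)) v)"
    using iv um v by (intro integral_indicator_Ioc a_form_continuous_sub H10_H1) auto
  also have "\<dots> = step \<tau> m * mean_form (\<tau> (m - 1)) (\<tau> m) (u (\<tau> m)) v"
    using iv by (simp add: mean_form_def time_mean_def step_def)
  finally have form: "(LINT t|lebesgue_on {0<..<T}. a_form \<Omega> a t (u t) (\<phi> t))
      = step \<tau> m * mean_form (\<tau> (m - 1)) (\<tau> m) (u (\<tau> m)) v" .
  have source: "(LINT t|lebesgue_on {0<..<T}. ip (f t) (\<phi> t))
      = (LINT t|lebesgue_on {0<..<T}. indicator ?I t * ip (f t) v)"
    by (intro Bochner_Integration.integral_cong refl) (auto simp: \<phi>_def L0)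
  have "(\<Sum>l=2..M. ip (\<lambda>x. u (\<tau> l) x - u (\<tau> (l - 1)) x) (\<phi> (\<tau> l)))
      = (\<Sum>l=2..M. if l = m then ip (\<lambda>x. u (\<tau> m) x - u (\<tau> (m - 1)) x) v else 0)"
    by (intro sum.cong refl) (auto simp: \<phi>_node L0)
  also have "\<dots> = (if m = 1 then 0 else ip (\<lambda>x. u (\<tau> m) x - u (\<tau> (m - 1)) x) v)"
    using m by (auto simp: sum.delta)
  finally have jumps: "(\<Sum>l=2..M. ip (\<lambda>x. u (\<tau> l) x - u (\<tau> (l - 1)) x) (\<phi> (\<tau> l)))
      = (if m = 1 then 0 else ip (\<lambda>x. u (\<tau> m) x - u (\<tau> (m - 1)) x) v)" .
  have first: "\<phi> (\<tau> 1) = (if m = 1 then v else (\<lambda>x. 0))" using \<phi>_node[of 1] m by auto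
  have eq: "(LINT t|lebesgue_on {0<..<T}. a_form \<Omega> a t (u t) (\<phi> t))
        + (\<Sum>m=2..M. ip (\<lambda>x. u (\<tau> m) x - u (\<tau> (m - 1)) x) (\<phi> (\<tau> m)))
        + ip (u (\<tau> 1)) (\<phi> (\<tau> 1))
        = (LINT t|lebesgue_on {0<..<T}. ip (f t) (\<phi> t))
        + ip u\<^sub>0 (\<phi> (\<tau> 1))"
    using u \<phi>_X unfolding dG0_solution_def by blast
  show ?thesis
  proof (cases "m = 1")
    case True
    then show ?thesis using eq um u0 v unfolding form source jumps first
      by (simp add: U L2.ip_diff_left H10_L2 L0)
  next
    case False
    then show ?thesis using eq m unfolding form source jumps first by (simp add: U L0)
  qed
qed

end

section \<open>The maximal regularity estimate\<close>

text \<open>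
  The polynomial lower bound on the steps makes \<open>ln (T / k)\<close> for a single step \<open>k\<close> comparable with
  \<open>ln (T / h)\<close> for the largest step \<open>h\<close>; since \<open>T / h \<ge> 4 > e\<close>, additive constants are absorbed as well.
\<close>
lemma log_step_bound:
  fixes T c \<beta> k h :: real
  assumes "0 < T" "0 < c" "0 < \<beta>" and h: "0 < h" "4 * h \<le> T" and k: "c * h powr \<beta> \<le> k"
  shows "1 \<le> ln (T / h)"
    and "1 + ln (T / k) \<le> (1 + \<beta> + \<bar>ln T - ln c - \<beta> * ln T\<bar>) * ln (T / h)"
proof -
  have "exp 1 \<le> (3 :: real)" by (rule exp_le)
  also have "3 \<le> T / h" using h by (simp add: field_simps)
  finally show l: "1 \<le> ln (T / h)" using h \<open>0 < T\<close> by (subst ln_ge_iff) auto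
  have c: "0 < c * h powr \<beta>" using \<open>0 < c\<close> h by simp
  then have "ln (c * h powr \<beta>) \<le> ln k" using k by (subst ln_le_cancel_iff) auto
  moreover have "ln (c * h powr \<beta>) = ln c + \<beta> * ln h" using h \<open>0 < c\<close> by (simp add: ln_mult ln_powr)
  moreover have "ln (T / k) = ln T - ln k"
  proof -
    have "0 < k" using c k by linarith
    then show ?thesis using \<open>0 < T\<close> by (simp add: ln_div)
  qed
  ultimately have "ln (T / k) \<le> ln T - ln c - \<beta> * ln h" by linarith
  also have "\<dots> = \<beta> * ln (T / h) + (ln T - ln c - \<beta> * ln T)"
    using h \<open>0 < T\<close> by (simp add: ln_div algebra_simps)
  finally have "1 + ln (T / k) \<le> \<beta> * ln (T / h) + (1 + \<bar>ln T - ln c - \<beta> * ln T\<bar>) * 1" by simp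
  also have "\<dots> \<le> \<beta> * ln (T / h) + (1 + \<bar>ln T - ln c - \<beta> * ln T\<bar>) * ln (T / h)"
    using l by (intro add_left_mono mult_left_mono) auto
  finally show "1 + ln (T / k) \<le> (1 + \<beta> + \<bar>ln T - ln c - \<beta> * ln T\<bar>) * ln (T / h)"
    by (simp add: algebra_simps)
qed

theorem theorem3p12:
  fixes \<Omega> :: "(real ^ 'n::finite) set"
    and T \<alpha> c \<beta> \<kappa> :: real
    and \<omega> :: "real \<Rightarrow> real"
    and a :: "'n \<Rightarrow> 'n \<Rightarrow> real \<Rightarrow> real ^ 'n \<Rightarrow> real"
  assumes "bounded_lipschitz_domain \<Omega>"
    and "T > 0" and "\<alpha> > 0"
    and "admissible_modulus T \<omega>"
    and "admissible_coefficients \<Omega> T \<alpha> \<omega> a"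
    and "c > 0" and "\<beta> > 0" and "\<kappa> > 0"
  shows "\<exists>\<mu> \<delta>\<^sub>0 C :: real. \<mu> > 0 \<and> \<delta>\<^sub>0 > 0 \<and> C > 0 \<and>
    (\<forall>(M::nat) (\<tau> :: nat \<Rightarrow> real).
       admissible_mesh T c \<beta> \<kappa> M \<tau> \<and> step_max M \<tau> - step_min M \<tau> \<le> \<delta>\<^sub>0 \<longrightarrow>
       (\<forall>(f :: real \<Rightarrow> real ^ 'n \<Rightarrow> real) (u\<^sub>0 :: real ^ 'n \<Rightarrow> real) (u :: real \<Rightarrow> real ^ 'n \<Rightarrow> real).
          f \<in> Linfty_L2_space {0<..<T} \<Omega> \<and>
          u\<^sub>0 \<in> H10_space \<Omega> \<and>
          (\<forall>m\<in>{1..M}. functional_in_L2 \<Omega> (A_mean \<Omega> a \<tau> m u\<^sub>0)) \<and>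
          dG0_solution \<Omega> T a M \<tau> f u\<^sub>0 u \<longrightarrow>
          (\<forall>m\<in>{1..M}. functional_in_L2 \<Omega> (A_mean \<Omega> a \<tau> m (u (\<tau> m)))) \<and>
          (MAX m\<in>{1..M}.
             functional_L2_norm \<Omega> (A_mean \<Omega> a \<tau> m (u (\<tau> m)))
             + L2_norm \<Omega> (\<lambda>x. jump \<tau> u\<^sub>0 u (m - 1) x / step \<tau> m))
          \<le> C * exp (\<mu> * T) *
             (ln (T / step_max M \<tau>) * Linfty_L2_norm {0<..<T} \<Omega> f
              + \<mu> * T * (MAX m\<in>{1..M}. functional_L2_norm \<Omega> (A_mean \<Omega> a \<tau> m u\<^sub>0)))))"
proof -
  have \<Omega>: "open \<Omega>" "bounded \<Omega>" using assms(1) by (auto simp: bounded_lipschitz_domain_def)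
  obtain K where K: "\<And>t i j. t \<in> {0..T} \<Longrightarrow> a i j t \<in> borel_measurable (lebesgue_on \<Omega>)"
    "\<And>t. t \<in> {0..T} \<Longrightarrow> AE x in lebesgue_on \<Omega>. slice_bounds K \<alpha> (\<lambda>i j. a i j t) x"
    using admissible_coefficients_slices[OF \<Omega>(1) \<open>T > 0\<close> assms(5)] by blast
  interpret pp: parabolic_problem \<Omega> T \<alpha> K \<omega> a
    by unfold_locales (use \<Omega> assms K in \<open>auto simp: admissible_coefficients_def\<close>)
  obtain P where P: "0 < P" "\<And>u. u \<in> H10_space \<Omega> \<Longrightarrow> L2_norm \<Omega> u \<le> P * grad_norm \<Omega> u"
    using pp.Poincare by blast
  \<comment> \<open>\<open>C1\<close> belongs to the logarithm, \<open>D\<close> to the absorbed freezing error, \<open>Cf\<close> and \<open>Cg\<close> to the source and the initial value\<close>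
  define C1 where "C1 = 1 + \<beta> + \<bar>ln T - ln c - \<beta> * ln T\<bar>"
  define D where "D = (pp.coeff_count * smoothing_const \<alpha> \<kappa> * dini \<omega> T)\<^sup>2 / \<alpha>"
  define Cf where "Cf = 4 * C1 + 2 * D * T + 1"
  define Cg where "Cg = 4 + 2 * D * (P\<^sup>2 / \<alpha>)"
  define C where "C = Cf + Cg / T"
  have C1: "0 < C1" using \<open>\<beta> > 0\<close> by (simp add: C1_def add_pos_nonneg)
  have D: "0 \<le> D" using \<open>\<alpha> > 0\<close> by (simp add: D_def)
  have Cf: "0 < Cf" using C1 D \<open>T > 0\<close> by (simp add: Cf_def add_pos_nonneg)
  have Cg: "0 < Cg" using D P(1) \<open>\<alpha> > 0\<close> by (simp add: Cg_def add_pos_nonneg)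
  have C: "0 < C" "Cf \<le> C" "Cg \<le> C * T"
    using Cf Cg \<open>T > 0\<close> by (auto simp: C_def add_pos_pos distrib_right)
  have main: "(\<forall>m\<in>{1..M}. functional_in_L2 \<Omega> (A_mean \<Omega> a \<tau> m (u (\<tau> m)))) \<and>
      (MAX m\<in>{1..M}. functional_L2_norm \<Omega> (A_mean \<Omega> a \<tau> m (u (\<tau> m)))
         + L2_norm \<Omega> (\<lambda>x. jump \<tau> u\<^sub>0 u (m - 1) x / step \<tau> m))
      \<le> C * exp (1 * T) * (ln (T / step_max M \<tau>) * Linfty_L2_norm {0<..<T} \<Omega> f
          + 1 * T * (MAX m\<in>{1..M}. functional_L2_norm \<Omega> (A_mean \<Omega> a \<tau> m u\<^sub>0)))"
    if mesh: "admissible_mesh T c \<beta> \<kappa> M \<tau>" and f: "f \<in> Linfty_L2_space {0<..<T} \<Omega>"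
      and u0: "u\<^sub>0 \<in> H10_space \<Omega>" and Au0: "\<forall>m\<in>{1..M}. functional_in_L2 \<Omega> (A_mean \<Omega> a \<tau> m u\<^sub>0)"
      and u: "dG0_solution \<Omega> T a M \<tau> f u\<^sub>0 u"
    for M \<tau> f u\<^sub>0 u
  proof -
    have \<tau>: "\<tau> 0 = 0" "\<tau> M = T" "\<And>m. m < M \<Longrightarrow> \<tau> m < \<tau> (Suc m)"
      using mesh by (auto simp: admissible_mesh_def)
    have M: "1 \<le> M" using \<tau>(1,2) \<open>T > 0\<close> by (cases M) auto
    have \<tau>_less: "\<tau> l < \<tau> m" if "l < m" "m \<le> M" for l m
      using that
    proof (induction m)
      case (Suc m)
      then show ?case using \<tau>(3)[of m] by (cases "l = m") auto
    qed simp
    have step_pos: "0 < step \<tau> m" if "1 \<le> m" "m \<le> M" for m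
      using \<tau>_less[of "m - 1" m] that by (simp add: step_def)
    have iv: "0 \<le> \<tau> (m - 1)" "\<tau> (m - 1) < \<tau> m" "\<tau> m \<le> T" if "1 \<le> m" "m \<le> M" for m
    proof -
      have "m - 1 = 0 \<or> 0 < m - 1 \<and> m - 1 \<le> M" "m = M \<or> m < M" "m - 1 < m" using that by auto
      then show "0 \<le> \<tau> (m - 1)" "\<tau> (m - 1) < \<tau> m" "\<tau> m \<le> T"
        using \<tau>_less[of 0 "m - 1"] \<tau>_less[of "m - 1" m] \<tau>_less[of m M] \<tau>(1,2) that by force+
    qed
    have ratio: "step \<tau> m \<le> \<kappa> * step \<tau> (m + 1) \<and> step \<tau> (m + 1) \<le> \<kappa> * step \<tau> m"
      if "1 \<le> m" "m < M" for m
    proof -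
      have "1 / \<kappa> \<le> step \<tau> m / step \<tau> (m + 1)" "step \<tau> m / step \<tau> (m + 1) \<le> \<kappa>"
        using mesh that by (auto simp: admissible_mesh_def)
      then show ?thesis using step_pos[of m] step_pos[of "m + 1"] that \<open>\<kappa> > 0\<close> by (simp add: field_simps)
    qed
    define U where "U m = (if m = 0 then u\<^sub>0 else u (\<tau> m))" for m
    have U: "U m \<in> H10_space \<Omega>" if "m \<le> M" for m
    proof (cases "m = 0")
      case False
      have "u \<in> X0_space \<Omega> M \<tau>" using u by (simp add: dG0_solution_def)
      moreover have "m \<in> {1..M}" using that False by simp
      ultimately obtain w where "w \<in> H10_space \<Omega>" "\<forall>t\<in>{\<tau> (m - 1)<..\<tau> m}. u t = w"
        unfolding X0_space_def by blast
      moreover have "\<tau> m \<in> {\<tau> (m - 1)<..\<tau> m}" using iv(2)[of m] that False by simp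
      ultimately have "u (\<tau> m) \<in> H10_space \<Omega>" by metis
      then show ?thesis using False by (simp add: U_def)
    qed (simp add: U_def u0)
    define N where "N = Linfty_L2_norm {0<..<T} \<Omega> f"
    define good where "good m F \<longleftrightarrow> F \<in> L2_space \<Omega> \<and> L2_norm \<Omega> F \<le> N \<and> (\<forall>v\<in>L2_space \<Omega>.
        (LINT t|lebesgue_on {0<..<T}. indicator {\<tau> (m - 1)<..\<tau> m} t * L2_inner \<Omega> (f t) v) = step \<tau> m * L2_inner \<Omega> F v)"
      for m F
    have good_ex: "\<exists>F. good m F" if "1 \<le> m" "m \<le> M" for m
      unfolding good_def step_def N_def
      by (rule pp.source_mean_exists[OF f iv[OF that]]) blast
    define F where "F m = (SOME F. good m F)" for m
    have good: "good m (F m)" if "1 \<le> m" "m \<le> M" for m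
      unfolding F_def by (rule someI_ex[OF good_ex[OF that]])
    have F: "F m \<in> L2_space \<Omega>" "L2_norm \<Omega> (F m) \<le> N"
      "v \<in> L2_space \<Omega> \<Longrightarrow> (LINT t|lebesgue_on {0<..<T}. indicator {\<tau> (m - 1)<..\<tau> m} t * L2_inner \<Omega> (f t) v)
        = step \<tau> m * L2_inner \<Omega> (F m) v"
      if "1 \<le> m" "m \<le> M" for m v
      using good[OF that] by (auto simp: good_def)
    define A where "A m = (SOME g. represented_by \<Omega> (A_mean \<Omega> a \<tau> m u\<^sub>0) g)" for m
    have A: "represented_by \<Omega> (A_mean \<Omega> a \<tau> m u\<^sub>0) (A m)" if "1 \<le> m" "m \<le> M" for m
    proof -
      have "\<exists>g. represented_by \<Omega> (A_mean \<Omega> a \<tau> m u\<^sub>0) g"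
        using Au0 that by (auto simp: functional_in_L2_def)
      then show ?thesis unfolding A_def by (rule someI_ex)
    qed
    define G where "G = (MAX m\<in>{1..M}. functional_L2_norm \<Omega> (A_mean \<Omega> a \<tau> m u\<^sub>0))"
    have G: "L2_norm \<Omega> (A m) \<le> G" if "1 \<le> m" "m \<le> M" for m
      unfolding G_def pp.represented_by_norm[OF A[OF that], symmetric]
      using that by (intro Max_ge) auto
    interpret s: dG_scheme \<Omega> T \<alpha> K \<omega> a \<kappa> M \<tau> U F A N G
    proof unfold_locales
      fix m \<eta> assume m: "1 \<le> m" "m \<le> M" and \<eta>: "\<eta> \<in> H10_space \<Omega>"
      show "L2_inner \<Omega> (\<lambda>x. U m x - U (m - 1) x) \<eta> + step \<tau> m * pp.mean_form (\<tau> (m - 1)) (\<tau> m) (U m) \<eta>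
          = step \<tau> m * L2_inner \<Omega> (F m) \<eta>"
        using pp.dG0_interval_equation[OF \<tau>(1,2) \<tau>_less u pp.H10_L2[OF u0] U_def m \<eta>] F(3)[OF m pp.H10_L2[OF \<eta>]] by simp
      show "pp.mean_form (\<tau> (m - 1)) (\<tau> m) (U 0) \<eta> = L2_inner \<Omega> (A m) \<eta>"
        using A[OF m] \<eta> by (simp add: represented_by_def pp.A_mean_eq U_def)
    qed (use \<open>\<kappa> > 0\<close> \<tau> ratio U F G A in \<open>auto simp: represented_by_def\<close>)
    define h where "h = step_max M \<tau>"
    have h_ge: "step \<tau> m \<le> h" if "1 \<le> m" "m \<le> M" for m
      unfolding h_def step_max_def using that by (intro Max_ge) auto
    have h: "0 < h" "4 * h \<le> T"
      using step_pos[of 1] h_ge[of 1] M mesh by (auto simp: admissible_mesh_def h_def)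
    have k_ge: "c * h powr \<beta> \<le> step \<tau> m" if "1 \<le> m" "m \<le> M" for m
    proof -
      have "c * h powr \<beta> \<le> step_min M \<tau>" using mesh by (simp add: admissible_mesh_def h_def)
      also have "\<dots> \<le> step \<tau> m" unfolding step_min_def using that by (intro Min_le) auto
      finally show ?thesis .
    qed
    define l where "l = ln (T / h)"
    note log = log_step_bound[OF \<open>T > 0\<close> \<open>c > 0\<close> \<open>\<beta> > 0\<close> h k_ge, folded l_def C1_def]
    have l: "1 \<le> l" using log(1)[of 1] M by simp
    have N0: "0 \<le> N" by (rule s.Fn_nonneg[OF M])
    have G0: "0 \<le> G" using order_trans[OF L2.seminorm_nonneg G[of 1]] A[of 1] M by (simp add: represented_by_def)
    have AU: "L2_norm \<Omega> (s.AU m) \<le> 2 * (C1 * l * N + G) + D * (P\<^sup>2 / \<alpha> * G + T * N)" if m: "1 \<le> m" "m \<le> M" for m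
      unfolding D_def by (rule s.discrete_estimate[OF M P log(2) m])
    have rep: "represented_by \<Omega> (A_mean \<Omega> a \<tau> m (u (\<tau> m))) (s.AU m)" if m: "1 \<le> m" "m \<le> M" for m
      using s.AU_L2[OF m] s.AU_eq[OF m] m by (simp add: represented_by_def pp.A_mean_eq U_def)
    have bound: "functional_L2_norm \<Omega> (A_mean \<Omega> a \<tau> m (u (\<tau> m)))
        + L2_norm \<Omega> (\<lambda>x. jump \<tau> u\<^sub>0 u (m - 1) x / step \<tau> m) \<le> C * exp T * (l * N + T * G)"
      if m: "1 \<le> m" "m \<le> M" for m
    proof -
      have "(\<lambda>x. jump \<tau> u\<^sub>0 u (m - 1) x / step \<tau> m) = (\<lambda>x. F m x - s.AU m x)"
        using m by (auto simp: s.AU_def jump_def U_def fun_eq_iff)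
      then have "L2_norm \<Omega> (\<lambda>x. jump \<tau> u\<^sub>0 u (m - 1) x / step \<tau> m) \<le> N + L2_norm \<Omega> (s.AU m)"
        using L2.seminorm_triangle_diff[OF F(1)[OF m] s.AU_L2[OF m]] F(2)[OF m] by simp
      then have "functional_L2_norm \<Omega> (A_mean \<Omega> a \<tau> m (u (\<tau> m)))
          + L2_norm \<Omega> (\<lambda>x. jump \<tau> u\<^sub>0 u (m - 1) x / step \<tau> m)
          \<le> 2 * (2 * (C1 * l * N + G) + D * (P\<^sup>2 / \<alpha> * G + T * N)) + N"
        using AU[OF m] pp.represented_by_norm[OF rep[OF m]] by argo
      also have "\<dots> = 4 * C1 * (l * N) + (2 * D * T + 1) * (1 * N) + Cg * G"
        by (simp add: Cg_def algebra_simps)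
      also have "\<dots> \<le> 4 * C1 * (l * N) + (2 * D * T + 1) * (l * N) + C * T * G"
        using l N0 G0 D \<open>T > 0\<close> C(3) by (intro add_mono mult_left_mono mult_right_mono order_refl) auto
      also have "\<dots> = Cf * (l * N) + C * T * G" by (simp add: Cf_def algebra_simps)
      also have "\<dots> \<le> C * (l * N) + C * T * G"
        using l N0 C(2) by (intro add_right_mono mult_right_mono) auto
      also have "\<dots> = C * 1 * (l * N + T * G)" by (simp add: algebra_simps)
      also have "\<dots> \<le> C * exp T * (l * N + T * G)"
        using C(1) l N0 G0 \<open>T > 0\<close> by (intro mult_right_mono mult_left_mono) auto
      finally show ?thesis .
    qed
    show ?thesis
    proof
      show "\<forall>m\<in>{1..M}. functional_in_L2 \<Omega> (A_mean \<Omega> a \<tau> m (u (\<tau> m)))"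
        unfolding functional_in_L2_def using rep by (meson atLeastAtMost_iff)
      have "(MAX m\<in>{1..M}. functional_L2_norm \<Omega> (A_mean \<Omega> a \<tau> m (u (\<tau> m)))
         + L2_norm \<Omega> (\<lambda>x. jump \<tau> u\<^sub>0 u (m - 1) x / step \<tau> m)) \<le> C * exp T * (l * N + T * G)"
        using M bound by (intro Max.boundedI) auto
      then show "(MAX m\<in>{1..M}. functional_L2_norm \<Omega> (A_mean \<Omega> a \<tau> m (u (\<tau> m)))
         + L2_norm \<Omega> (\<lambda>x. jump \<tau> u\<^sub>0 u (m - 1) x / step \<tau> m))
        \<le> C * exp (1 * T) * (ln (T / step_max M \<tau>) * Linfty_L2_norm {0<..<T} \<Omega> f
          + 1 * T * (MAX m\<in>{1..M}. functional_L2_norm \<Omega> (A_mean \<Omega> a \<tau> m u\<^sub>0)))"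
        by (simp only: l_def h_def N_def G_def mult_1)
    qed
  qed
  show ?thesis
    by (rule exI[of _ 1], rule exI[of _ 1], rule exI[of _ C])
      (intro conjI[OF zero_less_one conjI[OF zero_less_one conjI[OF C(1)]]] allI impI main; elim conjE; assumption)
qed

end
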